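(* Let $a(y,t)$ be a sufficiently smooth function on $\{(y,t):t\ge0,\ y\in\overline{\Omega(t)}\}$ and let $T$ be the solution of $$\frac{\partial T}{\partial t}(y,t)-\Delta T(y,t)+a(y,t)T(y,t)=0,\quad y\in\Omega(t);\qquad T(y,t)=0,\quad y\in\partial\Omega(t),\ \forall t;\qquad T(y,0)=T_0(y),\quad y\in\Omega_0.$$ Assume that $T_0\in L^2(\Omega_0)$, that $$\alpha(t)\le a(y,t)\qquad\text{for all } y\in\Omega(t)\text{ and all } t,$$ for some smooth function $\alpha(t)$, and that the function $$\gamma(t)=\alpha(t)-C_0(\Omega(t)),$$ where $C_0(\Omega(t))$ is the Poincaré constant in $\Omega(t)$, satisfies, for some $\alpha_1>0$, $$\liminf_{t\to\infty}\frac1t\int_0^t\gamma(s)\,ds>\alpha_1>0.$$ Then $$0\le\int_{\Omega(t)}T^2(y,t)\,dy\le e^{-2\int_0^t\gamma(s)\,ds}\int_{\Omega_0}T_0^2(x)\,dx\longrightarrow0\qquad\text{as } t\to\infty.$$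
   Context: $\Omega_0\subset\mathbb{R}^n$ is a bounded smooth open set (domain). $\vec{V}:\mathbb{R}^n\to\mathbb{R}^n$ is a smooth vector field such that all solutions of the autonomous ODE $\dot Y=\vec{V}(Y)$ are defined for all $t\in\mathbb{R}$. For $t\in\mathbb{R}$, $\phi(t):\mathbb{R}^n\to\mathbb{R}^n$ is the flow map: $\phi(t)x=Y(t;x)$, where $Y(\cdot;x)$ is the solution with $Y(0;x)=x$. The moving domain is $\Omega(t)=\phi(t)\Omega_0$, with $\partial\Omega(t)=\phi(t)\partial\Omega_0$. The Poincaré constant $C_0(\Omega(t))>0$ is the (largest) constant such that $\|\nabla u\|_{L^2(\Omega(t))}^2\ge C_0(\Omega(t))\|u\|_{L^2(\Omega(t))}^2$ for every smooth function $u$ vanishing on $\partial\Omega(t)$. Notion of solution: $T$ is a solution if its pull-back $\overline{T}(x,t)=T(\phi(t)x,t)$ is $C^2$ in $x$ and $C^1$ in $t$ on $\overline{\Omega_0}\times(0,\infty)$ (with these derivatives continuous there), the equation and the boundary condition hold pointwise for $t>0$, and $\overline{T}(\cdot,t)\to T_0$ in $L^2(\Omega_0)$ as $t\to0^+$. *)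

theory Defs
  imports "HOL-Analysis.Analysis"
begin

text \<open>
  These notions of \<open>C\<^sup>k\<close> and \<open>C\<^sup>\<infinity>\<close> are meant for open \<open>S\<close> only, since the derivatives are taken
  \<open>at x\<close>. On an open set, \<open>f\<close> is \<open>C\<^sup>k\<^sup>+\<^sup>1\<close> iff it is differentiable and all its directional
  derivatives are \<open>C\<^sup>k\<close>.
\<close>

primrec Ck_on :: "nat \<Rightarrow> ('a::euclidean_space \<Rightarrow> 'b::real_normed_vector) \<Rightarrow> 'a set \<Rightarrow> bool" where
  "Ck_on 0 f S \<longleftrightarrow> continuous_on S f"
| "Ck_on (Suc k) f S \<longleftrightarrow>
     (\<forall>x\<in>S. f differentiable (at x)) \<and> (\<forall>v. Ck_on k (\<lambda>x. frechet_derivative f (at x) v) S)"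

definition smooth_on :: "('a::euclidean_space \<Rightarrow> 'b::real_normed_vector) \<Rightarrow> 'a set \<Rightarrow> bool" where
  "smooth_on f S \<longleftrightarrow> (\<forall>k. Ck_on k f S)"

definition grad :: "('a::euclidean_space \<Rightarrow> real) \<Rightarrow> 'a \<Rightarrow> 'a" where
  "grad u x = (\<Sum>b\<in>Basis. frechet_derivative u (at x) b *\<^sub>R b)"

text \<open>The Laplacian is the trace of the derivative of the gradient field; as a relation it also
  asserts that \<open>u\<close> is twice differentiable at \<open>y\<close>.\<close>

definition has_laplacian :: "('a::euclidean_space \<Rightarrow> real) \<Rightarrow> real \<Rightarrow> 'a \<Rightarrow> bool" where
  "has_laplacian u L y \<longleftrightarrow>
     (\<exists>g H. (\<forall>\<^sub>F z in nhds y. GDERIV u z :> g z) \<and> (g has_derivative H) (at y) \<and>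
            L = (\<Sum>b\<in>Basis. H b \<bullet> b))"

text \<open>Smoothness of the boundary through local defining functions: near each boundary point the set
  is the strict sublevel set of a smooth function without critical points.\<close>

definition bounded_smooth_open :: "'a::euclidean_space set \<Rightarrow> bool" where
  "bounded_smooth_open \<Omega> \<longleftrightarrow> open \<Omega> \<and> bounded \<Omega> \<and>
     (\<forall>p\<in>frontier \<Omega>. \<exists>U \<rho>. open U \<and> p \<in> U \<and> smooth_on \<rho> U \<and> (\<forall>x\<in>U. grad \<rho> x \<noteq> 0) \<and>
        \<Omega> \<inter> U = {x\<in>U. \<rho> x < (0::real)})"

text \<open>For smooth \<open>V\<close> solutions of \<open>Y' = V Y\<close> are unique, so a \<open>\<phi>\<close> as below exists iff all solutions
  are global, and it is then unique.\<close>

definition is_flow :: "('a::euclidean_space \<Rightarrow> 'a) \<Rightarrow> (real \<Rightarrow> 'a \<Rightarrow> 'a) \<Rightarrow> bool" where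
  "is_flow V \<phi> \<longleftrightarrow>
     (\<forall>x. \<phi> 0 x = x \<and> (\<forall>t. ((\<lambda>s. \<phi> s x) has_vector_derivative V (\<phi> t x)) (at t)))"

definition moving_domain :: "(real \<Rightarrow> 'a \<Rightarrow> 'a) \<Rightarrow> 'a::euclidean_space set \<Rightarrow> real \<Rightarrow> 'a set" where
  "moving_domain \<phi> \<Omega>\<^sub>0 t = \<phi> t ` \<Omega>\<^sub>0"

text \<open>Functions smooth up to the boundary of a bounded smooth \<open>\<Omega>\<close> are the restrictions of smooth
  functions on the whole space, so the test functions are taken globally smooth.\<close>

definition poincare_constant :: "'a::euclidean_space set \<Rightarrow> real" where
  "poincare_constant \<Omega> =
     (GREATEST c. \<forall>u. smooth_on u UNIV \<and> (\<forall>x\<in>frontier \<Omega>. u x = 0) \<longrightarrow>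
        (LINT x|lebesgue_on \<Omega>. (norm (grad u x))\<^sup>2) \<ge> c * (LINT x|lebesgue_on \<Omega>. (u x)\<^sup>2))"

definition in_L2 :: "('a::euclidean_space \<Rightarrow> real) \<Rightarrow> 'a set \<Rightarrow> bool" where
  "in_L2 f \<Omega> \<longleftrightarrow> f \<in> borel_measurable (lebesgue_on \<Omega>) \<and> integrable (lebesgue_on \<Omega>) (\<lambda>x. (f x)\<^sup>2)"

text \<open>\<open>F\<close> is \<open>C\<^sup>2\<close> in \<open>x\<close> and \<open>C\<^sup>1\<close> in \<open>t\<close> on \<open>closure \<Omega>\<^sub>0 \<times> (0,\<infinity>)\<close>, with jointly continuous
  derivatives. Derivatives in \<open>x\<close> are taken within the closure, hence one-sided at the boundary.\<close>

definition C2_C1_on_closure :: "'a::euclidean_space set \<Rightarrow> ('a \<Rightarrow> real \<Rightarrow> real) \<Rightarrow> bool" where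
  "C2_C1_on_closure \<Omega>\<^sub>0 F \<longleftrightarrow>
     (\<exists>(Fx :: 'a \<Rightarrow> real \<Rightarrow> 'a \<Rightarrow>\<^sub>L real) (Fxx :: 'a \<Rightarrow> real \<Rightarrow> 'a \<Rightarrow>\<^sub>L 'a \<Rightarrow>\<^sub>L real) (Ft :: 'a \<Rightarrow> real \<Rightarrow> real).
        (\<forall>x\<in>closure \<Omega>\<^sub>0. \<forall>t>0.
           ((\<lambda>z. F z t) has_derivative blinfun_apply (Fx x t)) (at x within closure \<Omega>\<^sub>0) \<and>
           ((\<lambda>z. Fx z t) has_derivative blinfun_apply (Fxx x t)) (at x within closure \<Omega>\<^sub>0) \<and>
           ((\<lambda>s. F x s) has_real_derivative Ft x t) (at t)) \<and>
        continuous_on (closure \<Omega>\<^sub>0 \<times> {0<..}) (\<lambda>(x, t). F x t) \<and>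
        continuous_on (closure \<Omega>\<^sub>0 \<times> {0<..}) (\<lambda>(x, t). Fx x t) \<and>
        continuous_on (closure \<Omega>\<^sub>0 \<times> {0<..}) (\<lambda>(x, t). Fxx x t) \<and>
        continuous_on (closure \<Omega>\<^sub>0 \<times> {0<..}) (\<lambda>(x, t). Ft x t))"

text \<open>Solutions of \<open>\<partial>\<^sub>t T - \<Delta>T + a T = 0\<close> in the moving domain with homogeneous Dirichlet data. Only
  the values \<open>T y t\<close> with \<open>t \<ge> 0\<close> and \<open>y\<close> in the closure of the domain at time \<open>t\<close> (the open domain
  for \<open>t = 0\<close>) matter. The initial datum is attained in the \<open>L\<^sup>2\<close> sense by the pull-back; the equation
  \<open>T y 0 = T\<^sub>0 y\<close> only fixes the value of \<open>T\<close> at time \<open>0\<close>.\<close>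

definition is_solution ::
  "(real \<Rightarrow> 'a \<Rightarrow> 'a) \<Rightarrow> 'a::euclidean_space set \<Rightarrow> ('a \<Rightarrow> real \<Rightarrow> real) \<Rightarrow> ('a \<Rightarrow> real)
     \<Rightarrow> ('a \<Rightarrow> real \<Rightarrow> real) \<Rightarrow> bool" where
  "is_solution \<phi> \<Omega>\<^sub>0 a T\<^sub>0 T \<longleftrightarrow>
     C2_C1_on_closure \<Omega>\<^sub>0 (\<lambda>x t. T (\<phi> t x) t) \<and>
     (\<forall>t>0. \<forall>y\<in>moving_domain \<phi> \<Omega>\<^sub>0 t.
        \<exists>D L. ((\<lambda>s. T y s) has_real_derivative D) (at t) \<and> has_laplacian (\<lambda>z. T z t) L y \<and>
              D - L + a y t * T y t = 0) \<and>
     (\<forall>t>0. \<forall>y\<in>frontier (moving_domain \<phi> \<Omega>\<^sub>0 t). T y t = 0) \<and>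
     (\<forall>y\<in>\<Omega>\<^sub>0. T y 0 = T\<^sub>0 y) \<and>
     ((\<lambda>t. LINT x|lebesgue_on \<Omega>\<^sub>0. (T (\<phi> t x) t - T\<^sub>0 x)\<^sup>2) \<longlongrightarrow> 0) (at_right 0)"

end

theory Submission
  imports Defs
begin

text \<open>
  Put \<open>w = e\<^sup>A T\<close> with \<open>A(t) = \<integral>\<^sub>0\<^sup>t \<alpha>\<close>, so that \<open>w (\<partial>\<^sub>t w - \<Delta>w) \<le> 0\<close>; since \<open>C\<^sub>0 \<ge> 0\<close>, i.e. \<open>\<gamma> \<le> \<alpha>\<close>, it
  suffices that the \<open>L\<^sup>2\<close> norm of \<open>w\<close> does not increase. Instead of integrating by parts up to the
  moving boundary, extend \<open>w\<close> by zero to \<open>G\<close> and truncate: with \<open>p(s)\<close> the part of \<open>s\<close> exceeding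
  \<open>\<plusminus>\<epsilon>\<close>, the function \<open>p(G)\<close> is supported away from the boundary. Convexity of \<open>p\<^sup>2\<close> gives
  \<open>\<integral>p(G(\<tau>))\<^sup>2 - \<integral>p(G(t))\<^sup>2 \<ge> 2\<integral>p(G(t)) (G(\<tau>) - G(t))\<close>, whose difference quotient tends to
  \<open>2\<integral>p(w) \<partial>\<^sub>t w \<le> 2\<integral>p(w) \<Delta>w\<close>. The last integral is the limit of integrals against the discrete
  Laplacian, which are nonpositive by translation invariance of Lebesgue measure because \<open>p\<close> is
  monotone. The dominated convergence needs bounds on the flow and on its second differences only,
  which follow from Gronwall's inequality, so differentiability of the flow in space is never used.
  At \<open>t = 0\<close> the Lipschitz constant of \<open>\<phi>(t)\<close> tends to 1, which by Vitali's covering theorem bounds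
  the change of volume in the pull-back.
\<close>

section \<open>Smooth bump functions and the Poincare constant\<close>

text \<open>The proof is shaped by a mismatch of coordinates. Derivatives continuous up to the
  boundary are given for the pull-back, whereas the equation holds pointwise in the moving domain,
  with a time derivative and a Laplacian about whose dependence on \<open>y\<close> nothing is
  assumed. Both are therefore treated as pointwise limits of difference quotients of G, which yields
  their measurability; bounds for the quotients come from composing Taylor bounds for the pull-back
  with difference estimates for the inverse flow. Truncation makes such bounds possible: after
  extension by zero, w may have a jump of the gradient at the boundary, so that second differences
  there are only of order h and blow up after division by h^2. Where p(G) is nonzero, all points
  keep a positive distance from the boundary. Convexity gives an inequality instead of a derivative
  of the energy, and it has the useful direction only for \<tau> < t. Monotonicity is therefore
  deduced from one-sided information to the left of each time.\<close>

definition flat_exp :: "nat \<Rightarrow> real \<Rightarrow> real" where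
  "flat_exp m s = (if s > 0 then exp (- 1 / s) / s ^ m else 0)"

lemma flat_exp_tendsto_0: "(flat_exp m \<longlongrightarrow> 0) (at 0)"
proof -
  have "((\<lambda>s. inverse s ^ m / exp (inverse s)) \<longlongrightarrow> (0::real)) (at_right 0)"
    using filterlim_compose[OF tendsto_power_div_exp_0 filterlim_inverse_at_top_right] .
  moreover have "eventually (\<lambda>s. inverse s ^ m / exp (inverse s) = flat_exp m s) (at_right 0)"
    by (auto simp: eventually_at_filter flat_exp_def exp_minus field_simps power_inverse)
  ultimately have r: "(flat_exp m \<longlongrightarrow> 0) (at_right 0)"
    by (rule Lim_transform_eventually)
  have l: "(flat_exp m \<longlongrightarrow> 0) (at_left 0)"
    by (rule tendsto_eventually) (auto simp: eventually_at_filter flat_exp_def)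
  show ?thesis using l r by (simp add: filterlim_split_at)
qed

text \<open>Dividing by powers of s is what makes the family closed under differentiation. At 0 the
  difference quotient of \<open>flat_exp m\<close> is \<open>flat_exp (m + 1)\<close>
  itself.\<close>

lemma DERIV_flat_exp:
  "(flat_exp m has_real_derivative flat_exp (m + 2) s - m * flat_exp (m + 1) s) (at s)"
proof -
  consider "s > 0" | "s < 0" | "s = 0" by linarith
  then show ?thesis
  proof cases
    case 1
    have "((\<lambda>s. exp (- 1 / s) / s ^ m) has_real_derivative
        flat_exp (m + 2) s - m * flat_exp (m + 1) s) (at s)"
    proof (cases m)
      case 0
      then show ?thesis
        using 1 by (auto intro!: derivative_eq_intros simp: flat_exp_def power2_eq_square)
    next
      case (Suc k)
      have "((\<lambda>s. s ^ Suc k) has_real_derivative real (Suc k) * s ^ k) (at s)"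
        using DERIV_pow[of "Suc k" s] by simp
      then show ?thesis
        unfolding Suc using 1
        by (auto intro!: derivative_eq_intros simp: flat_exp_def field_simps power2_eq_square
            simp del: power_Suc) (simp add: field_simps)
    qed
    then show ?thesis
      by (rule has_field_derivative_transform_within_open[where S="{0<..}"])
        (use 1 in \<open>auto simp: flat_exp_def\<close>)
  next
    case 2
    have "((\<lambda>s. 0) has_real_derivative flat_exp (m + 2) s - m * flat_exp (m + 1) s) (at s)"
      using 2 by (simp add: flat_exp_def)
    then show ?thesis
      by (rule has_field_derivative_transform_within_open[where S="{..<0}"])
        (use 2 in \<open>auto simp: flat_exp_def\<close>)
  next
    case 3
    have "(\<lambda>h. (flat_exp m (0 + h) - flat_exp m 0) / h) = flat_exp (m + 1)"
      by (auto simp: flat_exp_def fun_eq_iff)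
    then show ?thesis
      using flat_exp_tendsto_0[of "m + 1"] 3 by (simp add: DERIV_def flat_exp_def)
  qed
qed

text \<open>An algebra of functions that contains the bump functions and is closed under
  differentiation, so its members are smooth.\<close>

inductive_set bump_algebra :: "'a::euclidean_space \<Rightarrow> real \<Rightarrow> ('a \<Rightarrow> real) set"
  for c r where
  const: "(\<lambda>x. k) \<in> bump_algebra c r"
| inner: "(\<lambda>x. inner x v) \<in> bump_algebra c r"
| bump: "(\<lambda>x. flat_exp m (r - inner (x - c) (x - c))) \<in> bump_algebra c r"
| add: "f \<in> bump_algebra c r \<Longrightarrow> g \<in> bump_algebra c r \<Longrightarrow> (\<lambda>x. f x + g x) \<in> bump_algebra c r"
| mult: "f \<in> bump_algebra c r \<Longrightarrow> g \<in> bump_algebra c r \<Longrightarrow> (\<lambda>x. f x * g x) \<in> bump_algebra c r"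

lemma bump_algebra_has_derivative:
  assumes "f \<in> bump_algebra c r"
  shows "\<exists>f'. (\<forall>x. (f has_derivative f' x) (at x)) \<and> (\<forall>v. (\<lambda>x. f' x v) \<in> bump_algebra c r)"
  using assms
proof induction
  case (const k)
  then show ?case
    by (intro exI[of _ "\<lambda>x v. 0"]) (auto intro: bump_algebra.const)
next
  case (inner v)
  then show ?case
    by (intro exI[of _ "\<lambda>x h. inner h v"])
      (auto intro!: derivative_eq_intros bump_algebra.const)
next
  case (bump m)
  let ?q = "\<lambda>x. r - inner (x - c) (x - c)"
  \<comment> \<open>Differences are written as sums with negated terms or constant factors, so that
    the introduction rules of the algebra match the derivative literally.\<close>
  let ?d = "\<lambda>x. flat_exp (m + 2) (?q x) + (- real m) * flat_exp (m + 1) (?q x)"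
  let ?f' = "\<lambda>x h. ?d x * (- 2 * (inner x h + - inner c h))"
  have "((\<lambda>x. flat_exp m (?q x)) has_derivative ?f' x) (at x)" for x
  proof -
    have "(?q has_derivative (\<lambda>h. - 2 * (inner x h + - inner c h))) (at x)"
      by (auto intro!: derivative_eq_intros simp: inner_commute inner_diff_left algebra_simps)
    from has_derivative_compose[OF this
        DERIV_flat_exp[of m "?q x", unfolded has_field_derivative_def]]
    show ?thesis by simp
  qed
  moreover have "(\<lambda>x. ?f' x v) \<in> bump_algebra c r" for v
    by (intro bump_algebra.intros)
  ultimately show ?case by (intro exI[of _ ?f']) simp
next
  case (add f g)
  then obtain f' g' where
    "\<And>x. (f has_derivative f' x) (at x)" "\<And>v. (\<lambda>x. f' x v) \<in> bump_algebra c r"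
    "\<And>x. (g has_derivative g' x) (at x)" "\<And>v. (\<lambda>x. g' x v) \<in> bump_algebra c r"
    by metis
  then show ?case
    by (intro exI[of _ "\<lambda>x v. f' x v + g' x v"])
      (auto intro!: derivative_eq_intros bump_algebra.intros)
next
  case (mult f g)
  then obtain f' g' where
    "\<And>x. (f has_derivative f' x) (at x)" "\<And>v. (\<lambda>x. f' x v) \<in> bump_algebra c r"
    "\<And>x. (g has_derivative g' x) (at x)" "\<And>v. (\<lambda>x. g' x v) \<in> bump_algebra c r"
    by metis
  then show ?case using mult.hyps
    by (intro exI[of _ "\<lambda>x v. f x * g' x v + f' x v * g x"])
      (auto intro!: has_derivative_mult bump_algebra.add bump_algebra.mult)
qed

lemma bump_algebra_smooth_on:
  assumes "f \<in> bump_algebra c r"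
  shows "smooth_on f UNIV"
proof -
  have "Ck_on k f UNIV" for k
    using assms
  proof (induction k arbitrary: f)
    case 0
    then show ?case
      using bump_algebra_has_derivative[OF 0]
      by (metis Ck_on.simps(1) continuous_at_imp_continuous_on has_derivative_continuous)
  next
    case (Suc k)
    obtain f' where f': "\<And>x. (f has_derivative f' x) (at x)" "\<And>v. (\<lambda>x. f' x v) \<in> bump_algebra c r"
      using bump_algebra_has_derivative[OF Suc.prems] by metis
    then have "frechet_derivative f (at x) = f' x" for x
      using frechet_derivative_at by metis
    then show ?case
      using f' Suc.IH by (auto simp: differentiable_def)
  qed
  then show ?thesis by (simp add: smooth_on_def)
qed

lemma exists_smooth_bump:
  fixes \<Omega> :: "'a::euclidean_space set"
  assumes "open \<Omega>" "\<Omega> \<noteq> {}"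
  obtains u :: "'a \<Rightarrow> real" where "smooth_on u UNIV" "\<And>x. x \<notin> \<Omega> \<Longrightarrow> u x = 0"
    "(LINT x|lebesgue_on \<Omega>. (u x)\<^sup>2) > 0"
proof -
  obtain c e where e: "e > 0" "cball c e \<subseteq> \<Omega>"
    using assms open_contains_cball by blast
  define u where "u = (\<lambda>x. flat_exp 0 (e\<^sup>2 - inner (x - c) (x - c)))"
  have sm: "smooth_on u UNIV"
    unfolding u_def by (rule bump_algebra_smooth_on[OF bump_algebra.bump])
  then have cont: "continuous_on UNIV u"
    unfolding smooth_on_def by (metis Ck_on.simps(1))
  have iff: "e\<^sup>2 - inner (x - c) (x - c) > 0 \<longleftrightarrow> x \<in> ball c e" for x
    using e(1) by (auto simp: dist_norm norm_minus_commute abs_less_iff simp flip: power2_norm_eq_inner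
        intro: power2_less_imp_less power_strict_mono)
  have pos: "x \<in> ball c e \<Longrightarrow> u x > 0" and zero: "x \<notin> ball c e \<Longrightarrow> u x = 0" for x
    using iff[of x] by (auto simp: u_def flat_exp_def)
  have zero_out: "u x = 0" if "x \<notin> \<Omega>" for x
    using zero[of x] e(2) ball_subset_cball[of c e] that by blast
  have bd: "0 \<le> u x" "u x \<le> 1" for x
    by (auto simp: u_def flat_exp_def)
  have bo: "u \<in> borel_measurable lebesgue"
    using cont by (simp add: borel_measurable_continuous_onI measurable_completion)
  have "(LINT x|lebesgue_on \<Omega>. (u x)\<^sup>2) = (LINT x|lebesgue. indicator \<Omega> x *\<^sub>R (u x)\<^sup>2)"
    using assms by (subst integral_restrict_space) auto
  also have "\<dots> = (LINT x|lebesgue. (u x)\<^sup>2)"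
    using zero_out by (intro Bochner_Integration.integral_cong) (auto simp: indicator_def)
  also have "\<dots> > 0"
  proof -
    have ib: "integrable lebesgue (indicator (cball c e) :: 'a \<Rightarrow> real)"
      using emeasure_lborel_cball_finite[of c e] by (simp add: integrable_indicator_iff)
    have int: "integrable lebesgue (\<lambda>x. (u x)\<^sup>2)"
      using bd zero by (intro Bochner_Integration.integrable_bound[OF ib])
        (auto simp: bo indicator_def power_le_one intro!: borel_measurable_power AE_I2)
    have "(LINT x|lebesgue. (u x)\<^sup>2) \<noteq> 0"
    proof
      assume "(LINT x|lebesgue. (u x)\<^sup>2) = 0"
      then have "AE x in lebesgue. (u x)\<^sup>2 = 0"
        using integral_nonneg_eq_0_iff_AE[OF int] by simp
      then have "AE x in lebesgue. x \<notin> ball c e"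
        by eventually_elim (use pos in force)
      then have "negligible (ball c e)"
        by (simp add: AE_iff_null negligible_iff_null_sets ball_def)
      then show False
        using e(1) open_not_negligible[of "ball c e"] by auto
    qed
    then show ?thesis
      by (simp add: order_less_le)
  qed
  finally show thesis
    using that[OF sm zero_out] by blast
qed

text \<open>\<open>GREATEST\<close> is meaningful only if the maximum is attained: a bump function bounds the admissible
  constants, and their set is closed.\<close>

lemma poincare_constant_nonneg:
  fixes \<Omega> :: "'a::euclidean_space set"
  assumes "open \<Omega>" "\<Omega> \<noteq> {}"
  shows "0 \<le> poincare_constant \<Omega>"
proof -
  define N where "N = (\<lambda>u::'a\<Rightarrow>real. LINT x|lebesgue_on \<Omega>. (u x)\<^sup>2)"
  define D where "D = (\<lambda>u::'a\<Rightarrow>real. LINT x|lebesgue_on \<Omega>. (norm (grad u x))\<^sup>2)"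
  define test where "test = (\<lambda>u::'a\<Rightarrow>real. smooth_on u UNIV \<and> (\<forall>x\<in>frontier \<Omega>. u x = 0))"
  define P where "P = (\<lambda>c. \<forall>u. test u \<longrightarrow> D u \<ge> c * N u)"
  have pc: "poincare_constant \<Omega> = Greatest P"
    by (simp add: poincare_constant_def P_def test_def N_def D_def)
  have P0: "P 0" by (simp add: P_def D_def)
  obtain u0 where u0: "smooth_on u0 UNIV" "\<And>x. x \<notin> \<Omega> \<Longrightarrow> u0 x = 0" "N u0 > 0"
    using exists_smooth_bump[OF assms] unfolding N_def by metis
  have t0: "test u0"
    using u0 assms by (auto simp: test_def frontier_def interior_open)
  have ub: "c \<le> D u0 / N u0" if "P c" for c
    using that t0 u0(3) by (auto simp: P_def field_simps)
  then have bdd: "bdd_above (Collect P)"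
    by (intro bdd_aboveI[of _ "D u0 / N u0"]) simp
  have "D u \<ge> Sup (Collect P) * N u" if u: "test u" for u
  proof (cases "N u > 0")
    case True
    have "Sup (Collect P) \<le> D u / N u"
    proof (rule cSup_least)
      show "Collect P \<noteq> {}" using P0 by blast
      show "c \<le> D u / N u" if "c \<in> Collect P" for c
        using that u True by (auto simp: P_def pos_le_divide_eq)
    qed
    then show ?thesis using True by (simp add: field_simps)
  next
    case False
    \<comment> \<open>\<open>N u\<close> is never negative: it is the integral of a square, or the
      default 0 if that square is not integrable. The same holds for \<open>D u\<close>.\<close>
    then have "N u = 0" by (simp add: N_def order_less_le)
    then show ?thesis by (simp add: D_def)
  qed
  then have "P (Sup (Collect P))"
    by (simp add: P_def)
  then have "Greatest P = Sup (Collect P)"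
    by (intro Greatest_equality) (auto intro: cSup_upper bdd)
  moreover have "0 \<le> Sup (Collect P)"
    using P0 by (auto intro: cSup_upper bdd)
  ultimately show ?thesis by (simp add: pc)
qed

section \<open>Gronwall estimates for flows\<close>

text \<open>The function exp(-k s) q(s) - m s is nonincreasing. The crude source term m t avoids a
  division by \<open>k\<close>, which may be 0.\<close>

lemma DERIV_affine_le_imp_exp_bound:
  fixes q q' :: "real \<Rightarrow> real"
  assumes q': "\<And>s. 0 \<le> s \<Longrightarrow> s \<le> t \<Longrightarrow> (q has_real_derivative q' s) (at s)"
    and le: "\<And>s. 0 \<le> s \<Longrightarrow> s \<le> t \<Longrightarrow> q' s \<le> k * q s + m"
    and "0 \<le> k" "0 \<le> m" "0 \<le> t"
  shows "q t \<le> exp (k * t) * (q 0 + m * t)"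
proof -
  let ?p = "\<lambda>s. exp (- k * s) * q s - m * s"
  have "?p t \<le> ?p 0"
  proof (rule DERIV_nonpos_imp_nonincreasing[OF \<open>0 \<le> t\<close>])
    fix s assume s: "0 \<le> s" "s \<le> t"
    have d: "(?p has_real_derivative exp (- k * s) * (q' s - k * q s) - m) (at s)"
      by (auto intro!: derivative_eq_intros q' s simp: algebra_simps)
    have "exp (- k * s) * (q' s - k * q s) \<le> exp (- k * s) * m"
      using le[OF s] by (intro mult_left_mono) auto
    also have "\<dots> \<le> 1 * m"
      using assms s by (intro mult_right_mono) auto
    finally show "\<exists>y. (?p has_real_derivative y) (at s) \<and> y \<le> 0"
      using d by (intro exI[of _ "exp (- k * s) * (q' s - k * q s) - m"]) simp
  qed
  then have "exp (k * t) * (exp (- k * t) * q t) \<le> exp (k * t) * (q 0 + m * t)"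
    by (intro mult_left_mono) auto
  then show ?thesis
    by (simp add: mult.assoc[symmetric] exp_add[symmetric])
qed

text \<open>The square is used because the norm itself is not differentiable at 0. The summand 1 in
  the exponent pays for the mixed term, 2 |f| c \<le> |f|^2 + c^2.\<close>

lemma gronwall_norm:
  fixes f :: "real \<Rightarrow> 'a::real_inner"
  assumes f': "\<And>s. 0 \<le> s \<Longrightarrow> s \<le> t \<Longrightarrow> (f has_vector_derivative f' s) (at s)"
    and le: "\<And>s. 0 \<le> s \<Longrightarrow> s \<le> t \<Longrightarrow> norm (f' s) \<le> L * norm (f s) + c"
    and "0 \<le> L" "0 \<le> t"
  shows "(norm (f t))\<^sup>2 \<le> exp ((2 * L + 1) * t) * ((norm (f 0))\<^sup>2 + c\<^sup>2 * t)"
proof -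
  let ?q' = "\<lambda>s. 2 * inner (f s) (f' s)"
  have d: "((\<lambda>s. (norm (f s))\<^sup>2) has_real_derivative ?q' s) (at s)" if "0 \<le> s" "s \<le> t" for s
    using f'[OF that] unfolding power2_norm_eq_inner has_vector_derivative_def has_field_derivative_def
    by (auto intro!: derivative_eq_intros simp: inner_commute fun_eq_iff)
  have "?q' s \<le> (2 * L + 1) * (norm (f s))\<^sup>2 + c\<^sup>2" if "0 \<le> s" "s \<le> t" for s
  proof -
    have "inner (f s) (f' s) \<le> norm (f s) * norm (f' s)"
      by (rule norm_cauchy_schwarz)
    also have "\<dots> \<le> norm (f s) * (L * norm (f s) + c)"
      by (intro mult_left_mono le that) simp
    finally have "?q' s \<le> 2 * L * (norm (f s))\<^sup>2 + 2 * norm (f s) * c"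
      by (simp add: power2_eq_square algebra_simps)
    moreover have "2 * norm (f s) * c \<le> (norm (f s))\<^sup>2 + c\<^sup>2"
      by (rule sum_squares_bound)
    ultimately show ?thesis by (simp add: algebra_simps)
  qed
  from DERIV_affine_le_imp_exp_bound[OF d this] assms show ?thesis by simp
qed

text \<open>These are the bounds that Gronwall's inequality needs: the Lipschitz bound controls
  first differences of the flow, the quadratic remainder controls second differences. All
  assumptions are invariant under reversing the signs of \<open>V\<close>, \<open>V'\<close> and
  time, so every estimate also serves negative times. The group law is not assumed; its instance
  \<open>flow_inverse\<close> is derived from uniqueness.\<close>

locale C11_flow =
  fixes V :: "'a::euclidean_space \<Rightarrow> 'a" and V' :: "'a \<Rightarrow> 'a \<Rightarrow> 'a" and \<phi> :: "real \<Rightarrow> 'a \<Rightarrow> 'a"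
  assumes flow_0: "\<phi> 0 x = x"
    and flow_deriv: "((\<lambda>s. \<phi> s x) has_vector_derivative V (\<phi> t x)) (at t)"
    and linear_V': "linear (V' x)"
    and local_bound: "\<exists>M\<ge>0. \<forall>x\<in>cball 0 R. \<forall>y\<in>cball 0 R. norm (V y - V x) \<le> M * norm (y - x) \<and>
      norm (V y - V x - V' x (y - x)) \<le> M * (norm (y - x))\<^sup>2 \<and> (\<forall>v. norm (V' x v) \<le> M * norm v)"
begin

lemma continuous_flow_time: "continuous_on S (\<lambda>s. \<phi> s x)"
  using flow_deriv has_vector_derivative_continuous
  by (metis continuous_at_imp_continuous_on)

lemma flow_trajectory_bounded: "\<exists>R\<ge>0. \<forall>s\<in>{0..t}. norm (\<phi> s x) \<le> R"
proof -
  have "bounded ((\<lambda>s. \<phi> s x) ` {0..t})"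
    by (intro compact_imp_bounded compact_continuous_image continuous_flow_time) simp
  then obtain R where "\<forall>s\<in>{0..t}. norm (\<phi> s x) \<le> R"
    unfolding bounded_iff by auto
  then show ?thesis by (intro exI[of _ "max R 0"]) auto
qed

lemma solution_unique:
  assumes Y: "\<And>s. (Y has_vector_derivative V (Y s)) (at s)"
    and Z: "\<And>s. (Z has_vector_derivative V (Z s)) (at s)"
    and "Y 0 = Z 0" "0 \<le> t"
  shows "Y t = Z t"
proof -
  have cont: "continuous_on {0..t} Y" "continuous_on {0..t} Z"
    using Y Z has_vector_derivative_continuous by (metis continuous_at_imp_continuous_on)+
  have "bounded (Y ` {0..t} \<union> Z ` {0..t})"
    by (intro compact_imp_bounded compact_Un compact_continuous_image cont) auto
  then obtain R where R: "\<forall>x\<in>Y ` {0..t} \<union> Z ` {0..t}. norm x \<le> R"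
    unfolding bounded_iff by auto
  obtain M where M: "M \<ge> 0" "\<And>x y. x \<in> cball 0 R \<Longrightarrow> y \<in> cball 0 R \<Longrightarrow> norm (V y - V x) \<le> M * norm (y - x)"
    using local_bound by meson
  have "(norm (Y t - Z t))\<^sup>2 \<le> exp ((2 * M + 1) * t) * ((norm (Y 0 - Z 0))\<^sup>2 + 0\<^sup>2 * t)"
  proof (rule gronwall_norm)
    show "norm (V (Y s) - V (Z s)) \<le> M * norm (Y s - Z s) + 0" if "0 \<le> s" "s \<le> t" for s
      using M(2)[of "Z s" "Y s"] R that by auto
  qed (auto intro!: derivative_intros Y Z M \<open>0 \<le> t\<close>)
  then show ?thesis using assms by simp
qed

text \<open>The Lipschitz bound for \<open>V\<close> is available only while the two trajectories stay close; the first
  time at which their distance is 1 contradicts Gronwall's bound.\<close>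

lemma flow_nearby:
  assumes "0 \<le> t"
  shows "\<exists>\<delta>>0. \<forall>x\<in>ball x0 \<delta>. \<forall>s\<in>{0..t}. norm (\<phi> s x - \<phi> s x0) \<le> 1"
proof -
  obtain R where R: "\<forall>s\<in>{0..t}. norm (\<phi> s x0) \<le> R"
    using flow_trajectory_bounded by blast
  obtain M where M: "M \<ge> 0" "\<And>x y. x \<in> cball 0 (R + 1) \<Longrightarrow> y \<in> cball 0 (R + 1) \<Longrightarrow> norm (V y - V x) \<le> M * norm (y - x)"
    using local_bound by meson
  let ?E = "exp ((2 * M + 1) * t)"
  \<comment> \<open>Two properties are wanted: \<delta> < 1 starts the distance below 1, and E
    \<delta>^2 < 1 contradicts Gronwall's bound at the first time where the distance equals
    1.\<close>
  define \<delta> where "\<delta> = 1 / (1 + ?E)"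
  have E: "?E > 0" by simp
  have \<delta>: "\<delta> > 0" "\<delta> < 1" "?E * \<delta>\<^sup>2 < 1"
  proof -
    have "0 < 1 / (1 + e)" "1 / (1 + e) < 1" "e * (1 / (1 + e)) < 1" if "e > 0" for e :: real
      using that by (auto simp: field_simps)
    note * = this[OF E, folded \<delta>_def]
    show "\<delta> > 0" "\<delta> < 1" by (rule *)+
    have "?E * \<delta> < 1" by (rule *)
    then have "(?E * \<delta>) * \<delta> < 1 * \<delta>" using *(1) by (rule mult_strict_right_mono)
    then show "?E * \<delta>\<^sup>2 < 1" using *(2) by (simp add: power2_eq_square mult.assoc)
  qed
  have "norm (\<phi> s x - \<phi> s x0) \<le> 1" if x: "x \<in> ball x0 \<delta>" and s: "s \<in> {0..t}" for x s
  proof (rule ccontr)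
    let ?q = "\<lambda>s. norm (\<phi> s x - \<phi> s x0)"
    have cont: "continuous_on S ?q" for S
      by (intro continuous_intros continuous_flow_time)
    assume "\<not> ?q s \<le> 1"
    moreover have "?q 0 < 1" using x \<delta> by (simp add: flow_0 dist_norm norm_minus_commute)
    ultimately have "\<exists>s'. 0 \<le> s' \<and> s' \<le> s \<and> ?q s' = 1"
      using s by (intro IVT' cont) auto
    then have ne: "{s \<in> {0..t}. ?q s = 1} \<noteq> {}" using s by (auto intro: order_trans)
    define s1 where "s1 = Inf {s \<in> {0..t}. ?q s = 1}"
    have bdd: "bdd_below {s \<in> {0..t}. ?q s = 1}"
      by (auto intro: bdd_belowI[of _ 0])
    have "closed {s \<in> {0..t}. ?q s = 1}"
      using continuous_closed_preimage_constant[OF cont[of "{0..t}"], of 1] by simp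
    then have s1: "s1 \<in> {0..t}" "?q s1 = 1"
      using closed_contains_Inf[OF ne bdd] by (auto simp: s1_def)
    have le1: "?q r \<le> 1" if r: "0 \<le> r" "r \<le> s1" for r
    proof (rule ccontr)
      assume "\<not> ?q r \<le> 1"
      then have "\<exists>s'. 0 \<le> s' \<and> s' \<le> r \<and> ?q s' = 1"
        using r \<open>?q 0 < 1\<close> by (intro IVT' cont) auto
      then obtain s' where s': "0 \<le> s'" "s' \<le> r" "?q s' = 1" by auto
      then have "s1 \<le> s'" unfolding s1_def using r s1 by (intro cInf_lower bdd) auto
      then have "r = s1" using s' r by auto
      then show False using s1 \<open>\<not> ?q r \<le> 1\<close> by simp
    qed
    have "(?q s1)\<^sup>2 \<le> exp ((2 * M + 1) * s1) * ((?q 0)\<^sup>2 + 0\<^sup>2 * s1)"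
    proof (rule gronwall_norm)
      show "norm (V (\<phi> r x) - V (\<phi> r x0)) \<le> M * ?q r + 0" if r: "0 \<le> r" "r \<le> s1" for r
      proof -
        have "norm (\<phi> r x0) \<le> R" using R r s1 by auto
        moreover have "norm (\<phi> r x) \<le> norm (\<phi> r x0) + ?q r"
          by (metis add.commute diff_add_cancel norm_triangle_ineq)
        ultimately show ?thesis
          using M(2)[of "\<phi> r x0" "\<phi> r x"] le1[OF r] by simp
      qed
    qed (use s1 M in \<open>auto intro!: derivative_intros flow_deriv\<close>)
    also have "\<dots> \<le> ?E * \<delta>\<^sup>2"
      using x s1 M by (intro mult_mono)
        (auto simp: flow_0 dist_norm norm_minus_commute intro!: power_mono mult_left_mono)
    finally show False using \<delta> s1 by simp
  qed
  then show ?thesis using \<delta> by blast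
qed

lemma flow_bounded_on_compact:
  assumes "compact K" "0 \<le> t"
  shows "\<exists>R\<ge>0. \<forall>x\<in>K. \<forall>s\<in>{0..t}. norm (\<phi> s x) \<le> R"
proof -
  have "\<exists>\<delta> R. \<delta> > 0 \<and> (\<forall>x\<in>ball x0 \<delta>. \<forall>s\<in>{0..t}. norm (\<phi> s x) \<le> R)" for x0
  proof -
    obtain R where "\<forall>s\<in>{0..t}. norm (\<phi> s x0) \<le> R"
      using flow_trajectory_bounded by blast
    moreover obtain \<delta> where "\<delta> > 0" "\<forall>x\<in>ball x0 \<delta>. \<forall>s\<in>{0..t}. norm (\<phi> s x - \<phi> s x0) \<le> 1"
      using flow_nearby[OF \<open>0 \<le> t\<close>] by blast
    moreover have "norm (\<phi> s x) \<le> norm (\<phi> s x0) + norm (\<phi> s x - \<phi> s x0)" for s x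
      by (metis add.commute diff_add_cancel norm_triangle_ineq)
    ultimately have "\<delta> > 0 \<and> (\<forall>x\<in>ball x0 \<delta>. \<forall>s\<in>{0..t}. norm (\<phi> s x) \<le> R + 1)"
      by (metis add_mono order_trans)
    then show ?thesis by blast
  qed
  then obtain \<delta> R where \<delta>: "\<And>x0. \<delta> x0 > 0"
    and R: "\<And>x0 x s. x \<in> ball x0 (\<delta> x0) \<Longrightarrow> s \<in> {0..t} \<Longrightarrow> norm (\<phi> s x) \<le> R x0"
    by metis
  obtain F where F: "finite F" "K \<subseteq> (\<Union>x0\<in>F. ball x0 (\<delta> x0))"
    by (rule compactE_image[OF \<open>compact K\<close>, of K "\<lambda>x0. ball x0 (\<delta> x0)"]) (use \<delta> in auto)
  \<comment> \<open>The sum of the finitely many bounds replaces their maximum and also covers the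
    case of no balls.\<close>
  have "norm (\<phi> s x) \<le> (\<Sum>x0\<in>F. \<bar>R x0\<bar>)" if x: "x \<in> K" and s: "s \<in> {0..t}" for x s
  proof -
    obtain x0 where x0: "x0 \<in> F" "x \<in> ball x0 (\<delta> x0)" using F x by auto
    then have "norm (\<phi> s x) \<le> \<bar>R x0\<bar>" using R s by (meson abs_ge_self order_trans)
    also have "\<dots> \<le> (\<Sum>x0\<in>F. \<bar>R x0\<bar>)" using x0 F by (intro member_le_sum) auto
    finally show ?thesis .
  qed
  then show ?thesis by (intro exI[of _ "\<Sum>x0\<in>F. \<bar>R x0\<bar>"]) (auto intro: sum_nonneg)
qed

text \<open>The Lipschitz constant is kept as a function of \<open>s\<close> that tends to 1 as
  \<open>s\<close> tends to 0, which the comparison with the initial datum relies on. For the other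
  two estimates any finite constant will do. The estimate at midpoints takes the place of a bound on
  the second spatial derivative of the flow.\<close>

lemma flow_estimates:
  assumes "0 \<le> t"
  obtains C where "0 \<le> C"
    "\<And>x y s. x \<in> cball 0 R \<Longrightarrow> y \<in> cball 0 R \<Longrightarrow> s \<in> {0..t} \<Longrightarrow>
       norm (\<phi> s x - \<phi> s y) \<le> exp (C * s) * norm (x - y)"
    "\<And>x y z s. x \<in> cball 0 R \<Longrightarrow> y \<in> cball 0 R \<Longrightarrow> z \<in> cball 0 R \<Longrightarrow> s \<in> {0..t} \<Longrightarrow>
       x + y = 2 *\<^sub>R z \<Longrightarrow> norm (\<phi> s x + \<phi> s y - 2 *\<^sub>R \<phi> s z) \<le> C * (norm (x - z))\<^sup>2"
    "\<And>x s s'. x \<in> cball 0 R \<Longrightarrow> s \<in> {0..t} \<Longrightarrow> s' \<in> {0..t} \<Longrightarrow> norm (\<phi> s x - \<phi> s' x) \<le> C * \<bar>s - s'\<bar>"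
proof -
  obtain R' where R': "R' \<ge> 0" "\<And>x s. x \<in> cball 0 R \<Longrightarrow> s \<in> {0..t} \<Longrightarrow> norm (\<phi> s x) \<le> R'"
    using flow_bounded_on_compact[OF compact_cball \<open>0 \<le> t\<close>] by blast
  obtain M where M: "M \<ge> 0"
    "\<And>x y. x \<in> cball 0 R' \<Longrightarrow> y \<in> cball 0 R' \<Longrightarrow> norm (V y - V x) \<le> M * norm (y - x)"
    "\<And>x y. x \<in> cball 0 R' \<Longrightarrow> y \<in> cball 0 R' \<Longrightarrow> norm (V y - V x - V' x (y - x)) \<le> M * (norm (y - x))\<^sup>2"
    "\<And>x v. x \<in> cball 0 R' \<Longrightarrow> norm (V' x v) \<le> M * norm v"
    using local_bound[of R'] by blast
  define k where "k = 2 * M + 1"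
  have k: "k \<ge> 0" using M by (simp add: k_def)
  have lip2: "(norm (\<phi> s x - \<phi> s y))\<^sup>2 \<le> exp (k * s) * (norm (x - y))\<^sup>2"
    if x: "x \<in> cball 0 R" "y \<in> cball 0 R" and s: "s \<in> {0..t}" for x y s
  proof -
    have "(norm (\<phi> s x - \<phi> s y))\<^sup>2 \<le> exp ((2 * M + 1) * s) * ((norm (\<phi> 0 x - \<phi> 0 y))\<^sup>2 + 0\<^sup>2 * s)"
    proof (rule gronwall_norm)
      show "norm (V (\<phi> r x) - V (\<phi> r y)) \<le> M * norm (\<phi> r x - \<phi> r y) + 0" if r: "0 \<le> r" "r \<le> s" for r
        using M(2)[of "\<phi> r y" "\<phi> r x"] R'(2)[OF x(1), of r] R'(2)[OF x(2), of r] r s by auto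
    qed (use M s in \<open>auto intro!: derivative_intros flow_deriv\<close>)
    then show ?thesis by (simp add: flow_0 k_def)
  qed
  have lip: "norm (\<phi> s x - \<phi> s y) \<le> exp (k * s) * norm (x - y)"
    if x: "x \<in> cball 0 R" "y \<in> cball 0 R" and s: "s \<in> {0..t}" for x y s
  proof (rule power2_le_imp_le)
    \<comment> \<open>The bound for the squares has the factor exp(k s), whose square root is at
      most exp(k s) itself.\<close>
    have "exp (k * s) \<ge> 1" using k s by auto
    then have "exp (k * s) \<le> (exp (k * s))\<^sup>2" by (simp add: power2_eq_square)
    then have "exp (k * s) * (norm (x - y))\<^sup>2 \<le> (exp (k * s) * norm (x - y))\<^sup>2"
      unfolding power_mult_distrib by (rule mult_right_mono) simp
    then show "(norm (\<phi> s x - \<phi> s y))\<^sup>2 \<le> (exp (k * s) * norm (x - y))\<^sup>2"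
      using lip2[OF that] by linarith
  qed simp
  \<comment> \<open>Two Taylor remainders of V, each at most M times a squared distance, and squared
    distances grow at most by exp(k t).\<close>
  define c where "c = 2 * M * exp (k * t)"
  have c: "c \<ge> 0" using M by (simp add: c_def)
  \<comment> \<open>Gronwall yields exp(k s) (c h)^2 s for the square; this is at most a perfect
    square because exp(k s) \<le> exp(k t)^2 and s \<le> (t + 1)^2.\<close>
  define C2 where "C2 = exp (k * t) * c * (t + 1)"
  have C2: "C2 \<ge> 0" using c assms by (simp add: C2_def)
  have second: "norm (\<phi> s x + \<phi> s y - 2 *\<^sub>R \<phi> s z) \<le> C2 * (norm (x - z))\<^sup>2"
    if x: "x \<in> cball 0 R" "y \<in> cball 0 R" "z \<in> cball 0 R" and s: "s \<in> {0..t}" and e: "x + y = 2 *\<^sub>R z" for x y z s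
  proof -
    let ?h = "(norm (x - z))\<^sup>2"
    have yz: "norm (y - z) = norm (x - z)"
    proof -
      have "y - z = - (x - z)" using e by (simp add: algebra_simps scaleR_2)
      then show ?thesis by (metis norm_minus_cancel)
    qed
    have "(norm (\<phi> s x + \<phi> s y - 2 *\<^sub>R \<phi> s z))\<^sup>2 \<le>
      exp ((2 * M + 1) * s) * ((norm (\<phi> 0 x + \<phi> 0 y - 2 *\<^sub>R \<phi> 0 z))\<^sup>2 + (c * ?h)\<^sup>2 * s)"
    proof (rule gronwall_norm)
      show "norm (V (\<phi> r x) + V (\<phi> r y) - 2 *\<^sub>R V (\<phi> r z)) \<le>
          M * norm (\<phi> r x + \<phi> r y - 2 *\<^sub>R \<phi> r z) + c * ?h" if r: "0 \<le> r" "r \<le> s" for r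
      proof -
        let ?p = "\<phi> r x" and ?q = "\<phi> r y" and ?r = "\<phi> r z"
        have rt: "r \<in> {0..t}" using r s by auto
        have "?p \<in> cball 0 R'" "?q \<in> cball 0 R'" "?r \<in> cball 0 R'"
          using R'(2) x rt by auto
        note ball = this
        have ex: "exp (k * r) \<le> exp (k * t)" using k rt by (auto intro: mult_left_mono)
        have pr: "(norm (?p - ?r))\<^sup>2 \<le> exp (k * t) * ?h"
          using lip2[OF x(1,3) rt] mult_right_mono[OF ex, of ?h] by simp
        have qr: "(norm (?q - ?r))\<^sup>2 \<le> exp (k * t) * ?h"
          using lip2[OF x(2,3) rt] mult_right_mono[OF ex, of ?h] yz by simp
        interpret V': linear "V' ?r" by (rule linear_V')
        \<comment> \<open>Expanding V at the image of the midpoint, the two linear parts add up to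
          V' applied to the second difference, which is the linear term for Gronwall. The quadratic
          remainders form its source term.\<close>
        have "V ?p + V ?q - 2 *\<^sub>R V ?r = (V ?p - V ?r - V' ?r (?p - ?r)) + (V ?q - V ?r - V' ?r (?q - ?r))
            + V' ?r (?p + ?q - 2 *\<^sub>R ?r)"
          by (simp add: V'.diff V'.add V'.scaleR scaleR_2)
        also have "norm \<dots> \<le> M * (norm (?p - ?r))\<^sup>2 + M * (norm (?q - ?r))\<^sup>2 + M * norm (?p + ?q - 2 *\<^sub>R ?r)"
          using M(3)[OF ball(3,1)] M(3)[OF ball(3,2)] M(4)[OF ball(3), of "?p + ?q - 2 *\<^sub>R ?r"]
          by (intro norm_triangle_le add_mono) auto
        also have "\<dots> \<le> M * (exp (k * t) * ?h) + M * (exp (k * t) * ?h) + M * norm (?p + ?q - 2 *\<^sub>R ?r)"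
          using M pr qr by (intro add_mono mult_left_mono) auto
        finally show ?thesis by (simp add: c_def algebra_simps)
      qed
    qed (use M s in \<open>auto intro!: has_vector_derivative_diff has_vector_derivative_add
        bounded_linear.has_vector_derivative[OF bounded_linear_scaleR_right] flow_deriv\<close>)
    also have "norm (\<phi> 0 x + \<phi> 0 y - 2 *\<^sub>R \<phi> 0 z) = 0" using e by (simp add: flow_0)
    also have "exp ((2 * M + 1) * s) * (0\<^sup>2 + (c * ?h)\<^sup>2 * s) \<le> (exp (k * t))\<^sup>2 * ((c * ?h)\<^sup>2 * (t + 1)\<^sup>2)"
    proof (rule mult_mono)
      have "exp ((2 * M + 1) * s) \<le> exp (k * t)" using k s by (auto simp: k_def intro!: mult_left_mono)
      also have "\<dots> \<le> (exp (k * t))\<^sup>2"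
        using k assms by (simp add: power2_eq_square)
      finally show "exp ((2 * M + 1) * s) \<le> (exp (k * t))\<^sup>2" .
      have "s \<le> (t + 1)\<^sup>2" using s by (simp add: power2_eq_square algebra_simps add_increasing)
      then show "0\<^sup>2 + (c * ?h)\<^sup>2 * s \<le> (c * ?h)\<^sup>2 * (t + 1)\<^sup>2"
        by (simp add: mult_left_mono)
    qed (use s in auto)
    also have "\<dots> = (C2 * ?h)\<^sup>2" by (simp add: C2_def power_mult_distrib)
    finally show ?thesis
      by (rule power2_le_imp_le) (use C2 in simp)
  qed
  \<comment> \<open>A bound for the speed: V is Lipschitz on the ball of radius R', which contains 0
    and the trajectories.\<close>
  define B where "B = norm (V 0) + M * R'"
  have B: "B \<ge> 0" using M R' by (simp add: B_def)
  have time: "norm (\<phi> s x - \<phi> s' x) \<le> B * \<bar>s - s'\<bar>"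
    if x: "x \<in> cball 0 R" and s: "s \<in> {0..t}" "s' \<in> {0..t}" for x s s'
  proof -
    have "norm (\<phi> s x - \<phi> s' x) \<le> B * norm (s - s')"
    proof (rule differentiable_bound[of "{0..t}" _ "\<lambda>r h. h *\<^sub>R V (\<phi> r x)"])
      fix r assume r: "r \<in> {0..t}"
      show "((\<lambda>s. \<phi> s x) has_derivative (\<lambda>h. h *\<^sub>R V (\<phi> r x))) (at r within {0..t})"
        using flow_deriv[of x r] unfolding has_vector_derivative_def by (rule has_derivative_at_withinI)
      have "norm (V (\<phi> r x)) \<le> norm (V 0) + norm (V (\<phi> r x) - V 0)"
        by (metis add.commute diff_add_cancel norm_triangle_ineq)
      also have "\<dots> \<le> norm (V 0) + M * norm (\<phi> r x)"
        using M(2)[of 0 "\<phi> r x"] R' x r by simp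
      also have "\<dots> \<le> B" unfolding B_def using M R'(2)[OF x r] by (intro add_mono mult_left_mono) auto
      finally show "onorm (\<lambda>h. h *\<^sub>R V (\<phi> r x)) \<le> B"
        by (intro onorm_le) (metis abs_ge_zero mult.commute mult_left_mono norm_scaleR real_norm_def)
    qed (use s in auto)
    then show ?thesis by simp
  qed
  let ?C = "k + C2 + B"
  show thesis
  proof (rule that[of ?C])
    show "0 \<le> ?C" using k C2 B by simp
    show "norm (\<phi> s x - \<phi> s y) \<le> exp (?C * s) * norm (x - y)"
      if "x \<in> cball 0 R" "y \<in> cball 0 R" "s \<in> {0..t}" for x y s
    proof -
      have "exp (k * s) \<le> exp (?C * s)" using C2 B that by (auto intro!: mult_right_mono)
      then show ?thesis using lip[OF that] by (meson mult_right_mono norm_ge_zero order_trans)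
    qed
    show "norm (\<phi> s x + \<phi> s y - 2 *\<^sub>R \<phi> s z) \<le> ?C * (norm (x - z))\<^sup>2"
      if "x \<in> cball 0 R" "y \<in> cball 0 R" "z \<in> cball 0 R" "s \<in> {0..t}" "x + y = 2 *\<^sub>R z" for x y z s
    proof -
      have "C2 * (norm (x - z))\<^sup>2 \<le> ?C * (norm (x - z))\<^sup>2" using k B by (intro mult_right_mono) auto
      then show ?thesis using second[OF that] by linarith
    qed
    show "norm (\<phi> s x - \<phi> s' x) \<le> ?C * \<bar>s - s'\<bar>"
      if "x \<in> cball 0 R" "s \<in> {0..t}" "s' \<in> {0..t}" for x s s'
    proof -
      have "B * \<bar>s - s'\<bar> \<le> ?C * \<bar>s - s'\<bar>" using k C2 by (intro mult_right_mono) auto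
      then show ?thesis using time[OF that] by linarith
    qed
  qed
qed

section \<open>Time reversal and the inverse of the flow\<close>

lemma reverse_flow: "C11_flow (\<lambda>x. - V x) (\<lambda>x v. - V' x v) (\<lambda>t. \<phi> (- t))"
proof
  show "((\<lambda>s. \<phi> (- s) x) has_vector_derivative - V (\<phi> (- t) x)) (at t)" for x t
  proof -
    have "((\<lambda>s. - s) has_vector_derivative - 1) (at t)"
      by (auto intro!: derivative_eq_intros)
    from vector_diff_chain_at[OF this flow_deriv[of x "- t"]]
    show ?thesis by (simp add: o_def)
  qed
  show "\<exists>M\<ge>0. \<forall>x\<in>cball 0 R. \<forall>y\<in>cball 0 R. norm (- V y - - V x) \<le> M * norm (y - x) \<and>
      norm (- V y - - V x - - V' x (y - x)) \<le> M * (norm (y - x))\<^sup>2 \<and> (\<forall>v. norm (- V' x v) \<le> M * norm v)" for R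
  proof -
    have "norm (- V y - - V x) = norm (V y - V x)"
      "norm (- V y - - V x - - V' x (y - x)) = norm (V y - V x - V' x (y - x))" for x y
      by (metis minus_diff_minus norm_minus_cancel)+
    then show ?thesis using local_bound[of R] by simp
  qed
qed (simp_all add: flow_0 linear_add[OF linear_V'] linear_scale[OF linear_V'])

text \<open>Running the trajectory of \<open>x\<close> backwards from time \<open>t\<close> solves
  the reversed equation with initial value \<open>\<phi> t x\<close>, as the reversed flow does. By
  uniqueness the two agree, and after time \<open>t\<close> the backward trajectory is at
  \<open>x\<close>.\<close>

lemma flow_inverse: "\<phi> (- t) (\<phi> t x) = x"
proof -
  \<comment> \<open>Uniqueness covers nonnegative times only. The claim is stated for arbitrary
    flows so that negative times follow by applying it to the reversed flow.\<close>
  have *: "\<phi> (- t) (\<phi> t x) = x" if "0 \<le> t" "C11_flow V V' \<phi>"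
    for \<phi> :: "real \<Rightarrow> 'a \<Rightarrow> 'a" and V V' t
  proof -
    interpret f: C11_flow V V' \<phi> by fact
    interpret r: C11_flow "\<lambda>x. - V x" "\<lambda>x v. - V' x v" "\<lambda>t. \<phi> (- t)" by (rule f.reverse_flow)
    have "((\<lambda>s. \<phi> (t - s) x) has_vector_derivative - V (\<phi> (t - s) x)) (at s)" for s
    proof -
      have "((\<lambda>s. t - s) has_vector_derivative - 1) (at s)"
        by (auto intro!: derivative_eq_intros)
      from vector_diff_chain_at[OF this f.flow_deriv[of x "t - s"]]
      show ?thesis by (simp add: o_def)
    qed
    from r.solution_unique[OF r.flow_deriv this, of "\<phi> t x" t] that(1)
    show ?thesis by (simp add: f.flow_0)
  qed
  show ?thesis
  proof (cases "0 \<le> t")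
    case True
    then show ?thesis using C11_flow_axioms by (rule *)
  next
    case False
    then show ?thesis using *[OF _ reverse_flow, of "- t"] by simp
  qed
qed

lemma flow_inverse': "\<phi> t (\<phi> (- t) x) = x"
  using flow_inverse[of "- t" x] by simp

end

section \<open>Taylor bounds, Lipschitz images and discrete Laplacians\<close>

text \<open>Mean value inequality on the segment for f minus its linearisation at \<open>x\<close>.
  A Lipschitz derivative suffices, which is why the constant is K and not half of it.\<close>

lemma taylor_quadratic:
  fixes f :: "'a::euclidean_space \<Rightarrow> 'b::real_normed_vector"
  assumes "convex S" and f': "\<And>x. x \<in> S \<Longrightarrow> (f has_derivative f' x) (at x within S)"
    and lip: "\<And>x z v. x \<in> S \<Longrightarrow> z \<in> S \<Longrightarrow> norm (f' z v - f' x v) \<le> K * norm (z - x) * norm v"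
    and "0 \<le> K" and xy: "x \<in> S" "y \<in> S"
  shows "norm (f y - f x - f' x (y - x)) \<le> K * (norm (y - x))\<^sup>2"
proof -
  let ?T = "closed_segment x y"
  have sub: "?T \<subseteq> S" using assms by (simp add: closed_segment_subset)
  have "norm (f y - f x - f' x (y - x)) \<le> norm (y - x) * (K * norm (y - x))"
  proof (rule differentiable_bound_linearization[of x y ?T f f' x])
    show "x + t *\<^sub>R (y - x) \<in> ?T" if "t \<in> {0..1}" for t
      using that by (auto simp: in_segment algebra_simps)
    show "(f has_derivative f' z) (at z within ?T)" if "z \<in> ?T" for z
      using has_derivative_subset[OF f' sub] sub that by blast
    show "onorm (f' z - f' x) \<le> K * norm (y - x)" if z: "z \<in> ?T" for z
    proof (rule onorm_le)
      fix v
      have "norm ((f' z - f' x) v) \<le> K * norm (z - x) * norm v"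
        using lip[of x z v] sub z xy by auto
      also have "\<dots> \<le> K * norm (y - x) * norm v"
        using segment_bound(1)[OF z] \<open>0 \<le> K\<close> by (intro mult_right_mono mult_left_mono) (auto simp: norm_minus_commute)
      finally show "norm ((f' z - f' x) v) \<le> K * norm (y - x) * norm v" .
    qed
  qed simp
  then show ?thesis by (simp add: power2_eq_square algebra_simps)
qed

lemma norm_linear_le_sum_Basis:
  assumes "linear f" "\<And>b. b \<in> Basis \<Longrightarrow> norm (f b) \<le> M b"
  shows "norm (f v) \<le> (\<Sum>b\<in>Basis. M b) * norm v"
proof -
  have "f v = f (\<Sum>b\<in>Basis. (v \<bullet> b) *\<^sub>R b)" by (simp add: euclidean_representation)
  also have "\<dots> = (\<Sum>b\<in>Basis. (v \<bullet> b) *\<^sub>R f b)" using assms(1)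
    by (simp add: linear_sum linear_scale)
  also have "norm \<dots> \<le> (\<Sum>b\<in>Basis. norm v * M b)"
    using assms by (intro sum_norm_le) (simp add: mult_mono Basis_le_norm)
  finally show ?thesis by (simp add: sum_distrib_left mult.commute)
qed

text \<open>\<open>Ck_on\<close> provides continuity of the derivative in each fixed direction, so
  the uniform operator bound is assembled from the finitely many basis directions.\<close>

lemma C1_lipschitz_on_cball:
  fixes f :: "'a::euclidean_space \<Rightarrow> 'b::real_normed_vector"
  assumes "Ck_on 1 f UNIV"
  shows "\<exists>L\<ge>0. (\<forall>x\<in>cball 0 R. \<forall>v. norm (frechet_derivative f (at x) v) \<le> L * norm v) \<and>
    (\<forall>x\<in>cball 0 R. \<forall>y\<in>cball 0 R. norm (f x - f y) \<le> L * norm (x - y))"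
proof -
  have f': "(f has_derivative frechet_derivative f (at x)) (at x)" for x
    using assms by (simp add: frechet_derivative_works)
  have "\<exists>M\<ge>0. \<forall>x\<in>cball 0 R. norm (frechet_derivative f (at x) b) \<le> M" for b
  proof -
    have "continuous_on (cball 0 R) (\<lambda>x. frechet_derivative f (at x) b)"
      using assms continuous_on_subset by fastforce
    then have "bounded ((\<lambda>x. frechet_derivative f (at x) b) ` cball 0 R)"
      by (intro compact_imp_bounded compact_continuous_image) auto
    then obtain M where "0 < M" "\<forall>x\<in>cball 0 R. norm (frechet_derivative f (at x) b) \<le> M"
      unfolding bounded_pos by auto
    then show ?thesis by (intro exI[of _ M]) auto
  qed
  then obtain M where M: "\<And>b. M b \<ge> 0" "\<And>b x. x \<in> cball 0 R \<Longrightarrow> norm (frechet_derivative f (at x) b) \<le> M b"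
    by metis
  define L where "L = (\<Sum>b\<in>(Basis::'a set). M b)"
  have "norm (frechet_derivative f (at x) v) \<le> L * norm v" if "x \<in> cball 0 R" for x v
    unfolding L_def using that M f' by (intro norm_linear_le_sum_Basis has_derivative_linear) auto
  note L = this
  moreover have "norm (f x - f y) \<le> L * norm (x - y)" if "x \<in> cball 0 R" "y \<in> cball 0 R" for x y
    by (rule differentiable_bound[OF convex_cball _ _ that]) (use f' L in \<open>auto intro: has_derivative_at_withinI onorm_le\<close>)
  moreover have "L \<ge> 0" using M by (simp add: L_def sum_nonneg)
  ultimately show ?thesis by blast
qed

lemma C2_local_bound:
  fixes V :: "'a::euclidean_space \<Rightarrow> 'b::real_normed_vector"
  assumes V: "\<And>k. Ck_on k V UNIV"
  defines "V' \<equiv> \<lambda>x. frechet_derivative V (at x)"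
  shows "\<exists>M\<ge>0. \<forall>x\<in>cball 0 R. \<forall>y\<in>cball 0 R. norm (V y - V x) \<le> M * norm (y - x) \<and>
      norm (V y - V x - V' x (y - x)) \<le> M * (norm (y - x))\<^sup>2 \<and> (\<forall>v. norm (V' x v) \<le> M * norm v)"
proof -
  have V': "(V has_derivative V' x) (at x)" for x
    using V[of 1] by (simp add: frechet_derivative_works V'_def)
  obtain L where L: "L \<ge> 0" "\<And>x v. x \<in> cball 0 R \<Longrightarrow> norm (V' x v) \<le> L * norm v"
    "\<And>x y. x \<in> cball 0 R \<Longrightarrow> y \<in> cball 0 R \<Longrightarrow> norm (V x - V y) \<le> L * norm (x - y)"
    using C1_lipschitz_on_cball[OF V, of R] unfolding V'_def by blast
  have "\<exists>K\<ge>0. \<forall>x\<in>cball 0 R. \<forall>y\<in>cball 0 R. norm (V' x b - V' y b) \<le> K * norm (x - y)" for b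
    using C1_lipschitz_on_cball[of "\<lambda>x. V' x b" R] V[of "Suc 1"] unfolding V'_def by auto
  then obtain K where K: "\<And>b. K b \<ge> 0"
    "\<And>b x y. x \<in> cball 0 R \<Longrightarrow> y \<in> cball 0 R \<Longrightarrow> norm (V' x b - V' y b) \<le> K b * norm (x - y)"
    by metis
  define K2 where "K2 = (\<Sum>b\<in>(Basis::'a set). K b)"
  have K2: "K2 \<ge> 0" using K by (simp add: K2_def sum_nonneg)
  have "norm (V' z v - V' x v) \<le> K2 * norm (z - x) * norm v" if "x \<in> cball 0 R" "z \<in> cball 0 R" for x z v
    unfolding K2_def sum_distrib_right[of _ _ "norm (z - x)"]
    by (rule norm_linear_le_sum_Basis[of "\<lambda>v. V' z v - V' x v"])
      (use K that in \<open>auto intro!: linear_compose_sub has_derivative_linear[OF V']\<close>)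
  then have T: "norm (V y - V x - V' x (y - x)) \<le> K2 * (norm (y - x))\<^sup>2" if "x \<in> cball 0 R" "y \<in> cball 0 R" for x y
    using K2 V' that by (intro taylor_quadratic[of "cball 0 R"]) (auto intro: has_derivative_at_withinI)
  show ?thesis
  proof (intro exI[of _ "L + K2"] conjI ballI allI)
    fix x y v assume xy: "x \<in> cball (0::'a) R" "y \<in> cball (0::'a) R"
    show "norm (V y - V x) \<le> (L + K2) * norm (y - x)"
      using L(3)[OF xy(2,1)] mult_nonneg_nonneg[OF K2 norm_ge_zero, of "y - x"] by (simp only: distrib_right)
    show "norm (V y - V x - V' x (y - x)) \<le> (L + K2) * (norm (y - x))\<^sup>2"
      using T[OF xy] mult_nonneg_nonneg[OF L(1) zero_le_power2, of "norm (y - x)"] by (simp only: distrib_right)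
    show "norm (V' x v) \<le> (L + K2) * norm v"
      using L(2)[OF xy(1), of v] mult_nonneg_nonneg[OF K2 norm_ge_zero, of v] by (simp only: distrib_right)
  qed (use L K2 in simp)
qed

text \<open>By Vitali the open set is, up to a negligible remainder, a disjoint union of balls. The
  image of a ball of radius r lies in a ball of radius L r, and the remainder has a negligible
  image. The factor is exactly the power of L, without a dimensional constant, so it tends to 1 with
  L.\<close>

lemma emeasure_lipschitz_image_open:
  fixes f :: "'a::euclidean_space \<Rightarrow> 'a"
  assumes "open U" and lip: "\<And>x y. x \<in> U \<Longrightarrow> y \<in> U \<Longrightarrow> norm (f x - f y) \<le> L * norm (x - y)"
    and "0 \<le> L" and fU: "f ` U \<in> sets lebesgue"
  shows "emeasure lebesgue (f ` U) \<le> ennreal (L ^ DIM('a)) * emeasure lborel U"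
proof -
  let ?K = "{(a, r). 0 < r \<and> ball a r \<subseteq> U} :: ('a \<times> real) set"
  let ?d = "DIM('a)"
  have "\<exists>i. i \<in> ?K \<and> x \<in> ball (fst i) (snd i) \<and> snd i < d" if x: "x \<in> U" and "0 < d" for x and d :: real
  proof -
    obtain e where "e > 0" "ball x e \<subseteq> U" using x \<open>open U\<close> open_contains_ball by blast
    then show ?thesis using \<open>0 < d\<close> by (intro exI[of _ "(x, min e (d / 2))"]) auto
  qed
  note cover = this
  obtain C where C: "countable C" "C \<subseteq> ?K"
    "pairwise (\<lambda>i j. disjnt (ball (fst i) (snd i)) (ball (fst j) (snd j))) C"
    "negligible (U - (\<Union>i\<in>C. ball (fst i) (snd i)))"
    by (rule Vitali_covering_theorem_balls[of U ?K fst snd, OF cover]; (rule that; assumption)?)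
  let ?N = "U - (\<Union>i\<in>C. ball (fst i) (snd i))"
  let ?I = "to_nat_on C ` C"
  define c where "c = from_nat_into C"
  define B where "B n = (if n \<in> ?I then ball (fst (c n)) (snd (c n)) else {})" for n
  \<comment> \<open>Closed balls, since for L = 0 the open ones would be empty.\<close>
  define F where "F n = (if n \<in> ?I then cball (f (fst (c n))) (L * snd (c n)) else {})" for n
  have c_in: "c n \<in> C" if "n \<in> ?I" for n
    using that C(1) by (auto simp: c_def)
  have c_surj: "\<exists>n\<in>?I. c n = i" if "i \<in> C" for i
    using that C(1) by (auto simp: c_def intro!: bexI[of _ i])
  have K: "0 < snd i" "ball (fst i) (snd i) \<subseteq> U" if "i \<in> C" for i
    using subsetD[OF C(2) that] by (auto simp: case_prod_beta)
  have neg: "negligible (f ` ?N)"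
  proof (rule negligible_locally_Lipschitz_image[OF order_refl C(4)])
    show "\<exists>T B. open T \<and> x \<in> T \<and> (\<forall>y\<in>?N \<inter> T. norm (f y - f x) \<le> B * norm (y - x))" if "x \<in> ?N" for x
      using that by (intro exI[of _ UNIV] exI[of _ L]) (auto intro: lip)
  qed
  have disj: "disjoint_family B"
    unfolding disjoint_family_on_def
  proof (intro ballI impI)
    fix m n :: nat assume "m \<noteq> n"
    show "B m \<inter> B n = {}"
    proof (cases "m \<in> ?I \<and> n \<in> ?I")
      case True
      then have "c m \<noteq> c n"
        using \<open>m \<noteq> n\<close> C(1) by (auto simp: c_def)
      then show ?thesis
        using C(3) c_in True by (simp add: B_def pairwise_def disjnt_def)
    qed (auto simp: B_def)
  qed
  have "f ` U \<subseteq> (\<Union>n. F n) \<union> f ` ?N"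
  proof
    fix y assume "y \<in> f ` U"
    then obtain x where x: "x \<in> U" "y = f x" by auto
    show "y \<in> (\<Union>n. F n) \<union> f ` ?N"
    proof (cases "x \<in> ?N")
      case False
      then obtain i where i: "i \<in> C" "x \<in> ball (fst i) (snd i)" using x by auto
      then obtain n where n: "n \<in> ?I" "c n = i" using c_surj by blast
      have "fst i \<in> U" using K[OF i(1)] by (meson centre_in_ball subsetD)
      then have "norm (f (fst i) - f x) \<le> L * norm (fst i - x)" using lip x by auto
      also have "\<dots> \<le> L * snd i" using i \<open>0 \<le> L\<close> by (intro mult_left_mono) (auto simp: dist_norm)
      finally have "y \<in> F n" using n x by (auto simp: F_def dist_norm)
      then show ?thesis by blast
    qed (use x in auto)
  qed
  then have "emeasure lebesgue (f ` U) \<le> emeasure lebesgue ((\<Union>n. F n) \<union> f ` ?N)"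
    using neg by (intro emeasure_mono sets.Un sets.countable_UN) (auto simp: F_def negligible_imp_sets)
  also have "\<dots> \<le> emeasure lebesgue (\<Union>n. F n) + emeasure lebesgue (f ` ?N)"
    using neg by (intro emeasure_subadditive sets.countable_UN) (auto simp: F_def negligible_imp_sets)
  also have "emeasure lebesgue (f ` ?N) = 0"
    using neg negligible_iff_emeasure0 negligible_imp_sets by blast
  also have "emeasure lebesgue (\<Union>n. F n) \<le> (\<Sum>n. emeasure lebesgue (F n))"
    by (intro emeasure_subadditive_countably) (auto simp: F_def)
  also have "\<dots> \<le> (\<Sum>n. ennreal (L ^ ?d) * emeasure lborel (B n))"
  proof (rule suminf_le)
    fix n
    show "emeasure lebesgue (F n) \<le> ennreal (L ^ ?d) * emeasure lborel (B n)"
    proof (cases "n \<in> ?I")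
      case True
      then have "snd (c n) > 0" using K c_in by blast
      then show ?thesis using True \<open>0 \<le> L\<close>
        by (simp add: F_def B_def emeasure_cball emeasure_ball ennreal_mult'[symmetric] power_mult_distrib mult_ac)
    qed (simp add: F_def)
  qed auto
  also have "\<dots> = ennreal (L ^ ?d) * emeasure lborel (\<Union>n. B n)"
    using disj by (subst ennreal_suminf_cmult, subst suminf_emeasure) (auto simp: B_def)
  also have "emeasure lborel (\<Union>n. B n) \<le> emeasure lborel U"
  proof (rule emeasure_mono)
    have "B n \<subseteq> U" for n using K(2)[OF c_in] by (simp add: B_def)
    then show "(\<Union>n. B n) \<subseteq> U" by blast
  qed (use \<open>open U\<close> in simp)
  finally show ?thesis by (simp add: mult_left_mono)
qed

text \<open>An inequality in place of the Jacobian formula. The volume bound passes from open to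
  Borel sets by outer regularity and then reads as an inequality between two measures, against which
  \<open>h\<close> is integrated. Continuity of the inverse \<open>g\<close> ensures that images
  under \<open>f\<close> stay open or Borel.\<close>

lemma nn_integral_lipschitz_change_of_variables:
  fixes f g :: "'a::euclidean_space \<Rightarrow> 'a"
  assumes "open U" and lip: "\<And>x y. x \<in> U \<Longrightarrow> y \<in> U \<Longrightarrow> norm (f x - f y) \<le> L * norm (x - y)"
    and "0 \<le> L" and g: "continuous_on UNIV g" and inv: "\<And>x. g (f x) = x" "\<And>x. f (g x) = x"
    and h[measurable]: "h \<in> borel_measurable borel"
  shows "(\<integral>\<^sup>+y. h (g y) * indicator (f ` U) y \<partial>lborel) \<le> ennreal (L ^ DIM('a)) * (\<integral>\<^sup>+x. h x * indicator U x \<partial>lborel)"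
proof -
  let ?c = "L ^ DIM('a)"
  have [measurable]: "g \<in> borel_measurable borel" using g by (rule borel_measurable_continuous_onI)
  have im: "f ` A = g -` A" for A
    using inv by (metis (no_types, lifting) bij_def bij_vimage_eq_inv_image inj_on_def inv_equality surjI)
  have opn: "open (f ` W)" if "open W" for W
    unfolding im using that g by (simp add: continuous_on_open_vimage)
  have [measurable]: "f ` A \<in> sets borel" if "A \<in> sets borel" for A
    unfolding im using that measurable_sets[of g borel borel A] by simp
  have [measurable]: "U \<in> sets borel" using \<open>open U\<close> by simp
  have c: "0 \<le> ?c" using \<open>0 \<le> L\<close> by simp
  have bound: "emeasure lborel (f ` A) \<le> ennreal ?c * emeasure lborel A" if A: "A \<in> sets borel" "A \<subseteq> U" for A
  proof (rule ennreal_le_epsilon)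
    fix e :: real assume e: "0 < e"
    \<comment> \<open>Chosen so that the excess volume, after multiplication by the Lipschitz
      factor, is at most e; the summand 1 allows the factor to be 0.\<close>
    define e' where "e' = e / (?c + 1)"
    have e': "e' > 0" using e c by (simp add: e'_def)
    obtain W where W: "open W" "A \<subseteq> W" "emeasure lborel (W - A) < ennreal e'"
      using outer_regular_lborel[OF A(1) e'] by blast
    let ?W = "W \<inter> U"
    have oW: "open ?W" using W \<open>open U\<close> by auto
    have "emeasure lborel (f ` A) \<le> emeasure lborel (f ` ?W)"
      using A W opn[OF oW] by (intro emeasure_mono) auto
    also have "\<dots> = emeasure lebesgue (f ` ?W)" using opn[OF oW] by simp
    also have "\<dots> \<le> ennreal ?c * emeasure lborel ?W"
      using oW opn[OF oW] \<open>0 \<le> L\<close> by (intro emeasure_lipschitz_image_open lip) auto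
    also have "emeasure lborel ?W \<le> emeasure lborel A + emeasure lborel (W - A)"
    proof -
      have "emeasure lborel ?W \<le> emeasure lborel (A \<union> (W - A))"
        using A W by (intro emeasure_mono) auto
      also have "\<dots> \<le> emeasure lborel A + emeasure lborel (W - A)"
        using A W by (intro emeasure_subadditive) auto
      finally show ?thesis .
    qed
    also have "\<dots> \<le> emeasure lborel A + ennreal e'" using W by (intro add_left_mono) simp
    also have "ennreal ?c * (emeasure lborel A + ennreal e') = ennreal ?c * emeasure lborel A + ennreal (?c * e')"
      using c e' by (simp add: distrib_left ennreal_mult)
    also have "ennreal (?c * e') \<le> ennreal e"
      using e c by (intro ennreal_leI) (simp add: e'_def field_simps)
    finally show "emeasure lborel (f ` A) \<le> ennreal ?c * emeasure lborel A + ennreal e"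
      by (simp add: mult_left_mono)
  qed
  have oU: "f ` U \<in> sets borel" using opn[OF \<open>open U\<close>] by simp
  let ?M = "distr (restrict_space lborel (f ` U)) borel g"
  let ?N = "scale_measure (ennreal ?c) (distr (restrict_space lborel U) borel (\<lambda>x. x))"
  have gm: "g \<in> measurable (restrict_space lborel (f ` U)) borel"
    by (intro measurable_restrict_space1) simp
  have im': "(\<lambda>x. x) \<in> measurable (restrict_space lborel U) borel"
    by (intro measurable_restrict_space1) simp
  have "emeasure ?M A \<le> emeasure ?N A" if A[measurable]: "A \<in> sets borel" for A
  proof -
    have "emeasure ?M A = emeasure (restrict_space lborel (f ` U)) (f ` (A \<inter> U))"
      using gm A by (simp add: emeasure_distr im space_restrict_space vimage_Int)
    also have "\<dots> = emeasure lborel (f ` (A \<inter> U))"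
      using oU by (intro emeasure_restrict_space) auto
    also have "\<dots> \<le> ennreal ?c * emeasure lborel (A \<inter> U)" by (intro bound) auto
    also have "\<dots> = emeasure ?N A"
      using im' A by (simp add: emeasure_distr space_restrict_space emeasure_restrict_space)
    finally show ?thesis .
  qed
  then have "?M \<le> ?N" by (intro le_measure[THEN iffD2]) auto
  then have "nn_integral ?M h \<le> nn_integral ?N h" by (intro nn_integral_mono_measure) auto
  moreover have "nn_integral ?M h = (\<integral>\<^sup>+y. h (g y) * indicator (f ` U) y \<partial>lborel)"
    using gm oU by (simp add: nn_integral_distr nn_integral_restrict_space)
  moreover have "nn_integral ?N h = ennreal ?c * (\<integral>\<^sup>+x. h x * indicator U x \<partial>lborel)"
    using im' by (simp add: nn_integral_scale_measure nn_integral_distr nn_integral_restrict_space)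
  ultimately show ?thesis by simp
qed

lemma LINT_lebesgue_on_eq_lborel:
  fixes h :: "'a::euclidean_space \<Rightarrow> real"
  assumes "U \<in> sets borel" "(\<lambda>x. indicator U x * h x) \<in> borel_measurable borel"
  shows "(LINT x|lebesgue_on U. h x) = (LINT x|lborel. indicator U x * h x)"
  using assms by (subst integral_restrict_space) (auto simp: integral_completion)

lemma integrable_bounded_support:
  fixes f :: "'a::euclidean_space \<Rightarrow> real"
  assumes "f \<in> borel_measurable borel" "\<And>x. \<bar>f x\<bar> \<le> M" "\<And>x. x \<notin> cball 0 R \<Longrightarrow> f x = 0"
  shows "integrable lborel f"
proof -
  have "integrable lborel (\<lambda>x. M * indicator (cball (0::'a) R) x :: real)"
    using emeasure_lborel_cball_finite[of "0::'a" R] by (simp add: integrable_indicator_iff)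
  then show ?thesis
  proof (rule Bochner_Integration.integrable_bound)
    have "M \<ge> 0" using assms(2) by (meson abs_ge_zero order_trans)
    then show "AE x in lborel. norm (f x) \<le> norm (M * indicator (cball 0 R) x :: real)"
      using assms(2,3) by (intro AE_I2) (auto simp: indicator_def)
  qed (use assms in simp)
qed

lemma lborel_integral_translate:
  fixes f :: "'a::euclidean_space \<Rightarrow> real"
  assumes "f \<in> borel_measurable borel"
  shows "(LINT x|lborel. f (h + x)) = (LINT x|lborel. f x)"
proof -
  have "(LINT x|lborel. f x) = (LINT x|distr lborel borel ((+) h). f x)"
    by (simp add: lborel_distr_plus)
  also have "\<dots> = (LINT x|lborel. f (h + x))" using assms by (intro integral_distr) auto
  finally show ?thesis by simp
qed

text \<open>Discrete form of integrating \<beta>(u) times the Laplacian by parts to minus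
  \<beta>'(u) |grad u|^2. Translating the backward half by \<open>h\<close> turns the integral into
  minus the integral of (\<beta>(u(x+h)) - \<beta>(u(x))) (u(x+h) - u(x)), a product of factors of
  equal sign.\<close>

lemma monotone_second_difference_integral_nonpos:
  fixes u :: "'a::euclidean_space \<Rightarrow> real" and \<beta> :: "real \<Rightarrow> real"
  assumes u[measurable]: "u \<in> borel_measurable borel" and bd: "\<And>x. \<bar>u x\<bar> \<le> M"
    and supp: "\<And>x. x \<notin> cball 0 R \<Longrightarrow> u x = 0"
    and \<beta>: "mono \<beta>" "\<beta> 0 = 0"
  shows "(LINT x|lborel. \<beta> (u x) * (u (x + h) + u (x - h) - 2 * u x)) \<le> 0"
proof -
  have [measurable]: "\<beta> \<in> borel_measurable borel" using \<beta>(1) by (rule borel_measurable_mono)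
  define p where "p x = \<beta> (u x)" for x
  have [measurable]: "p \<in> borel_measurable borel" unfolding p_def by measurable
  define N where "N = \<bar>\<beta> M\<bar> + \<bar>\<beta> (- M)\<bar>"
  have p: "\<bar>p x\<bar> \<le> N" for x
  proof -
    have "- M \<le> u x" "u x \<le> M" using bd[of x] by (simp_all add: abs_le_iff)
    then have "\<beta> (- M) \<le> p x" "p x \<le> \<beta> M" using \<beta>(1) by (auto simp: p_def dest: monoD)
    then show ?thesis by (simp add: N_def)
  qed
  have M: "M \<ge> 0" and N: "N \<ge> 0" using bd p by (meson abs_ge_zero order_trans)+
  have int: "integrable lborel (\<lambda>x. p x * v x)"
    if [measurable]: "v \<in> borel_measurable borel" and v: "\<And>x. \<bar>v x\<bar> \<le> 2 * M" for v
  proof (rule integrable_bounded_support[where M="N * (2 * M)"])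
    show "\<bar>p x * v x\<bar> \<le> N * (2 * M)" for x
      unfolding abs_mult using p v N by (intro mult_mono) auto
    show "x \<notin> cball 0 R \<Longrightarrow> p x * v x = 0" for x using supp \<beta> by (simp add: p_def)
  qed simp
  have ub: "\<bar>u a - u b\<bar> \<le> 2 * M" for a b using bd[of a] bd[of b] by (simp add: abs_le_iff)
  have i1: "integrable lborel (\<lambda>x. p x * (u (x + h) - u x))"
    using ub by (intro int) auto
  have i2: "integrable lborel (\<lambda>x. p x * (u (x - h) - u x))"
    using ub by (intro int) auto
  have i3: "integrable lborel (\<lambda>x. p (x + h) * (u x - u (x + h)))"
  proof (rule integrable_bounded_support[where M="N * (2 * M)" and R="R + norm h"])
    show "\<bar>p (x + h) * (u x - u (x + h))\<bar> \<le> N * (2 * M)" for x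
      unfolding abs_mult using p ub N by (intro mult_mono) auto
    show "p (x + h) * (u x - u (x + h)) = 0" if "x \<notin> cball 0 (R + norm h)" for x
    proof -
      have "norm x \<le> norm (x + h) + norm h" using norm_triangle_ineq4[of "x + h" h] by simp
      then have "x + h \<notin> cball 0 R" using that by auto
      then show ?thesis using supp \<beta> by (simp add: p_def)
    qed
  qed simp
  have "(LINT x|lborel. p x * (u (x + h) + u (x - h) - 2 * u x)) =
      (LINT x|lborel. p x * (u (x + h) - u x)) + (LINT x|lborel. p x * (u (x - h) - u x))"
    by (subst Bochner_Integration.integral_add[OF i1 i2, symmetric]) (simp add: algebra_simps)
  also have "(LINT x|lborel. p x * (u (x - h) - u x)) = (LINT x|lborel. p (x + h) * (u x - u (x + h)))"
    using lborel_integral_translate[of "\<lambda>x. p x * (u (x - h) - u x)" h] by (simp add: add.commute)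
  also have "(LINT x|lborel. p x * (u (x + h) - u x)) + (LINT x|lborel. p (x + h) * (u x - u (x + h)))
      = (LINT x|lborel. - ((p (x + h) - p x) * (u (x + h) - u x)))"
    by (subst Bochner_Integration.integral_add[OF i1 i3, symmetric]) (simp add: algebra_simps)
  also have "\<dots> \<le> 0"
  proof -
    have "0 \<le> (p (x + h) - p x) * (u (x + h) - u x)" for x
      using monoD[OF \<beta>(1), of "u x" "u (x + h)"] monoD[OF \<beta>(1), of "u (x + h)" "u x"]
      by (cases "u x \<le> u (x + h)") (auto simp: p_def intro: mult_nonneg_nonneg mult_nonpos_nonpos)
    then have "0 \<le> (LINT x|lborel. (p (x + h) - p x) * (u (x + h) - u x))"
      by (intro Bochner_Integration.integral_nonneg)
    then show ?thesis by simp
  qed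
  finally show ?thesis by (simp add: p_def)
qed

section \<open>Second differences and the Laplacian\<close>

lemma second_difference_quotient_tendsto:
  fixes f f' :: "real \<Rightarrow> real"
  assumes f': "\<forall>\<^sub>F s in nhds 0. (f has_real_derivative f' s) (at s)"
    and c: "(f' has_real_derivative c) (at 0)"
  shows "((\<lambda>h. (f h + f (- h) - 2 * f 0) / h\<^sup>2) \<longlongrightarrow> c) (at_right 0)"
proof (rule lhopital_right_0)
  have cont: "isCont f 0" using eventually_nhds_x_imp_x[OF f'] by (rule DERIV_isCont)
  have "isCont (\<lambda>h. f (- h)) 0"
    using cont by (intro isCont_o2[of 0 uminus f]) auto
  then have "isCont (\<lambda>h. f h + f (- h) - 2 * f 0) 0"
    using cont by (intro continuous_intros)
  then show "((\<lambda>h. f h + f (- h) - 2 * f 0) \<longlongrightarrow> 0) (at_right 0)"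
    by (auto simp: isCont_def filterlim_at_split)
  show "((\<lambda>h::real. h\<^sup>2) \<longlongrightarrow> 0) (at_right 0)" by (auto intro!: tendsto_eq_intros)
  show "\<forall>\<^sub>F h in at_right 0. (h::real)\<^sup>2 \<noteq> 0" "\<forall>\<^sub>F h in at_right 0. 2 * (h::real) \<noteq> 0"
    by (auto simp: eventually_at_filter)
  obtain d where d: "d > 0" "\<And>s. \<bar>s\<bar> < d \<Longrightarrow> (f has_real_derivative f' s) (at s)"
    using f' by (auto simp: eventually_nhds_metric dist_real_def)
  show "\<forall>\<^sub>F h in at_right 0. ((\<lambda>h. f h + f (- h) - 2 * f 0) has_real_derivative f' h - f' (- h)) (at h)"
  proof -
    have "((\<lambda>h. f h + f (- h) - 2 * f 0) has_real_derivative f' h - f' (- h)) (at h)" if "\<bar>h\<bar> < d" for h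
    proof -
      have "((\<lambda>h. f (- h)) has_real_derivative f' (- h) * (- 1)) (at h)"
        using d(2)[of "- h"] that by (intro DERIV_chain2[where f=f]) (auto intro!: derivative_eq_intros)
      then show ?thesis using d(2)[OF that] by (auto intro!: derivative_eq_intros)
    qed
    then show ?thesis using d(1) eventually_at_right_real[OF d(1)] by (auto elim!: eventually_mono)
  qed
  show "\<forall>\<^sub>F h in at_right 0. ((\<lambda>h. h\<^sup>2) has_real_derivative 2 * h) (at (h::real))"
    by (intro always_eventually) (auto intro!: derivative_eq_intros)
  \<comment> \<open>l'Hopital's rule can be used only once, since f' is known to be differentiable
    at 0 alone. The quotient it leaves is the mean of the two one-sided difference quotients of f'
    at 0.\<close>
  have 1: "((\<lambda>h. (f' h - f' 0) / h) \<longlongrightarrow> c) (at_right 0)"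
    using c by (simp add: DERIV_def filterlim_at_split)
  have 2: "((\<lambda>h. (f' (- h) - f' 0) / (- h)) \<longlongrightarrow> c) (at_right 0)"
  proof -
    have "((\<lambda>h. (f' h - f' 0) / h) \<longlongrightarrow> c) (at_left 0)"
      using c by (simp add: DERIV_def filterlim_at_split)
    then show ?thesis by (simp add: at_left_minus[of 0] filterlim_filtermap)
  qed
  have 3: "((\<lambda>h. ((f' h - f' 0) / h + (f' (- h) - f' 0) / (- h)) / 2) \<longlongrightarrow> (c + c) / 2) (at_right 0)"
    by (intro tendsto_intros 1 2) simp
  have "\<forall>\<^sub>F h in at_right 0. ((f' h - f' 0) / h + (f' (- h) - f' 0) / (- h)) / 2 = (f' h - f' (- h)) / (2 * h)"
    by (auto simp: eventually_at_filter field_simps)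
  from Lim_transform_eventually[OF 3 this]
  show "((\<lambda>h. (f' h - f' (- h)) / (2 * h)) \<longlongrightarrow> c) (at_right 0)" by simp
qed

lemma has_laplacian_second_difference:
  fixes u :: "'a::euclidean_space \<Rightarrow> real"
  assumes "has_laplacian u L y"
  shows "((\<lambda>h. \<Sum>b\<in>Basis. (u (y + h *\<^sub>R b) + u (y - h *\<^sub>R b) - 2 * u y) / h\<^sup>2) \<longlongrightarrow> L) (at_right 0)"
proof -
  obtain g H where g: "\<forall>\<^sub>F z in nhds y. GDERIV u z :> g z" and H: "(g has_derivative H) (at y)"
    and L: "L = (\<Sum>b\<in>Basis. H b \<bullet> b)"
    using assms unfolding has_laplacian_def by blast
  have "((\<lambda>h. (u (y + h *\<^sub>R b) + u (y - h *\<^sub>R b) - 2 * u y) / h\<^sup>2) \<longlongrightarrow> H b \<bullet> b) (at_right 0)" for b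
  proof -
    have t: "((\<lambda>s. y + s *\<^sub>R b) \<longlongrightarrow> y) (nhds (0::real))"
      using tendsto_at_iff_tendsto_nhds[of "\<lambda>s. y + s *\<^sub>R b" 0]
      by (auto intro!: tendsto_eq_intros)
    have "\<forall>\<^sub>F s in nhds 0. ((\<lambda>s. u (y + s *\<^sub>R b)) has_real_derivative g (y + s *\<^sub>R b) \<bullet> b) (at s)"
      using filterlim_iff[THEN iffD1, OF t, rule_format, OF g]
    proof eventually_elim
      case (elim s)
      have "((\<lambda>s. y + s *\<^sub>R b) has_derivative (\<lambda>h. h *\<^sub>R b)) (at s)"
        by (auto intro!: derivative_eq_intros)
      from has_derivative_compose[OF this elim[unfolded gderiv_def]]
      show ?case by (simp add: has_field_derivative_def inner_commute mult_commute_abs)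
    qed
    moreover have "((\<lambda>s. g (y + s *\<^sub>R b) \<bullet> b) has_real_derivative H b \<bullet> b) (at 0)"
    proof -
      have 1: "((\<lambda>s. y + s *\<^sub>R b) has_derivative (\<lambda>h. h *\<^sub>R b)) (at 0)"
        by (auto intro!: derivative_eq_intros)
      have "((\<lambda>s. g (y + s *\<^sub>R b)) has_derivative (\<lambda>h. H (h *\<^sub>R b))) (at 0)"
        using has_derivative_compose[OF 1, of g H] H by simp
      then have "((\<lambda>s. g (y + s *\<^sub>R b) \<bullet> b) has_derivative (\<lambda>h. H (h *\<^sub>R b) \<bullet> b)) (at 0)"
        by (rule has_derivative_inner_left)
      moreover have "(\<lambda>h. H (h *\<^sub>R b) \<bullet> b) = (\<lambda>h. (H b \<bullet> b) * h)"
        using has_derivative_linear[OF H] by (auto simp: linear_scale)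
      ultimately show ?thesis by (simp add: has_field_derivative_def)
    qed
    ultimately show ?thesis
      using second_difference_quotient_tendsto[of "\<lambda>s. u (y + s *\<^sub>R b)"] by simp
  qed
  then show ?thesis unfolding L by (intro tendsto_sum)
qed

section \<open>Energy decay of subsolutions in moving domains\<close>

lemma (in C11_flow) continuous_flow_space: "continuous_on UNIV (\<phi> s)"
proof -
  have *: "continuous_on UNIV (\<phi> s)" if "0 \<le> s" "C11_flow V V' \<phi>"
    for \<phi> :: "real \<Rightarrow> 'a \<Rightarrow> 'a" and V V' s
  proof -
    interpret f: C11_flow V V' \<phi> by fact
    have "isCont (\<phi> s) x" for x
    proof -
      obtain C where C: "\<And>x' y s'. x' \<in> cball 0 (norm x + 1) \<Longrightarrow> y \<in> cball 0 (norm x + 1) \<Longrightarrow> s' \<in> {0..s} \<Longrightarrow>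
          norm (\<phi> s' x' - \<phi> s' y) \<le> exp (C * s') * norm (x' - y)"
        using f.flow_estimates[OF \<open>0 \<le> s\<close>, of "norm x + 1"] by metis
      have "continuous_on (cball 0 (norm x + 1)) (\<phi> s)"
        using C \<open>0 \<le> s\<close>
        by (intro lipschitz_on_continuous_on[of "exp (C * s)"] lipschitz_onI) (auto simp: dist_norm)
      then have "continuous_on (ball 0 (norm x + 1)) (\<phi> s)"
        by (rule continuous_on_subset) auto
      then show ?thesis by (simp add: continuous_on_eq_continuous_at)
    qed
    then show ?thesis by (simp add: continuous_at_imp_continuous_on)
  qed
  show ?thesis
  proof (cases "0 \<le> s")
    case True
    then show ?thesis using C11_flow_axioms by (rule *)
  next
    case False
    then show ?thesis using *[OF _ reverse_flow, of "- s"] by simp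
  qed
qed

lemma (in C11_flow) mem_flow_image: "y \<in> \<phi> t ` A \<longleftrightarrow> \<phi> (- t) y \<in> A"
  by (metis (no_types, lifting) flow_inverse flow_inverse' image_iff)

lemma (in C11_flow) open_flow_image:
  assumes "open U"
  shows "open (\<phi> t ` U)"
proof -
  have "\<phi> t ` U = \<phi> (- t) -` U" by (auto simp: mem_flow_image flow_inverse)
  then show ?thesis using continuous_flow_space assms by (simp add: continuous_on_open_vimage)
qed

section \<open>Truncation by soft thresholding\<close>

definition clamp_sym :: "real \<Rightarrow> real \<Rightarrow> real" where
  "clamp_sym e s = max (- e) (min e s)"

text \<open>Soft thresholding: for \<open>e > 0\<close> its square is the squared distance to the
  interval [-e, e], a convex C^1 function with derivative \<open>2 * excess e\<close>.\<close>

definition excess :: "real \<Rightarrow> real \<Rightarrow> real" where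
  "excess e s = s - clamp_sym e s"

lemma excess_mono: "mono (excess e)"
  by (auto simp: mono_def excess_def clamp_sym_def)

lemma excess_bounds:
  assumes "e > 0"
  shows "excess e 0 = 0" "\<bar>s\<bar> < e \<Longrightarrow> excess e s = 0" "\<bar>excess e s\<bar> \<le> \<bar>s\<bar>" "\<bar>excess e s - s\<bar> \<le> e"
    "s * c \<le> s * d \<Longrightarrow> excess e s * c \<le> excess e s * d"
proof -
  show "excess e 0 = 0" "\<bar>s\<bar> < e \<Longrightarrow> excess e s = 0" "\<bar>excess e s\<bar> \<le> \<bar>s\<bar>" "\<bar>excess e s - s\<bar> \<le> e"
    using assms by (auto simp: excess_def clamp_sym_def)
  \<comment> \<open>\<open>excess e s\<close> is 0 or has the sign of \<open>s\<close>, so the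
    inequality survives the exchange of factors.\<close>
  show "excess e s * c \<le> excess e s * d" if "s * c \<le> s * d"
    using that assms by (auto simp: excess_def clamp_sym_def mult_le_cancel_left max_def min_def)
qed

lemma excess_sq_subgradient:
  assumes "e > 0"
  shows "(excess e b)\<^sup>2 - (excess e a)\<^sup>2 \<ge> 2 * excess e a * (b - a)"
proof -
  \<comment> \<open>Where \<open>excess e a\<close> is nonzero, \<open>clamp_sym e a\<close> already
    is the extreme value of the same sign, so it can only change in the opposite direction.\<close>
  have "excess e a * (clamp_sym e b - clamp_sym e a) \<le> 0"
    using assms by (auto simp: excess_def clamp_sym_def mult_le_0_iff max_def min_def)
  then have "2 * excess e a * (b - a) \<le> 2 * excess e a * (excess e b - excess e a)"
    by (simp add: excess_def algebra_simps)
  also have "\<dots> \<le> (excess e b)\<^sup>2 - (excess e a)\<^sup>2"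
    using zero_le_power2[of "excess e b - excess e a"] by (simp add: power2_eq_square algebra_simps)
  finally show ?thesis .
qed

lemma continuous_excess: "continuous_on S (excess e)"
  unfolding excess_def clamp_sym_def by (intro continuous_intros)

text \<open>A Dini-type argument. The set of times with \<Phi>(t) + \<eta> (b - t) \<ge> \<Phi>(b)
  contains b and is closed, and the left bound shows that its least element cannot exceed a.\<close>

lemma nonincreasing_from_left_bound:
  fixes \<Phi> :: "real \<Rightarrow> real"
  assumes "a \<le> b" and cont: "continuous_on {a..b} \<Phi>"
    and left: "\<And>t \<eta>. a < t \<Longrightarrow> t \<le> b \<Longrightarrow> \<eta> > 0 \<Longrightarrow> \<forall>\<^sub>F \<tau> in at_left t. \<Phi> \<tau> \<ge> \<Phi> t - \<eta> * (t - \<tau>)"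
  shows "\<Phi> b \<le> \<Phi> a"
proof (rule field_le_epsilon)
  fix e :: real assume "e > 0"
  define \<eta> where "\<eta> = e / (b - a + 1)"
  have \<eta>: "\<eta> > 0" "\<eta> * (b - a) \<le> e"
    using \<open>e > 0\<close> \<open>a \<le> b\<close> by (auto simp: \<eta>_def field_simps)
  let ?A = "{t \<in> {a..b}. \<Phi> t + \<eta> * (b - t) \<ge> \<Phi> b}"
  have "continuous_on {a..b} (\<lambda>t. \<Phi> t + \<eta> * (b - t))"
    by (intro continuous_intros cont)
  then have "closed ?A"
    using continuous_on_closed_Collect_le[of "{a..b}" "\<lambda>t. \<Phi> b" "\<lambda>t. \<Phi> t + \<eta> * (b - t)"] by auto
  moreover have "b \<in> ?A" using \<open>a \<le> b\<close> by simp
  moreover have bdd: "bdd_below ?A" by (auto intro: bdd_belowI[of _ a])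
  ultimately have mem: "Inf ?A \<in> ?A" by (intro closed_contains_Inf) auto
  define c where "c = Inf ?A"
  have c: "a \<le> c" "c \<le> b" "\<Phi> c + \<eta> * (b - c) \<ge> \<Phi> b" using mem by (auto simp: c_def)
  have "c = a"
  proof (rule ccontr)
    assume "c \<noteq> a"
    then have "a < c" using c by simp
    have "\<forall>\<^sub>F \<tau> in at_left c. \<Phi> \<tau> \<ge> \<Phi> c - \<eta> * (c - \<tau>) \<and> \<tau> \<in> {a<..<c}"
      using left[OF \<open>a < c\<close> c(2) \<eta>(1)] eventually_at_left_real[OF \<open>a < c\<close>] by eventually_elim simp
    then obtain \<tau> where \<tau>: "\<Phi> \<tau> \<ge> \<Phi> c - \<eta> * (c - \<tau>)" "a < \<tau>" "\<tau> < c"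
      using eventually_happens'[OF trivial_limit_at_left_real] by fastforce
    then have "\<tau> \<in> ?A" using c by (auto simp: algebra_simps)
    then have "c \<le> \<tau>" unfolding c_def using bdd by (rule cInf_lower)
    then show False using \<tau> by simp
  qed
  then show "\<Phi> b \<le> \<Phi> a + e" using c \<eta> by simp
qed

text \<open>Regularity is assumed in the fixed coordinates, the differential inequality in the
  moving ones; passing between them by the chain rule would need spatial derivatives of the flow.
  The inequality carries the factor \<open>w\<close> because \<open>w\<close> may change
  sign.\<close>

locale moving_subsolution = C11_flow V V' \<phi>
  for V :: "'a::euclidean_space \<Rightarrow> 'a" and V' \<phi> +
  fixes \<Omega>\<^sub>0 :: "'a set" and w :: "'a \<Rightarrow> real \<Rightarrow> real"
    and Fx :: "'a \<Rightarrow> real \<Rightarrow> 'a \<Rightarrow>\<^sub>L real" and Fxx :: "'a \<Rightarrow> real \<Rightarrow> 'a \<Rightarrow>\<^sub>L 'a \<Rightarrow>\<^sub>L real" and Ft :: "'a \<Rightarrow> real \<Rightarrow> real"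
  assumes open_\<Omega>: "open \<Omega>\<^sub>0" and bounded_\<Omega>: "bounded \<Omega>\<^sub>0"
    and Fx: "x \<in> closure \<Omega>\<^sub>0 \<Longrightarrow> 0 < t \<Longrightarrow> ((\<lambda>z. w (\<phi> t z) t) has_derivative Fx x t) (at x within closure \<Omega>\<^sub>0)"
    and Fxx: "x \<in> closure \<Omega>\<^sub>0 \<Longrightarrow> 0 < t \<Longrightarrow> ((\<lambda>z. Fx z t) has_derivative Fxx x t) (at x within closure \<Omega>\<^sub>0)"
    and Ft: "x \<in> closure \<Omega>\<^sub>0 \<Longrightarrow> 0 < t \<Longrightarrow> ((\<lambda>s. w (\<phi> s x) s) has_real_derivative Ft x t) (at t)"
    and cont_F: "continuous_on (closure \<Omega>\<^sub>0 \<times> {0<..}) (\<lambda>(x, t). w (\<phi> t x) t)"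
    and cont_Fx: "continuous_on (closure \<Omega>\<^sub>0 \<times> {0<..}) (\<lambda>(x, t). Fx x t)"
    and cont_Fxx: "continuous_on (closure \<Omega>\<^sub>0 \<times> {0<..}) (\<lambda>(x, t). Fxx x t)"
    and cont_Ft: "continuous_on (closure \<Omega>\<^sub>0 \<times> {0<..}) (\<lambda>(x, t). Ft x t)"
    and boundary: "x \<in> frontier \<Omega>\<^sub>0 \<Longrightarrow> 0 < t \<Longrightarrow> w (\<phi> t x) t = 0"
    and subsolution: "0 < t \<Longrightarrow> y \<in> \<phi> t ` \<Omega>\<^sub>0 \<Longrightarrow> \<exists>D L. ((\<lambda>s. w y s) has_real_derivative D) (at t) \<and>
      has_laplacian (\<lambda>z. w z t) L y \<and> w y t * D \<le> w y t * L"
begin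

interpretation rev: C11_flow "\<lambda>x. - V x" "\<lambda>x v. - V' x v" "\<lambda>t. \<phi> (- t)"
  by (rule reverse_flow)

text \<open>The extension by zero is made on the fixed domain, where the sets to be glued are
  products with the time axis; \<open>G\<close> is its transport along the flow.\<close>

definition F :: "'a \<Rightarrow> real \<Rightarrow> real" where "F x t = (if x \<in> closure \<Omega>\<^sub>0 then w (\<phi> t x) t else 0)"

definition G :: "'a \<Rightarrow> real \<Rightarrow> real" where "G y t = F (\<phi> (- t) y) t"

lemma compact_closure_\<Omega>: "compact (closure \<Omega>\<^sub>0)"
  using bounded_\<Omega> by simp

lemma F_zero: "x \<notin> \<Omega>\<^sub>0 \<Longrightarrow> 0 < t \<Longrightarrow> F x t = 0"
  using boundary[of x t] open_\<Omega> by (auto simp: F_def frontier_def interior_open)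

lemma G_eq: "y \<in> \<phi> t ` \<Omega>\<^sub>0 \<Longrightarrow> G y t = w y t"
  unfolding mem_flow_image using closure_subset by (auto simp: G_def F_def flow_inverse')

lemma G_zero: "y \<notin> \<phi> t ` \<Omega>\<^sub>0 \<Longrightarrow> 0 < t \<Longrightarrow> G y t = 0"
  unfolding mem_flow_image by (auto simp: G_def F_zero)

text \<open>Two relatively closed sets are glued. They overlap in the frontier of the domain, where
  the boundary condition makes both pieces 0.\<close>

lemma continuous_F: "continuous_on (UNIV \<times> {0<..}) (\<lambda>(x, t). F x t)"
proof -
  let ?S = "closure \<Omega>\<^sub>0 \<times> {0::real<..}" and ?T = "(- \<Omega>\<^sub>0) \<times> {0::real<..}"
  have U: "?S \<union> ?T = UNIV \<times> {0<..}" using closure_subset by auto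
  have "continuous_on (?S \<union> ?T) (\<lambda>p. if fst p \<in> closure \<Omega>\<^sub>0 then w (\<phi> (snd p) (fst p)) (snd p) else 0)"
  proof (rule continuous_on_cases_local)
    have "?S = (?S \<union> ?T) \<inter> (closure \<Omega>\<^sub>0 \<times> UNIV)" "?T = (?S \<union> ?T) \<inter> ((- \<Omega>\<^sub>0) \<times> UNIV)"
      using closure_subset by auto
    moreover have "closed (closure \<Omega>\<^sub>0 \<times> (UNIV :: real set))" "closed ((- \<Omega>\<^sub>0) \<times> (UNIV :: real set))"
      using open_\<Omega> by (auto intro!: closed_Times)
    ultimately show "closedin (top_of_set (?S \<union> ?T)) ?S" "closedin (top_of_set (?S \<union> ?T)) ?T"
      unfolding closedin_closed by blast+
    show "continuous_on ?S (\<lambda>p. w (\<phi> (snd p) (fst p)) (snd p))"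
      using cont_F by (simp add: case_prod_beta)
    show "w (\<phi> (snd p) (fst p)) (snd p) = 0"
      if "p \<in> ?S \<and> fst p \<notin> closure \<Omega>\<^sub>0 \<or> p \<in> ?T \<and> fst p \<in> closure \<Omega>\<^sub>0" for p
      using that F_zero[of "fst p" "snd p"] by (auto simp: F_def)
  qed simp
  then show ?thesis unfolding U by (simp add: F_def case_prod_beta)
qed

lemma continuous_F_space: "0 < t \<Longrightarrow> continuous_on UNIV (\<lambda>x. F x t)"
  using continuous_on_compose2[OF continuous_F continuous_on_Pair[OF continuous_on_id continuous_on_const], of t UNIV]
  by auto

lemma continuous_G_space: "0 < t \<Longrightarrow> continuous_on UNIV (\<lambda>y. G y t)"
  unfolding G_def
  by (rule continuous_on_compose2[OF continuous_F_space continuous_flow_space]) auto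

lemma borel_measurable_G: "0 < t \<Longrightarrow> (\<lambda>y. G y t) \<in> borel_measurable borel"
  by (rule borel_measurable_continuous_onI[OF continuous_G_space])

lemma continuous_G_time: "continuous_on {0<..} (\<lambda>t. G y t)"
proof -
  have "continuous_on {0<..} (\<lambda>t. (\<phi> (- t) y, t))"
    by (intro continuous_on_Pair rev.continuous_flow_time continuous_on_id)
  from continuous_on_compose2[OF continuous_F this] show ?thesis
    by (auto simp: G_def)
qed

lemma G_bounded:
  assumes "0 < a" "a \<le> b"
  obtains M R where "0 \<le> M" "\<And>y t. t \<in> {a..b} \<Longrightarrow> \<bar>G y t\<bar> \<le> M"
    "\<And>y t. t \<in> {a..b} \<Longrightarrow> y \<notin> cball 0 R \<Longrightarrow> G y t = 0"
proof -
  have "continuous_on (closure \<Omega>\<^sub>0 \<times> {a..b}) (\<lambda>(x, t). F x t)"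
    by (rule continuous_on_subset[OF continuous_F]) (use assms in auto)
  then have "bounded ((\<lambda>(x, t). F x t) ` (closure \<Omega>\<^sub>0 \<times> {a..b}))"
    by (intro compact_imp_bounded compact_continuous_image compact_Times compact_closure_\<Omega>) auto
  then obtain M where M: "0 < M" "\<And>x t. x \<in> closure \<Omega>\<^sub>0 \<Longrightarrow> t \<in> {a..b} \<Longrightarrow> \<bar>F x t\<bar> \<le> M"
    by (auto simp: bounded_pos)
  have bd: "\<bar>G y t\<bar> \<le> M" if "t \<in> {a..b}" for y t
    using M(2)[OF _ that, of "\<phi> (- t) y"] M(1) by (cases "\<phi> (- t) y \<in> closure \<Omega>\<^sub>0") (auto simp: G_def, simp add: F_def)
  obtain R where R: "\<And>x t. x \<in> closure \<Omega>\<^sub>0 \<Longrightarrow> t \<in> {0..b} \<Longrightarrow> norm (\<phi> t x) \<le> R"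
    using flow_bounded_on_compact[OF compact_closure_\<Omega>, of b] assms by fastforce
  have "G y t = 0" if "t \<in> {a..b}" "y \<notin> cball 0 R" for y t
  proof (rule G_zero)
    show "y \<notin> \<phi> t ` \<Omega>\<^sub>0" using R that assms closure_subset by fastforce
  qed (use that assms in auto)
  with bd M(1) that show thesis by (meson less_imp_le)
qed

text \<open>The superlevel set is compact and contained in an open set, hence at positive distance
  from the complement. This is what truncation gains.\<close>

lemma superlevel_margin:
  assumes "0 < t" "0 < e"
  obtains \<delta> where "0 < \<delta>" "\<And>x z. e \<le> \<bar>F x t\<bar> \<Longrightarrow> dist x z < \<delta> \<Longrightarrow> z \<in> \<Omega>\<^sub>0"
proof -
  let ?S = "{x. e \<le> \<bar>F x t\<bar>}"
  have sub: "?S \<subseteq> \<Omega>\<^sub>0" using F_zero[OF _ \<open>0 < t\<close>] \<open>0 < e\<close> by force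
  have "closed ?S"
    by (intro closed_Collect_le continuous_intros continuous_F_space \<open>0 < t\<close>)
  moreover have "bounded ?S" using bounded_\<Omega> sub bounded_subset by blast
  ultimately have "compact ?S" by (simp add: compact_eq_bounded_closed)
  then obtain \<delta> where "\<delta> > 0" "\<forall>x\<in>?S. \<forall>z\<in>- \<Omega>\<^sub>0. \<delta> \<le> dist x z"
    using separate_compact_closed[of ?S "- \<Omega>\<^sub>0"] open_\<Omega> sub by auto
  then show thesis using that by (metis ComplI linorder_not_le mem_Collect_eq)
qed

text \<open>The mean value inequality needs convexity, which the domain lacks, so the bounds are
  stated inside balls. One \<open>K\<close> serves all of them because the derivatives are bounded
  on the compact closure.\<close>

lemma F_local_bounds:
  assumes t: "0 < t"
  obtains K where "0 \<le> K"
    "\<And>x z \<delta>. ball x \<delta> \<subseteq> \<Omega>\<^sub>0 \<Longrightarrow> z \<in> ball x \<delta> \<Longrightarrow> \<bar>F z t - F x t\<bar> \<le> K * norm (z - x)"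
    "\<And>x z \<delta>. ball x \<delta> \<subseteq> \<Omega>\<^sub>0 \<Longrightarrow> z \<in> ball x \<delta> \<Longrightarrow> \<bar>F z t - F x t - Fx x t (z - x)\<bar> \<le> K * (norm (z - x))\<^sup>2"
    "\<And>x v. x \<in> \<Omega>\<^sub>0 \<Longrightarrow> \<bar>Fx x t v\<bar> \<le> K * norm v"
proof -
  have "continuous_on (closure \<Omega>\<^sub>0) (\<lambda>x. Fx x t)" "continuous_on (closure \<Omega>\<^sub>0) (\<lambda>x. Fxx x t)"
    using continuous_on_compose2[OF cont_Fx continuous_on_Pair[OF continuous_on_id continuous_on_const], of t "closure \<Omega>\<^sub>0"]
      continuous_on_compose2[OF cont_Fxx continuous_on_Pair[OF continuous_on_id continuous_on_const], of t "closure \<Omega>\<^sub>0"] t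
    by auto
  then have "bounded ((\<lambda>x. Fx x t) ` closure \<Omega>\<^sub>0)" "bounded ((\<lambda>x. Fxx x t) ` closure \<Omega>\<^sub>0)"
    by (auto intro!: compact_imp_bounded compact_continuous_image compact_closure_\<Omega>)
  then obtain K1 K2 where K: "0 < K1" "\<And>x. x \<in> closure \<Omega>\<^sub>0 \<Longrightarrow> norm (Fx x t) \<le> K1"
    "0 < K2" "\<And>x. x \<in> closure \<Omega>\<^sub>0 \<Longrightarrow> norm (Fxx x t) \<le> K2"
    by (auto simp: bounded_pos)
  let ?K = "K1 + K2"
  have sub: "ball x \<delta> \<subseteq> closure \<Omega>\<^sub>0" if "ball x \<delta> \<subseteq> \<Omega>\<^sub>0" for x \<delta> using that closure_subset by blast
  have dF: "((\<lambda>z. F z t) has_derivative Fx z t) (at z within ball x \<delta>)"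
    if "ball x \<delta> \<subseteq> \<Omega>\<^sub>0" "z \<in> ball x \<delta>" for x z \<delta>
  proof (rule has_derivative_transform[OF that(2)])
    show "((\<lambda>z. w (\<phi> t z) t) has_derivative Fx z t) (at z within ball x \<delta>)"
      using has_derivative_subset[OF Fx sub[OF that(1)]] t sub[OF that(1)] that(2) by blast
    show "F z' t = w (\<phi> t z') t" if z': "z' \<in> ball x \<delta>" for z'
      using subsetD[OF sub[OF \<open>ball x \<delta> \<subseteq> \<Omega>\<^sub>0\<close>] z'] by (simp add: F_def)
  qed
  have dFx: "((\<lambda>z. Fx z t) has_derivative Fxx z t) (at z within ball x \<delta>)"
    if "ball x \<delta> \<subseteq> \<Omega>\<^sub>0" "z \<in> ball x \<delta>" for x z \<delta>
    using has_derivative_subset[OF Fxx sub[OF that(1)]] t sub[OF that(1)] that(2) by blast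
  have lip: "norm (Fx z t - Fx x' t) \<le> K2 * norm (z - x')"
    if b: "ball x \<delta> \<subseteq> \<Omega>\<^sub>0" "z \<in> ball x \<delta>" "x' \<in> ball x \<delta>" for x x' z \<delta>
    by (rule differentiable_bound[OF convex_ball dFx[OF b(1)] _ b(2,3)])
      (use K(4) sub[OF b(1)] in \<open>auto simp flip: norm_blinfun.rep_eq\<close>)
  show thesis
  proof (rule that[of ?K])
    show "0 \<le> ?K" using K by simp
    fix x z \<delta> assume b: "ball x \<delta> \<subseteq> \<Omega>\<^sub>0" and z: "z \<in> ball x \<delta>"
    have x: "x \<in> ball x \<delta>" using z by (metis centre_in_ball dist_not_less_zero mem_ball not_less order.strict_trans1 zero_le_dist)
    have "norm (F z t - F x t) \<le> K1 * norm (z - x)"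
      by (rule differentiable_bound[OF convex_ball dF[OF b] _ z x])
        (use K(2) sub[OF b] in \<open>auto simp flip: norm_blinfun.rep_eq\<close>)
    also have "\<dots> \<le> ?K * norm (z - x)" using K by (intro mult_right_mono) auto
    finally show "\<bar>F z t - F x t\<bar> \<le> ?K * norm (z - x)" by simp
    have "norm (F z t - F x t - Fx x t (z - x)) \<le> K2 * (norm (z - x))\<^sup>2"
    proof (rule taylor_quadratic[OF convex_ball dF[OF b] _ _ x z])
      fix x' z' v assume xz: "x' \<in> ball x \<delta>" "z' \<in> ball x \<delta>"
      have "norm (Fx z' t v - Fx x' t v) \<le> norm (Fx z' t - Fx x' t) * norm v"
        using norm_blinfun[of "Fx z' t - Fx x' t" v] by (simp add: blinfun.diff_left)
      also have "\<dots> \<le> K2 * norm (z' - x') * norm v"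
        using lip[OF b xz(2,1)] by (rule mult_right_mono) simp
      finally show "norm (Fx z' t v - Fx x' t v) \<le> K2 * norm (z' - x') * norm v" .
    qed (use K in auto)
    also have "\<dots> \<le> ?K * (norm (z - x))\<^sup>2" using K by (intro mult_right_mono) auto
    finally show "\<bar>F z t - F x t - Fx x t (z - x)\<bar> \<le> ?K * (norm (z - x))\<^sup>2" by simp
  next
    fix x v assume "x \<in> \<Omega>\<^sub>0"
    then have "norm (Fx x t) \<le> ?K" using K closure_subset by (smt (verit) subsetD)
    then show "\<bar>Fx x t v\<bar> \<le> ?K * norm v"
      using norm_blinfun[of "Fx x t" v] by (smt (verit) mult_right_mono norm_ge_zero real_norm_def)
  qed
qed

lemma G_second_difference_bound:
  assumes t: "0 < t" and e: "0 < e"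
  obtains M h0 where "0 < h0" "0 \<le> M"
    "\<And>y b h. e \<le> \<bar>G y t\<bar> \<Longrightarrow> norm b = 1 \<Longrightarrow> 0 < h \<Longrightarrow> h < h0 \<Longrightarrow>
      \<bar>G (y + h *\<^sub>R b) t + G (y - h *\<^sub>R b) t - 2 * G y t\<bar> \<le> M * h\<^sup>2"
proof -
  obtain M0 R0 where supp: "\<And>y s. s \<in> {t..t} \<Longrightarrow> y \<notin> cball 0 R0 \<Longrightarrow> G y s = 0"
    using G_bounded[OF t order_refl] by metis
  obtain C where C: "0 \<le> C"
    "\<And>x y s. x \<in> cball 0 (R0 + 1) \<Longrightarrow> y \<in> cball 0 (R0 + 1) \<Longrightarrow> s \<in> {0..t} \<Longrightarrow>
       norm (\<phi> (- s) x - \<phi> (- s) y) \<le> exp (C * s) * norm (x - y)"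
    "\<And>x y z s. x \<in> cball 0 (R0 + 1) \<Longrightarrow> y \<in> cball 0 (R0 + 1) \<Longrightarrow> z \<in> cball 0 (R0 + 1) \<Longrightarrow> s \<in> {0..t} \<Longrightarrow>
       x + y = 2 *\<^sub>R z \<Longrightarrow> norm (\<phi> (- s) x + \<phi> (- s) y - 2 *\<^sub>R \<phi> (- s) z) \<le> C * (norm (x - z))\<^sup>2"
    using rev.flow_estimates[of t "R0 + 1"] t by (metis less_imp_le)
  obtain \<delta> where \<delta>: "0 < \<delta>" "\<And>x z. e \<le> \<bar>F x t\<bar> \<Longrightarrow> dist x z < \<delta> \<Longrightarrow> z \<in> \<Omega>\<^sub>0"
    using superlevel_margin[OF t e] by blast
  obtain K where K: "0 \<le> K"
    "\<And>x z \<delta>. ball x \<delta> \<subseteq> \<Omega>\<^sub>0 \<Longrightarrow> z \<in> ball x \<delta> \<Longrightarrow> \<bar>F z t - F x t - Fx x t (z - x)\<bar> \<le> K * (norm (z - x))\<^sup>2"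
    "\<And>x v. x \<in> \<Omega>\<^sub>0 \<Longrightarrow> \<bar>Fx x t v\<bar> \<le> K * norm v"
    using F_local_bounds[OF t] by metis
  let ?E = "exp (C * t)"
  \<comment> \<open>The bound 1 keeps the shifted points in the ball of radius \<open>R0 + 1\<close>
    where the flow estimates hold; the other keeps their preimages within \<delta> of
    \<open>x\<close>.\<close>
  define h0 where "h0 = min 1 (\<delta> / ?E)"
  have h0: "0 < h0" using \<delta> by (simp add: h0_def)
  let ?M = "2 * K * ?E\<^sup>2 + K * C"
  show thesis
  proof (rule that[OF h0])
    show "0 \<le> ?M" using K C by simp
    fix y b :: 'a and h :: real
    assume Gy: "e \<le> \<bar>G y t\<bar>" and b: "norm b = 1" and h: "0 < h" "h < h0"
    define x p q where "x = \<phi> (- t) y" and "p = \<phi> (- t) (y + h *\<^sub>R b)" and "q = \<phi> (- t) (y - h *\<^sub>R b)"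
    have "y \<in> cball 0 R0" using supp[of t y] Gy e by fastforce
    moreover have "norm (h *\<^sub>R b) \<le> 1" using h b by (simp add: h0_def)
    ultimately have ball: "y \<in> cball 0 (R0 + 1)" "y + h *\<^sub>R b \<in> cball 0 (R0 + 1)" "y - h *\<^sub>R b \<in> cball 0 (R0 + 1)"
      using norm_triangle_ineq[of y "h *\<^sub>R b"] norm_triangle_ineq4[of y "h *\<^sub>R b"] by auto
    have tt: "t \<in> {0..t}" using t by simp
    have px: "norm (p - x) \<le> ?E * h" and qx: "norm (q - x) \<le> ?E * h"
      using C(2)[OF ball(2,1) tt] C(2)[OF ball(3,1) tt] h b by (auto simp: x_def p_def q_def)
    have "?E * h < \<delta>" using h by (simp add: h0_def field_simps)
    then have pq: "p \<in> ball x \<delta>" "q \<in> ball x \<delta>" using px qx by (auto simp: dist_norm norm_minus_commute)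
    have Fx_e: "e \<le> \<bar>F x t\<bar>" using Gy by (simp add: G_def x_def)
    then have sub: "ball x \<delta> \<subseteq> \<Omega>\<^sub>0" using \<delta> by auto
    then have x: "x \<in> \<Omega>\<^sub>0" using \<delta>(1) by auto
    have pqx: "norm (p + q - 2 *\<^sub>R x) \<le> C * h\<^sup>2"
      using C(3)[OF ball(2,3,1) tt] h b by (simp add: x_def p_def q_def scaleR_2)
    \<comment> \<open>Second-order chain rule in difference form: Taylor remainders of the pull-back
      at two points, and its derivative applied to the second difference of the inverse flow. Each
      is of order h^2.\<close>
    have "G (y + h *\<^sub>R b) t + G (y - h *\<^sub>R b) t - 2 * G y t = (F p t - F x t - Fx x t (p - x)) + (F q t - F x t - Fx x t (q - x))
        + Fx x t (p + q - 2 *\<^sub>R x)"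
      by (simp add: G_def x_def p_def q_def blinfun.diff_right blinfun.add_right blinfun.scaleR_right)
    also have "\<bar>\<dots>\<bar> \<le> K * (norm (p - x))\<^sup>2 + K * (norm (q - x))\<^sup>2 + K * norm (p + q - 2 *\<^sub>R x)"
      using K(2)[OF sub pq(1)] K(2)[OF sub pq(2)] K(3)[OF x, of "p + q - 2 *\<^sub>R x"] by linarith
    also have "\<dots> \<le> K * (?E * h)\<^sup>2 + K * (?E * h)\<^sup>2 + K * (C * h\<^sup>2)"
      using px qx pqx K by (intro add_mono mult_left_mono power_mono) auto
    finally show "\<bar>G (y + h *\<^sub>R b) t + G (y - h *\<^sub>R b) t - 2 * G y t\<bar> \<le> ?M * h\<^sup>2"
      by (simp add: algebra_simps power_mult_distrib)
  qed
qed

text \<open>With the spatial point fixed, its preimage moves with time. The difference splits into a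
  change of time at the preimage \<open>z\<close> and a displacement from \<open>x\<close> to
  \<open>z\<close> at time \<open>t\<close>.\<close>

lemma G_time_difference_bound:
  assumes t: "0 < t" and e: "0 < e"
  obtains M s0 where "0 < s0" "s0 < t" "0 \<le> M"
    "\<And>y s. e \<le> \<bar>G y t\<bar> \<Longrightarrow> s0 < s \<Longrightarrow> s < t \<Longrightarrow> \<bar>G y s - G y t\<bar> \<le> M * \<bar>s - t\<bar>"
proof -
  obtain M0 R0 where supp: "\<And>y s. s \<in> {t..t} \<Longrightarrow> y \<notin> cball 0 R0 \<Longrightarrow> G y s = 0"
    using G_bounded[OF t order_refl] by metis
  obtain C where C: "0 \<le> C"
    "\<And>x s s'. x \<in> cball 0 R0 \<Longrightarrow> s \<in> {0..t} \<Longrightarrow> s' \<in> {0..t} \<Longrightarrow> norm (\<phi> (- s) x - \<phi> (- s') x) \<le> C * \<bar>s - s'\<bar>"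
    using rev.flow_estimates[of t R0] t by (metis less_imp_le)
  obtain \<delta> where \<delta>: "0 < \<delta>" "\<And>x z. e \<le> \<bar>F x t\<bar> \<Longrightarrow> dist x z < \<delta> \<Longrightarrow> z \<in> \<Omega>\<^sub>0"
    using superlevel_margin[OF t e] by blast
  obtain K where K: "0 \<le> K"
    "\<And>x z \<delta>. ball x \<delta> \<subseteq> \<Omega>\<^sub>0 \<Longrightarrow> z \<in> ball x \<delta> \<Longrightarrow> \<bar>F z t - F x t\<bar> \<le> K * norm (z - x)"
    using F_local_bounds[OF t] by metis
  have "continuous_on (closure \<Omega>\<^sub>0 \<times> {t/2..t}) (\<lambda>(x, t). Ft x t)"
    by (rule continuous_on_subset[OF cont_Ft]) (use t in auto)
  then have "bounded ((\<lambda>(x, t). Ft x t) ` (closure \<Omega>\<^sub>0 \<times> {t/2..t}))"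
    by (intro compact_imp_bounded compact_continuous_image compact_Times compact_closure_\<Omega>) auto
  then obtain K' where K': "0 < K'" "\<And>x s. x \<in> closure \<Omega>\<^sub>0 \<Longrightarrow> s \<in> {t/2..t} \<Longrightarrow> \<bar>Ft x s\<bar> \<le> K'"
    by (auto simp: bounded_pos)
  \<comment> \<open>Half of \<open>t\<close> keeps away from time 0, where \<open>Ft\<close> need
    not be bounded. The other term keeps the preimage within \<delta> of \<open>x\<close>; the
    summand 1 allows C = 0.\<close>
  define s0 where "s0 = max (t / 2) (t - \<delta> / (C + 1))"
  have s0: "0 < s0" "s0 < t" "t / 2 \<le> s0" using t \<delta> C by (auto simp: s0_def)
  let ?M = "K' + K * C"
  show thesis
  proof (rule that[OF s0(1,2)])
    show "0 \<le> ?M" using K K' C by simp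
    fix y s assume Gy: "e \<le> \<bar>G y t\<bar>" and s: "s0 < s" "s < t"
    define x z where "x = \<phi> (- t) y" and "z = \<phi> (- s) y"
    have y: "y \<in> cball 0 R0" using supp[of t y] Gy e by fastforce
    have zx: "norm (z - x) \<le> C * \<bar>s - t\<bar>"
      unfolding x_def z_def using s s0 by (intro C(2) y) auto
    have "t - \<delta> / (C + 1) < s" using s by (simp add: s0_def)
    then have "(C + 1) * (t - s) < \<delta>" using C by (simp add: field_simps)
    moreover have "C * \<bar>s - t\<bar> \<le> (C + 1) * (t - s)" using C s by (simp add: algebra_simps)
    ultimately have z: "z \<in> ball x \<delta>" using zx by (simp add: dist_norm norm_minus_commute)
    have Fx_e: "e \<le> \<bar>F x t\<bar>" using Gy by (simp add: G_def x_def)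
    then have sub: "ball x \<delta> \<subseteq> \<Omega>\<^sub>0" using \<delta> by auto
    then have zc: "z \<in> closure \<Omega>\<^sub>0" using z closure_subset[of \<Omega>\<^sub>0] by blast
    have "norm (F z s - F z t) \<le> K' * norm (s - t)"
    proof (rule differentiable_bound[of "{t/2..t}" "\<lambda>s. F z s" "\<lambda>r h. h * Ft z r"])
      fix r assume r: "r \<in> {t/2..t}"
      then have "((\<lambda>s. w (\<phi> s z) s) has_real_derivative Ft z r) (at r)" using zc t by (intro Ft) auto
      then have "((\<lambda>s. F z s) has_real_derivative Ft z r) (at r)" using zc by (simp add: F_def)
      then show "((\<lambda>s. F z s) has_derivative (\<lambda>h. h * Ft z r)) (at r within {t/2..t})"
        by (auto simp: has_field_derivative_def mult_commute_abs intro: has_derivative_at_withinI)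
      show "onorm (\<lambda>h. h * Ft z r) \<le> K'"
        using mult_right_mono[OF K'(2)[OF zc r] abs_ge_zero] by (intro onorm_le) (simp add: abs_mult mult.commute)
    qed (use s s0 in auto)
    moreover have "\<bar>F z t - F x t\<bar> \<le> K * (C * \<bar>s - t\<bar>)"
      using K(2)[OF sub z] mult_left_mono[OF zx K(1)] by linarith
    ultimately show "\<bar>G y s - G y t\<bar> \<le> ?M * \<bar>s - t\<bar>"
      unfolding G_def x_def[symmetric] z_def[symmetric] by (simp add: algebra_simps)
  qed
qed

section \<open>Monotonicity of the truncated energy\<close>

definition energy :: "real \<Rightarrow> real \<Rightarrow> real" where
  "energy e t = (LINT y|lborel. (excess e (G y t))\<^sup>2)"

lemma integrable_energy:
  assumes "0 < t" "0 < e"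
  shows "integrable lborel (\<lambda>y. (excess e (G y t))\<^sup>2)"
proof -
  obtain M R where M: "0 \<le> M" "\<And>y s. s \<in> {t..t} \<Longrightarrow> \<bar>G y s\<bar> \<le> M"
    "\<And>y s. s \<in> {t..t} \<Longrightarrow> y \<notin> cball 0 R \<Longrightarrow> G y s = 0"
    using G_bounded[OF \<open>0 < t\<close> order_refl] by metis
  note [measurable] = borel_measurable_G[OF \<open>0 < t\<close>] borel_measurable_continuous_onI[OF continuous_excess]
  show ?thesis
  proof (rule integrable_bounded_support[where M="M\<^sup>2" and R=R])
    show "\<bar>(excess e (G y t))\<^sup>2\<bar> \<le> M\<^sup>2" for y
      using excess_bounds(3)[OF \<open>0 < e\<close>, of "G y t"] M(2)[of t y] by (simp add: abs_le_square_iff[symmetric])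
  qed (use M excess_bounds(1)[OF \<open>0 < e\<close>] in auto)
qed

lemma continuous_energy:
  assumes "0 < a" "a \<le> b" "0 < e"
  shows "continuous_on {a..b} (energy e)"
  unfolding continuous_on_sequentially
proof (intro allI ballI impI)
  fix s :: "nat \<Rightarrow> real" and t assume t: "t \<in> {a..b}" and s: "(\<forall>n. s n \<in> {a..b}) \<and> s \<longlonglongrightarrow> t"
  obtain M R where M: "0 \<le> M" "\<And>y s. s \<in> {a..b} \<Longrightarrow> \<bar>G y s\<bar> \<le> M"
    "\<And>y s. s \<in> {a..b} \<Longrightarrow> y \<notin> cball 0 R \<Longrightarrow> G y s = 0"
    using G_bounded[OF assms(1,2)] by metis
  have pos: "0 < r" if "r \<in> {a..b}" for r using that assms by simp
  have meas: "(\<lambda>y. (excess e (G y r))\<^sup>2) \<in> borel_measurable lborel" if "r \<in> {a..b}" for r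
    using integrable_energy[OF pos[OF that] \<open>0 < e\<close>] by (rule borel_measurable_integrable)
  show "(energy e \<circ> s) \<longlonglongrightarrow> energy e t"
    unfolding o_def energy_def
  proof (rule integral_dominated_convergence[where w="\<lambda>y. M\<^sup>2 * indicator (cball 0 R) y"])
    show "integrable lborel (\<lambda>y::'a. M\<^sup>2 * indicator (cball 0 R) y :: real)"
      by (rule integrable_bounded_support[where M="M\<^sup>2" and R=R]) (auto simp: indicator_def)
    show "AE y in lborel. (\<lambda>i. (excess e (G y (s i)))\<^sup>2) \<longlonglongrightarrow> (excess e (G y t))\<^sup>2"
    proof (intro AE_I2 tendsto_power)
      fix y
      have "isCont (\<lambda>t. G y t) t"
        using continuous_G_time[of y] pos[OF t] by (simp add: continuous_on_eq_continuous_at)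
      moreover have "isCont (excess e) (G y t)"
        using continuous_excess[of UNIV] by (simp add: continuous_on_eq_continuous_at)
      ultimately show "(\<lambda>i. excess e (G y (s i))) \<longlonglongrightarrow> excess e (G y t)"
        using isCont_tendsto_compose[OF _ isCont_tendsto_compose[OF _ conjunct2[OF s]]] by fast
    qed
    show "AE y in lborel. norm ((excess e (G y (s i)))\<^sup>2) \<le> M\<^sup>2 * indicator (cball 0 R) y" for i
    proof (rule AE_I2)
      fix y
      show "norm ((excess e (G y (s i)))\<^sup>2) \<le> M\<^sup>2 * indicator (cball 0 R) y"
      proof (cases "y \<in> cball 0 R")
        case True
        then show ?thesis
          using excess_bounds(3)[OF \<open>0 < e\<close>, of "G y (s i)"] M(2)[of "s i" y] s
          by (simp add: abs_le_square_iff[symmetric])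
      qed (use M(3)[of "s i" y] s excess_bounds(1)[OF \<open>0 < e\<close>] in simp)
    qed
  qed (use meas t s in auto)
qed

text \<open>The fields \<open>D\<close> and \<open>L\<close> are chosen pointwise and may be
  arbitrary outside the domain. Multiplied by \<beta>, which vanishes there, they are limits of
  dominated measurable quotients, hence integrable, and the pointwise inequality between them can be
  integrated.\<close>

lemma energy_left_bound:
  assumes t: "0 < t" and e: "0 < e" and "0 < \<eta>"
  shows "\<forall>\<^sub>F \<tau> in at_left t. energy e \<tau> \<ge> energy e t - \<eta> * (t - \<tau>)"
proof -
  \<comment> \<open>The derivative of the squared \<open>excess\<close> at the value of
    \<open>G\<close> at time \<open>t\<close>.\<close>
  define \<beta> where "\<beta> = (\<lambda>y. 2 * excess e (G y t))"
  obtain M0 R where M0: "0 \<le> M0" "\<And>y s. s \<in> {t..t} \<Longrightarrow> \<bar>G y s\<bar> \<le> M0"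
    "\<And>y s. s \<in> {t..t} \<Longrightarrow> y \<notin> cball 0 R \<Longrightarrow> G y s = 0"
    using G_bounded[OF t order_refl] by metis
  obtain M h0 where h0: "0 < h0" "0 \<le> M"
    "\<And>y b h. e \<le> \<bar>G y t\<bar> \<Longrightarrow> norm b = 1 \<Longrightarrow> 0 < h \<Longrightarrow> h < h0 \<Longrightarrow>
      \<bar>G (y + h *\<^sub>R b) t + G (y - h *\<^sub>R b) t - 2 * G y t\<bar> \<le> M * h\<^sup>2"
    using G_second_difference_bound[OF t e] by metis
  obtain M' s0 where s0: "0 < s0" "s0 < t" "0 \<le> M'"
    "\<And>y s. e \<le> \<bar>G y t\<bar> \<Longrightarrow> s0 < s \<Longrightarrow> s < t \<Longrightarrow> \<bar>G y s - G y t\<bar> \<le> M' * \<bar>s - t\<bar>"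
    using G_time_difference_bound[OF t e] by metis
  have \<beta>_meas[measurable]: "\<beta> \<in> borel_measurable borel"
    unfolding \<beta>_def using borel_measurable_G[OF t] borel_measurable_continuous_onI[OF continuous_excess]
    by measurable
  have \<beta>_zero: "\<beta> y = 0" if "\<bar>G y t\<bar> < e" for y using that excess_bounds(2)[OF e] by (simp add: \<beta>_def)
  have \<beta>_supp: "\<beta> y = 0" if "y \<notin> cball 0 R" for y using that M0(3)[of t y] excess_bounds(1)[OF e] by (simp add: \<beta>_def)
  have \<beta>_bd: "\<bar>\<beta> y\<bar> \<le> 2 * M0" for y
    using excess_bounds(3)[OF e, of "G y t"] M0(2)[of t y] by (simp add: \<beta>_def)
  have inside: "y \<in> \<phi> t ` \<Omega>\<^sub>0" if "\<beta> y \<noteq> 0" for y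
    using that G_zero[OF _ t] \<beta>_zero[of y] e by force
  obtain D L where DL: "\<And>y. y \<in> \<phi> t ` \<Omega>\<^sub>0 \<Longrightarrow> ((\<lambda>s. w y s) has_real_derivative D y) (at t)"
    "\<And>y. y \<in> \<phi> t ` \<Omega>\<^sub>0 \<Longrightarrow> has_laplacian (\<lambda>z. w z t) (L y) y"
    "\<And>y. y \<in> \<phi> t ` \<Omega>\<^sub>0 \<Longrightarrow> w y t * D y \<le> w y t * L y"
    using subsolution[OF t] by metis
  have DLle: "\<beta> y * D y \<le> \<beta> y * L y" for y
  proof (cases "\<beta> y = 0")
    case False
    then show ?thesis using DL(3)[OF inside[OF False]] excess_bounds(5)[OF e, of "G y t" "D y" "L y"] G_eq[OF inside[OF False]]
      by (simp add: \<beta>_def)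
  qed simp
  let ?\<Delta> = "\<lambda>h y. \<Sum>b\<in>Basis. (G (y + h *\<^sub>R b) t + G (y - h *\<^sub>R b) t - 2 * G y t) / h\<^sup>2"
  have lim\<Delta>: "((\<lambda>h. \<beta> y * ?\<Delta> h y) \<longlongrightarrow> \<beta> y * L y) (at_right 0)" for y
  proof (cases "\<beta> y = 0")
    case False
    have "has_laplacian (\<lambda>z. G z t) (L y) y"
    proof -
      obtain g H where g: "\<forall>\<^sub>F z in nhds y. GDERIV (\<lambda>z. w z t) z :> g z" "(g has_derivative H) (at y)"
          "L y = (\<Sum>b\<in>Basis. H b \<bullet> b)"
        using DL(2)[OF inside[OF False]] unfolding has_laplacian_def by blast
      have "\<forall>\<^sub>F z in nhds y. z \<in> \<phi> t ` \<Omega>\<^sub>0"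
        using inside[OF False] open_flow_image[OF open_\<Omega>] eventually_nhds by blast
      with g(1) have "\<forall>\<^sub>F z in nhds y. GDERIV (\<lambda>z. G z t) z :> g z"
      proof eventually_elim
        case (elim z)
        show ?case
          unfolding gderiv_def
        proof (rule has_derivative_transform_within_open[OF _ open_flow_image[OF open_\<Omega>] elim(2)])
          show "((\<lambda>z. w z t) has_derivative (\<lambda>h. h \<bullet> g z)) (at z)" using elim(1) by (simp add: gderiv_def)
        qed (simp add: G_eq)
      qed
      then show ?thesis using g unfolding has_laplacian_def by blast
    qed
    then show ?thesis by (intro tendsto_intros has_laplacian_second_difference)
  qed simp
  have limD: "((\<lambda>s. \<beta> y * ((G y s - G y t) / (s - t))) \<longlongrightarrow> \<beta> y * D y) (at_left t)" for y
  proof (cases "\<beta> y = 0")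
    case False
    \<comment> \<open>For \<open>s\<close> close to \<open>t\<close> the point \<open>y\<close>
      still lies in the moving domain, so \<open>G\<close> and \<open>w\<close> have the same
      difference quotient.\<close>
    have "((\<lambda>s. \<phi> (- s) y) \<longlongrightarrow> \<phi> (- t) y) (at t)"
      using rev.continuous_flow_time[of UNIV y] by (simp add: continuous_on_eq_continuous_at isCont_def)
    then have "\<forall>\<^sub>F s in at t. \<phi> (- s) y \<in> \<Omega>\<^sub>0"
      using inside[OF False] open_\<Omega> unfolding mem_flow_image by (auto dest: topological_tendstoD)
    then have ev: "\<forall>\<^sub>F s in at t. (w y s - w y t) / (s - t) = (G y s - G y t) / (s - t)"
      by eventually_elim (use inside[OF False] in \<open>simp add: G_eq mem_flow_image\<close>)
    have "((\<lambda>s. (w y s - w y t) / (s - t)) \<longlongrightarrow> D y) (at t)"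
      using DL(1)[OF inside[OF False]] by (simp add: has_field_derivative_iff)
    from Lim_transform_eventually[OF this ev] have "((\<lambda>s. (G y s - G y t) / (s - t)) \<longlongrightarrow> D y) (at_left t)"
      by (simp add: filterlim_at_split)
    then show ?thesis by (intro tendsto_intros)
  qed simp
  have G_meas[measurable]: "(\<lambda>y. G y s) \<in> borel_measurable borel" if "0 < s" for s
    using borel_measurable_G[OF that] .
  \<comment> \<open>The shift by 2 keeps every step strictly below \<open>h0\<close>; a shift by 1
    would start at \<open>h0\<close> itself.\<close>
  define h where "h = (\<lambda>n::nat. h0 / real (n + 2))"
  have h: "0 < h n" "h n < h0" for n using h0(1) by (auto simp: h_def field_simps add_pos_nonneg)
  have "h \<longlonglongrightarrow> 0" unfolding h_def
    by (rule LIMSEQ_ignore_initial_segment[of "\<lambda>n. h0 / real n" 0 2, OF lim_const_over_n])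
  then have h_lim: "filterlim h (at_right 0) sequentially"
    using h(1) by (auto simp: filterlim_at less_imp_neq[THEN not_sym] intro!: always_eventually)
  have \<Delta>_meas: "(\<lambda>y. \<beta> y * ?\<Delta> k y) \<in> borel_measurable lborel" for k
    using G_meas[OF t] by (auto intro!: borel_measurable_times borel_measurable_sum borel_measurable_divide
       borel_measurable_diff borel_measurable_add measurable_compose[OF _ G_meas[OF t]])
  have L_seq: "(\<lambda>n. \<beta> y * ?\<Delta> (h n) y) \<longlonglongrightarrow> \<beta> y * L y" for y
    using filterlim_compose[OF lim\<Delta> h_lim] .
  have L_meas: "(\<lambda>y. \<beta> y * L y) \<in> borel_measurable lborel"
    using L_seq \<Delta>_meas by (rule borel_measurable_LIMSEQ_real)
  let ?d = "real DIM('a)"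
  have intM: "integrable lborel (\<lambda>y::'a. k * indicator (cball 0 R) y :: real)" if "k \<ge> 0" for k
    by (rule integrable_bounded_support[where M=k and R=R]) (use that in \<open>auto simp: indicator_def\<close>)
  have \<Delta>_bd: "norm (\<beta> y * ?\<Delta> (h n) y) \<le> (2 * M0 * (?d * M)) * indicator (cball 0 R) y" for n y
  proof (cases "\<beta> y = 0")
    case False
    then have y: "y \<in> cball 0 R" "e \<le> \<bar>G y t\<bar>" using \<beta>_supp \<beta>_zero by (blast, force)
    have "\<bar>(G (y + h n *\<^sub>R b) t + G (y - h n *\<^sub>R b) t - 2 * G y t) / (h n)\<^sup>2\<bar> \<le> M" if "b \<in> Basis" for b
      using h0(3)[OF y(2) norm_Basis[OF that] h] h[of n] by (simp add: abs_divide pos_divide_le_eq)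
    then have "\<bar>?\<Delta> (h n) y\<bar> \<le> (\<Sum>b\<in>(Basis::'a set). M)"
      by (intro order_trans[OF sum_abs sum_mono]) auto
    then have "\<bar>\<beta> y\<bar> * \<bar>?\<Delta> (h n) y\<bar> \<le> 2 * M0 * (?d * M)"
      using \<beta>_bd[of y] M0(1) by (intro mult_mono) auto
    then show ?thesis using y by (simp add: abs_mult)
  qed (use M0 h0 in \<open>simp add: indicator_def\<close>)
  have L_int: "integrable lborel (\<lambda>y. \<beta> y * L y)"
    and L_lim: "(\<lambda>n. LINT y|lborel. \<beta> y * ?\<Delta> (h n) y) \<longlonglongrightarrow> (LINT y|lborel. \<beta> y * L y)"
    using integrable_dominated_convergence[OF L_meas \<Delta>_meas intM AE_I2[OF L_seq] AE_I2[OF \<Delta>_bd]]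
      integral_dominated_convergence[OF L_meas \<Delta>_meas intM AE_I2[OF L_seq] AE_I2[OF \<Delta>_bd]] M0 h0 by auto
  have "(LINT y|lborel. \<beta> y * ?\<Delta> (h n) y) \<le> 0" for n
  proof -
    have i: "integrable lborel (\<lambda>y. \<beta> y * (G (y + h n *\<^sub>R b) t + G (y - h n *\<^sub>R b) t - 2 * G y t))" if "b \<in> Basis" for b
    proof (rule integrable_bounded_support[where M="2 * M0 * (4 * M0)" and R=R])
      show "(\<lambda>y. \<beta> y * (G (y + h n *\<^sub>R b) t + G (y - h n *\<^sub>R b) t - 2 * G y t)) \<in> borel_measurable borel"
        by (auto intro!: borel_measurable_times borel_measurable_diff borel_measurable_add measurable_compose[OF _ G_meas[OF t]])
      show "\<bar>\<beta> y * (G (y + h n *\<^sub>R b) t + G (y - h n *\<^sub>R b) t - 2 * G y t)\<bar> \<le> 2 * M0 * (4 * M0)" for y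
      proof -
        have "\<bar>G (y + h n *\<^sub>R b) t + G (y - h n *\<^sub>R b) t - 2 * G y t\<bar> \<le> 4 * M0"
          using M0(2)[of t "y + h n *\<^sub>R b"] M0(2)[of t "y - h n *\<^sub>R b"] M0(2)[of t y] by simp
        then show ?thesis unfolding abs_mult[of "\<beta> y"] using \<beta>_bd[of y] M0(1) by (intro mult_mono) auto
      qed
    qed (use \<beta>_supp in auto)
    have "(LINT y|lborel. \<beta> y * ?\<Delta> (h n) y) =
        (LINT y|lborel. (\<Sum>b\<in>Basis. \<beta> y * (G (y + h n *\<^sub>R b) t + G (y - h n *\<^sub>R b) t - 2 * G y t)) / (h n)\<^sup>2)"
      by (simp add: sum_distrib_left sum_divide_distrib)
    also have "\<dots> = (\<Sum>b\<in>Basis. LINT y|lborel. \<beta> y * (G (y + h n *\<^sub>R b) t + G (y - h n *\<^sub>R b) t - 2 * G y t)) / (h n)\<^sup>2"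
      using i by (simp add: Bochner_Integration.integral_sum)
    also have "\<dots> \<le> 0"
    proof (intro divide_nonpos_nonneg sum_nonpos)
      fix b :: 'a assume "b \<in> Basis"
      show "(LINT y|lborel. \<beta> y * (G (y + h n *\<^sub>R b) t + G (y - h n *\<^sub>R b) t - 2 * G y t)) \<le> 0"
        unfolding \<beta>_def
      proof (rule monotone_second_difference_integral_nonpos[where \<beta>="\<lambda>s. 2 * excess e s" and M=M0 and R=R])
        show "mono (\<lambda>s. 2 * excess e s)" using excess_mono[of e] by (auto simp: mono_def)
      qed (use G_meas[OF t] M0 excess_bounds(1)[OF e] in auto)
    qed simp
    finally show ?thesis .
  qed
  then have L_nonpos: "(LINT y|lborel. \<beta> y * L y) \<le> 0"
    using L_lim by (intro LIMSEQ_le_const2) auto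
  define q where "q = (\<lambda>s. LINT y|lborel. \<beta> y * ((G y s - G y t) / (s - t)))"
  have q_bd: "norm (\<beta> y * ((G y s - G y t) / (s - t))) \<le> (2 * M0 * M') * indicator (cball 0 R) y"
    if s: "s0 < s" "s < t" for s y
  proof (cases "\<beta> y = 0")
    case False
    then have y: "y \<in> cball 0 R" "e \<le> \<bar>G y t\<bar>" using \<beta>_supp \<beta>_zero by (blast, force)
    have "\<bar>(G y s - G y t) / (s - t)\<bar> \<le> M'"
      using s0(4)[OF y(2) s] s by (simp add: abs_divide pos_divide_le_eq)
    then have "\<bar>\<beta> y\<bar> * \<bar>(G y s - G y t) / (s - t)\<bar> \<le> 2 * M0 * M'"
      using \<beta>_bd[of y] M0(1) by (intro mult_mono) auto
    then show ?thesis using y by (simp add: abs_mult)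
  qed (use M0 s0 in \<open>simp add: indicator_def\<close>)
  have q_meas: "(\<lambda>y. \<beta> y * ((G y s - G y t) / (s - t))) \<in> borel_measurable lborel" if "0 < s" for s
    using G_meas[OF t] G_meas[OF that] by auto
  have "(q \<longlongrightarrow> (LINT y|lborel. \<beta> y * D y)) (at_left t) \<and> integrable lborel (\<lambda>y. \<beta> y * D y)"
  proof
    \<comment> \<open>Dominated convergence speaks of sequences, so the one-sided limit is tested
      along arbitrary sequences approaching from the left.\<close>
    have seq: "(\<lambda>n. q (S n)) \<longlonglongrightarrow> (LINT y|lborel. \<beta> y * D y) \<and> integrable lborel (\<lambda>y. \<beta> y * D y)"
      if S: "\<And>n. S n < t" "\<And>n. s0 < S n" "S \<longlonglongrightarrow> t" for S :: "nat \<Rightarrow> real"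
    proof -
      have fl: "filterlim S (at_left t) sequentially" using S
        by (auto simp: filterlim_at less_imp_neq intro!: always_eventually)
      have l: "(\<lambda>n. \<beta> y * ((G y (S n) - G y t) / (S n - t))) \<longlonglongrightarrow> \<beta> y * D y" for y
        using filterlim_compose[OF limD fl] .
      have m: "(\<lambda>y. \<beta> y * ((G y (S n) - G y t) / (S n - t))) \<in> borel_measurable lborel" for n
        using q_meas S s0 by (meson order_less_trans)
      have D_meas: "(\<lambda>y. \<beta> y * D y) \<in> borel_measurable lborel"
        using l m by (rule borel_measurable_LIMSEQ_real)
      show ?thesis unfolding q_def
        using integrable_dominated_convergence[OF D_meas m intM AE_I2[OF l] AE_I2[OF q_bd[OF S(2,1)]]]
          integral_dominated_convergence[OF D_meas m intM AE_I2[OF l] AE_I2[OF q_bd[OF S(2,1)]]] M0 s0 by auto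
    qed
    show "(q \<longlongrightarrow> (LINT y|lborel. \<beta> y * D y)) (at_left t)"
      by (rule tendsto_at_left_sequentially[OF s0(2)]) (use seq in blast)
    \<comment> \<open>Integrability of the limit needs one actual sequence inside the interval,
      which is supplied here.\<close>
    have "(\<lambda>n. t - (t - s0) / real (n + 2)) \<longlonglongrightarrow> t - 0"
      by (intro tendsto_intros LIMSEQ_ignore_initial_segment[of "\<lambda>n. (t - s0) / real n" 0 2, OF lim_const_over_n])
    moreover have "0 < (t - s0) / real (n + 2)" "(t - s0) / real (n + 2) < t - s0" for n
    proof -
      have "0 < d / real (n + 2)" "d / real (n + 2) < d" if "0 < d" for d :: real
        using that by (auto simp: field_simps add_pos_nonneg)
      from this[of "t - s0"] s0(2)
      show "0 < (t - s0) / real (n + 2)" "(t - s0) / real (n + 2) < t - s0" by auto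
    qed
    note \<tau> = this
    have "t - (t - s0) / real (n + 2) < t" "s0 < t - (t - s0) / real (n + 2)" for n
      using \<tau>[of n] by linarith+
    ultimately show "integrable lborel (\<lambda>y. \<beta> y * D y)"
      using seq[of "\<lambda>n. t - (t - s0) / real (n + 2)"] by simp
  qed
  then have q_lim: "(q \<longlongrightarrow> (LINT y|lborel. \<beta> y * D y)) (at_left t)" and D_int: "integrable lborel (\<lambda>y. \<beta> y * D y)"
    by auto
  have "(LINT y|lborel. \<beta> y * D y) \<le> (LINT y|lborel. \<beta> y * L y)"
    by (rule integral_mono[OF D_int L_int]) (rule DLle)
  then have "(LINT y|lborel. \<beta> y * D y) < \<eta>" using L_nonpos \<open>0 < \<eta>\<close> by simp
  then have "\<forall>\<^sub>F s in at_left t. q s < \<eta>" by (rule order_tendstoD(2)[OF q_lim])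
  moreover have "\<forall>\<^sub>F s in at_left t. s \<in> {s0<..<t}" by (rule eventually_at_left_real[OF s0(2)])
  ultimately show ?thesis
  proof eventually_elim
    case (elim s)
    then have s: "s0 < s" "s < t" "0 < s" using s0 by auto
    have i: "integrable lborel (\<lambda>y. \<beta> y * (G y s - G y t))"
    proof -
      have "integrable lborel (\<lambda>y. \<beta> y * ((G y s - G y t) / (s - t)))"
        by (rule Bochner_Integration.integrable_bound[OF intM[of "2 * M0 * M'"] q_meas[OF s(3)]])
          (use M0 s0 order_trans[OF q_bd[OF s(1,2)] abs_ge_self] in \<open>auto intro!: AE_I2\<close>)
      then have "integrable lborel (\<lambda>y. (s - t) * (\<beta> y * ((G y s - G y t) / (s - t))))"
        by (rule integrable_mult_right)
      moreover have "(s - t) * (\<beta> y * ((G y s - G y t) / (s - t))) = \<beta> y * (G y s - G y t)" for y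
        using s by simp
      ultimately show ?thesis by simp
    qed
    have "(s - t) * q s = (LINT y|lborel. (s - t) * (\<beta> y * ((G y s - G y t) / (s - t))))"
      unfolding q_def by simp
    also have "\<dots> = (LINT y|lborel. \<beta> y * (G y s - G y t))" using s by simp
    also have "\<dots> \<le> (LINT y|lborel. (excess e (G y s))\<^sup>2 - (excess e (G y t))\<^sup>2)"
    proof (rule integral_mono[OF i])
      show "\<beta> y * (G y s - G y t) \<le> (excess e (G y s))\<^sup>2 - (excess e (G y t))\<^sup>2" for y
        using excess_sq_subgradient[OF e, of "G y t" "G y s"] by (simp add: \<beta>_def)
    qed (intro Bochner_Integration.integrable_diff integrable_energy s t e)
    also have "\<dots> = energy e s - energy e t"
      unfolding energy_def by (intro Bochner_Integration.integral_diff integrable_energy s t e)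
    finally have "(s - t) * q s \<le> energy e s - energy e t" .
    \<comment> \<open>As s < t, the factor s - t is negative: an upper bound for \<open>q s\<close>
      becomes a lower bound for the earlier energy.\<close>
    moreover have "(t - s) * q s \<le> (t - s) * \<eta>" using elim s by (intro mult_left_mono) auto
    ultimately show ?case by (simp add: algebra_simps)
  qed
qed

lemma energy_nonincreasing: "0 < a \<Longrightarrow> a \<le> b \<Longrightarrow> 0 < e \<Longrightarrow> energy e b \<le> energy e a"
  by (rule nonincreasing_from_left_bound[OF _ continuous_energy energy_left_bound]) auto

section \<open>From the truncated energy to the full norm and its pull-back\<close>

lemma L2_norm_eq:
  assumes "0 < t"
  shows "(LINT y|lebesgue_on (\<phi> t ` \<Omega>\<^sub>0). (w y t)\<^sup>2) = (LINT y|lborel. (G y t)\<^sup>2)"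
proof -
  have eq: "indicator (\<phi> t ` \<Omega>\<^sub>0) y * (w y t)\<^sup>2 = (G y t)\<^sup>2" for y
    using G_eq[of y t] G_zero[of y t] assms by (cases "y \<in> \<phi> t ` \<Omega>\<^sub>0") auto
  show ?thesis
    using borel_measurable_G[OF assms] open_flow_image[OF open_\<Omega>, of t]
    by (subst LINT_lebesgue_on_eq_lborel) (auto simp: eq)
qed

text \<open>The truncation level tends to 0, with the square of \<open>G\<close> as integrable
  majorant.\<close>

lemma L2_norm_nonincreasing:
  assumes "0 < a" "a \<le> b"
  shows "(LINT y|lebesgue_on (\<phi> b ` \<Omega>\<^sub>0). (w y b)\<^sup>2) \<le> (LINT y|lebesgue_on (\<phi> a ` \<Omega>\<^sub>0). (w y a)\<^sup>2)"
proof -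
  have lim: "(\<lambda>n. energy (inverse (real (Suc n))) t) \<longlonglongrightarrow> (LINT y|lborel. (G y t)\<^sup>2)" if t: "0 < t" for t
  proof -
    obtain M R where M: "0 \<le> M" "\<And>y s. s \<in> {t..t} \<Longrightarrow> \<bar>G y s\<bar> \<le> M"
      "\<And>y s. s \<in> {t..t} \<Longrightarrow> y \<notin> cball 0 R \<Longrightarrow> G y s = 0"
      using G_bounded[OF t order_refl] by metis
    have e: "0 < inverse (real (Suc n))" for n by simp
    have int: "integrable lborel (\<lambda>y. (G y t)\<^sup>2)"
    proof (rule integrable_bounded_support[where M="M\<^sup>2" and R=R])
      show "\<bar>(G y t)\<^sup>2\<bar> \<le> M\<^sup>2" for y
        using M(2)[of t y] by (simp add: abs_le_square_iff[symmetric])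
    qed (use M borel_measurable_G[OF t] in auto)
    show ?thesis unfolding energy_def
    proof (rule integral_dominated_convergence[OF _ _ int])
      show "AE y in lborel. (\<lambda>n. (excess (inverse (real (Suc n))) (G y t))\<^sup>2) \<longlonglongrightarrow> (G y t)\<^sup>2"
      proof (intro AE_I2 tendsto_power)
        fix y
        have "(\<lambda>n. excess (inverse (real (Suc n))) (G y t) - G y t) \<longlonglongrightarrow> 0"
          by (rule Lim_null_comparison[OF _ LIMSEQ_inverse_real_of_nat])
            (use excess_bounds(4)[OF e] in \<open>auto intro!: always_eventually\<close>)
        then show "(\<lambda>n. excess (inverse (real (Suc n))) (G y t)) \<longlonglongrightarrow> G y t"
          by (simp add: LIM_zero_iff)
      qed
      show "AE y in lborel. norm ((excess (inverse (real (Suc n))) (G y t))\<^sup>2) \<le> (G y t)\<^sup>2" for n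
        using excess_bounds(3)[OF e] by (intro AE_I2) (simp add: abs_le_square_iff[symmetric])
      show "(\<lambda>y. (excess (inverse (real (Suc n))) (G y t))\<^sup>2) \<in> borel_measurable lborel" for n
        using integrable_energy[OF t e] by (rule borel_measurable_integrable)
    qed (use int in auto)
  qed
  have "(LINT y|lborel. (G y b)\<^sup>2) \<le> (LINT y|lborel. (G y a)\<^sup>2)"
  proof (rule LIMSEQ_le[OF lim lim])
    show "\<exists>N. \<forall>n\<ge>N. energy (inverse (real (Suc n))) b \<le> energy (inverse (real (Suc n))) a"
      using energy_nonincreasing[OF assms] by auto
  qed (use assms in auto)
  then show ?thesis using assms by (simp add: L2_norm_eq)
qed

text \<open>The initial datum is attained by the pull-back, so norms on the moving domain must be
  compared with norms on the fixed one. A single \<open>C\<close> serves all times up to 1, hence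
  the factor tends to 1 at time 0.\<close>

lemma L2_norm_le_pullback:
  obtains C where
    "\<And>t. 0 < t \<Longrightarrow> t \<le> 1 \<Longrightarrow> (LINT y|lebesgue_on (\<phi> t ` \<Omega>\<^sub>0). (w y t)\<^sup>2)
      \<le> exp (C * t) ^ DIM('a) * (LINT x|lebesgue_on \<Omega>\<^sub>0. (w (\<phi> t x) t)\<^sup>2)"
proof -
  obtain R where R: "\<Omega>\<^sub>0 \<subseteq> cball 0 R"
    using bounded_\<Omega> unfolding bounded_iff by (metis mem_cball_0 subsetI)
  obtain C where C: "\<And>x y s. x \<in> cball 0 R \<Longrightarrow> y \<in> cball 0 R \<Longrightarrow> s \<in> {0..1} \<Longrightarrow>
       norm (\<phi> s x - \<phi> s y) \<le> exp (C * s) * norm (x - y)"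
    using flow_estimates[of 1 R] by (metis zero_le_one)
  have "(LINT y|lebesgue_on (\<phi> t ` \<Omega>\<^sub>0). (w y t)\<^sup>2)
      \<le> exp (C * t) ^ DIM('a) * (LINT x|lebesgue_on \<Omega>\<^sub>0. (w (\<phi> t x) t)\<^sup>2)" if t: "0 < t" "t \<le> 1" for t
  proof -
    obtain M where M: "0 \<le> M" "\<And>y s. s \<in> {t..t} \<Longrightarrow> \<bar>G y s\<bar> \<le> M"
      using G_bounded[OF \<open>0 < t\<close> order_refl] by metis
    have [measurable]: "(\<lambda>x. F x t) \<in> borel_measurable borel"
      by (rule borel_measurable_continuous_onI[OF continuous_F_space[OF t(1)]])
    have "F x t = G (\<phi> t x) t" for x by (simp add: G_def flow_inverse)
    then have F_bd: "\<bar>F x t\<bar> \<le> M" for x using M(2) by simp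
    have F_out: "F x t = 0" if "x \<notin> \<Omega>\<^sub>0" for x using F_zero[OF that t(1)] .
    have int: "integrable lborel (\<lambda>x. (F x t)\<^sup>2)"
    proof (rule integrable_bounded_support[where M="M\<^sup>2" and R=R])
      show "\<bar>(F x t)\<^sup>2\<bar> \<le> M\<^sup>2" for x using F_bd[of x] M(1) by (simp add: abs_le_square_iff[symmetric])
      show "(F x t)\<^sup>2 = 0" if "x \<notin> cball 0 R" for x
        using F_out[of x] subsetD[OF R, of x] that by auto
    qed simp
    have pull: "(LINT x|lebesgue_on \<Omega>\<^sub>0. (w (\<phi> t x) t)\<^sup>2) = (LINT x|lborel. (F x t)\<^sup>2)"
    proof -
      have "indicator \<Omega>\<^sub>0 x * (w (\<phi> t x) t)\<^sup>2 = (F x t)\<^sup>2" for x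
        using F_out[of x] closure_subset[of \<Omega>\<^sub>0] by (cases "x \<in> \<Omega>\<^sub>0") (auto simp: F_def)
      then show ?thesis using open_\<Omega> by (subst LINT_lebesgue_on_eq_lborel) auto
    qed
    let ?K = "exp (C * t) ^ DIM('a)"
    have "(\<integral>\<^sup>+y. ennreal ((G y t)\<^sup>2) \<partial>lborel) = (\<integral>\<^sup>+y. ennreal ((F (\<phi> (- t) y) t)\<^sup>2) * indicator (\<phi> t ` \<Omega>\<^sub>0) y \<partial>lborel)"
      using F_out by (intro nn_integral_cong) (auto simp: G_def indicator_def mem_flow_image)
    also have "\<dots> \<le> ennreal ?K * (\<integral>\<^sup>+x. ennreal ((F x t)\<^sup>2) * indicator \<Omega>\<^sub>0 x \<partial>lborel)"
      using t R by (intro nn_integral_lipschitz_change_of_variables open_\<Omega> continuous_flow_space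
          flow_inverse flow_inverse' C) auto
    also have "(\<integral>\<^sup>+x. ennreal ((F x t)\<^sup>2) * indicator \<Omega>\<^sub>0 x \<partial>lborel) = (\<integral>\<^sup>+x. ennreal ((F x t)\<^sup>2) \<partial>lborel)"
      using F_out by (intro nn_integral_cong) (auto simp: indicator_def)
    also have "\<dots> = ennreal (LINT x|lborel. (F x t)\<^sup>2)"
      by (rule nn_integral_eq_integral[OF int]) simp
    finally have "(\<integral>\<^sup>+y. ennreal ((G y t)\<^sup>2) \<partial>lborel) \<le> ennreal (?K * (LINT x|lborel. (F x t)\<^sup>2))"
      by (simp add: ennreal_mult')
    then have "(LINT y|lborel. (G y t)\<^sup>2) \<le> ?K * (LINT x|lborel. (F x t)\<^sup>2)"
      by (rule integral_real_bounded[rotated]) simp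
    then show ?thesis by (simp add: L2_norm_eq t pull)
  qed
  then show thesis by (rule that)
qed

end

section \<open>Solutions of the heat equation in moving domains\<close>

lemma smooth_flow_C11:
  assumes "smooth_on V UNIV" "is_flow V \<phi>"
  shows "C11_flow V (\<lambda>x. frechet_derivative V (at x)) \<phi>"
proof
  have Ck: "Ck_on k V UNIV" for k using assms(1) by (simp add: smooth_on_def)
  have V': "(V has_derivative frechet_derivative V (at x)) (at x)" for x
    using Ck[of 1] by (simp add: frechet_derivative_works)
  show "frechet_derivative V (at x) (b1 + b2) = frechet_derivative V (at x) b1 + frechet_derivative V (at x) b2"
    "frechet_derivative V (at x) (r *\<^sub>R b) = r *\<^sub>R frechet_derivative V (at x) b" for x b1 b2 r b
    using has_derivative_linear[OF V'] by (simp_all add: linear_add linear_scale)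
  show "\<exists>M\<ge>0. \<forall>x\<in>cball 0 R. \<forall>y\<in>cball 0 R. norm (V y - V x) \<le> M * norm (y - x) \<and>
      norm (V y - V x - frechet_derivative V (at x) (y - x)) \<le> M * (norm (y - x))\<^sup>2 \<and>
      (\<forall>v. norm (frechet_derivative V (at x) v) \<le> M * norm v)" for R
    by (rule C2_local_bound[OF Ck])
qed (use assms(2) in \<open>auto simp: is_flow_def\<close>)

lemma integrable_square_continuous_on_closure:
  fixes f :: "'a::euclidean_space \<Rightarrow> real"
  assumes "open U" "bounded U" and f: "continuous_on (closure U) f"
  shows "f \<in> borel_measurable (lebesgue_on U)" "integrable (lebesgue_on U) (\<lambda>x. (f x)\<^sup>2)"
proof -
  show m: "f \<in> borel_measurable (lebesgue_on U)"
    using continuous_on_subset[OF f closure_subset] \<open>open U\<close>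
    by (intro continuous_imp_measurable_on_sets_lebesgue) auto
  have "bounded (f ` closure U)"
    using f \<open>bounded U\<close> by (intro compact_imp_bounded compact_continuous_image) auto
  then obtain M where M: "\<And>x. x \<in> closure U \<Longrightarrow> \<bar>f x\<bar> \<le> M" by (auto simp: bounded_iff)
  interpret finite_measure "lebesgue_on U"
    using assms by (intro finite_measure_lebesgue_on lmeasurable_open)
  show "integrable (lebesgue_on U) (\<lambda>x. (f x)\<^sup>2)"
  proof (rule integrable_const_bound[of _ "M\<^sup>2"])
    show "AE x in lebesgue_on U. norm ((f x)\<^sup>2) \<le> M\<^sup>2"
      using M closure_subset[of U]
      by (intro AE_I2) (force simp: space_restrict_space intro: power2_le_iff_abs_le[THEN iffD2] abs_le_square_iff[THEN iffD1])
  qed (use m in measurable)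
qed

text \<open>Young's inequality with a free parameter. A fixed factor such as 2 in front of q^2 would
  spoil the constant 1 in the final estimate.\<close>

lemma square_le_perturbed:
  fixes p q \<eta> :: real
  assumes "0 < \<eta>"
  shows "p\<^sup>2 \<le> (1 + \<eta>) * q\<^sup>2 + (1 + 1 / \<eta>) * (p - q)\<^sup>2"
proof -
  have "0 \<le> (\<eta> * q - (p - q))\<^sup>2 / \<eta>" using assms by simp
  also have "\<dots> = \<eta> * q\<^sup>2 - 2 * q * (p - q) + (p - q)\<^sup>2 / \<eta>"
    using assms by (simp add: power2_eq_square field_simps)
  finally show ?thesis by (simp add: power2_eq_square algebra_simps add_divide_distrib diff_divide_distrib)
qed

lemma has_laplacian_mult_const:
  assumes "has_laplacian u L y"
  shows "has_laplacian (\<lambda>z. c * u z) (c * L) y"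
proof -
  obtain g H where g: "\<forall>\<^sub>F z in nhds y. GDERIV u z :> g z" and H: "(g has_derivative H) (at y)"
    and L: "L = (\<Sum>b\<in>Basis. H b \<bullet> b)"
    using assms unfolding has_laplacian_def by blast
  have "\<forall>\<^sub>F z in nhds y. GDERIV (\<lambda>z. c * u z) z :> c *\<^sub>R g z"
    using g
  proof eventually_elim
    case (elim z)
    then show ?case
      unfolding gderiv_def using has_derivative_mult_right[of u "\<lambda>h. h \<bullet> g z" "at z" c] by simp
  qed
  moreover have "((\<lambda>z. c *\<^sub>R g z) has_derivative (\<lambda>h. c *\<^sub>R H h)) (at y)"
    by (rule has_derivative_scaleR_right[OF H])
  ultimately show ?thesis unfolding has_laplacian_def L
    by (intro exI[of _ "\<lambda>z. c *\<^sub>R g z"] exI[of _ "\<lambda>h. c *\<^sub>R H h"]) (simp add: sum_distrib_left)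
qed

text \<open>The integrating factor depends on time alone, so it commutes with the Laplacian; it
  replaces the coefficient \<open>a\<close> by the nonnegative a - \<alpha>.\<close>

lemma solution_moving_subsolution:
  fixes \<alpha> :: "real \<Rightarrow> real"
  assumes \<Omega>: "bounded_smooth_open \<Omega>\<^sub>0" and flow: "C11_flow V V' \<phi>"
    and sol: "is_solution \<phi> \<Omega>\<^sub>0 a T\<^sub>0 T"
    and \<alpha>: "continuous_on UNIV \<alpha>"
    and \<alpha>_le: "\<And>t y. 0 \<le> t \<Longrightarrow> y \<in> moving_domain \<phi> \<Omega>\<^sub>0 t \<Longrightarrow> \<alpha> t \<le> a y t"
  shows "\<exists>Fx Fxx Ft. moving_subsolution V V' \<phi> \<Omega>\<^sub>0 (\<lambda>y t. exp (integral {0..t} \<alpha>) * T y t) Fx Fxx Ft"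
proof -
  interpret C11_flow V V' \<phi> by fact
  define E where "E = (\<lambda>t. exp (integral {0..t} \<alpha>))"
  have E': "(E has_real_derivative E t * \<alpha> t) (at t)" if "0 < t" for t
  proof -
    \<comment> \<open>An interval reaching beyond \<open>t\<close> makes \<open>t\<close> an
      interior point, so the derivative is two-sided.\<close>
    have "((\<lambda>t. integral {0..t} \<alpha>) has_real_derivative \<alpha> t) (at t within {0..t + 1})"
      using that continuous_on_subset[OF \<alpha>] by (intro integral_has_real_derivative) auto
    then have "((\<lambda>t. integral {0..t} \<alpha>) has_real_derivative \<alpha> t) (at t)"
      using that at_within_interior[of t "{0..t + 1}"] by simp
    then show ?thesis unfolding E_def by (rule DERIV_fun_exp)
  qed
  have E_pos: "0 < E t" for t by (simp add: E_def)
  have E_cont: "continuous_on {0<..} E"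
    using E' by (intro continuous_at_imp_continuous_on) (auto dest: DERIV_isCont)
  have E_cont2: "continuous_on (S \<times> {0<..}) (\<lambda>p. E (snd p))" for S :: "'a set"
    by (rule continuous_on_compose2[OF E_cont continuous_on_snd[OF continuous_on_id]]) auto
  obtain Fx Fxx Ft where F:
    "\<And>x t. x \<in> closure \<Omega>\<^sub>0 \<Longrightarrow> 0 < t \<Longrightarrow> ((\<lambda>z. T (\<phi> t z) t) has_derivative blinfun_apply (Fx x t)) (at x within closure \<Omega>\<^sub>0)"
    "\<And>x t. x \<in> closure \<Omega>\<^sub>0 \<Longrightarrow> 0 < t \<Longrightarrow> ((\<lambda>z. Fx z t) has_derivative blinfun_apply (Fxx x t)) (at x within closure \<Omega>\<^sub>0)"
    "\<And>x t. x \<in> closure \<Omega>\<^sub>0 \<Longrightarrow> 0 < t \<Longrightarrow> ((\<lambda>s. T (\<phi> s x) s) has_real_derivative Ft x t) (at t)"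
    and cont: "continuous_on (closure \<Omega>\<^sub>0 \<times> {0<..}) (\<lambda>(x, t). T (\<phi> t x) t)"
    "continuous_on (closure \<Omega>\<^sub>0 \<times> {0<..}) (\<lambda>(x, t). Fx x t)"
    "continuous_on (closure \<Omega>\<^sub>0 \<times> {0<..}) (\<lambda>(x, t). Fxx x t)"
    "continuous_on (closure \<Omega>\<^sub>0 \<times> {0<..}) (\<lambda>(x, t). Ft x t)"
    using sol unfolding is_solution_def C2_C1_on_closure_def by blast
  note cont = cont[unfolded case_prod_beta]
  have \<alpha>2: "continuous_on (closure \<Omega>\<^sub>0 \<times> {0<..}) (\<lambda>p. \<alpha> (snd p))"
    by (rule continuous_on_compose2[OF \<alpha> continuous_on_snd[OF continuous_on_id]]) auto
  have "moving_subsolution V V' \<phi> \<Omega>\<^sub>0 (\<lambda>y t. E t * T y t) (\<lambda>x t. E t *\<^sub>R Fx x t) (\<lambda>x t. E t *\<^sub>R Fxx x t)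
      (\<lambda>x t. E t * \<alpha> t * T (\<phi> t x) t + E t * Ft x t)"
  proof
    show "open \<Omega>\<^sub>0" "bounded \<Omega>\<^sub>0" using \<Omega> by (auto simp: bounded_smooth_open_def)
    fix x t assume x: "x \<in> closure \<Omega>\<^sub>0" and t: "0 < (t::real)"
    show "((\<lambda>z. E t * T (\<phi> t z) t) has_derivative blinfun_apply (E t *\<^sub>R Fx x t)) (at x within closure \<Omega>\<^sub>0)"
      using has_derivative_mult_right[OF F(1)[OF x t], of "E t"] by (simp add: blinfun.scaleR_left scaleR_blinfun.rep_eq[abs_def])
    show "((\<lambda>z. E t *\<^sub>R Fx z t) has_derivative blinfun_apply (E t *\<^sub>R Fxx x t)) (at x within closure \<Omega>\<^sub>0)"
      using has_derivative_scaleR_right[OF F(2)[OF x t], of "E t"] by (simp add: scaleR_blinfun.rep_eq[abs_def])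
    show "((\<lambda>s. E s * T (\<phi> s x) s) has_real_derivative E t * \<alpha> t * T (\<phi> t x) t + E t * Ft x t) (at t)"
      using DERIV_mult[OF E'[OF t] F(3)[OF x t]] by (simp add: mult.commute)
  next
    show "continuous_on (closure \<Omega>\<^sub>0 \<times> {0<..}) (\<lambda>(x, t). E t * T (\<phi> t x) t)"
      "continuous_on (closure \<Omega>\<^sub>0 \<times> {0<..}) (\<lambda>(x, t). E t *\<^sub>R Fx x t)"
      "continuous_on (closure \<Omega>\<^sub>0 \<times> {0<..}) (\<lambda>(x, t). E t *\<^sub>R Fxx x t)"
      "continuous_on (closure \<Omega>\<^sub>0 \<times> {0<..}) (\<lambda>(x, t). E t * \<alpha> t * T (\<phi> t x) t + E t * Ft x t)"
      unfolding case_prod_beta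
      by (intro continuous_on_add continuous_on_mult continuous_on_scaleR E_cont2 cont \<alpha>2)+
  next
    fix x t assume x: "x \<in> frontier \<Omega>\<^sub>0" and t: "0 < (t::real)"
    \<comment> \<open>The boundary condition is given on the frontier of the moved set. That the
      flow maps frontier points there follows from its continuity and injectivity.\<close>
    have "\<phi> t x \<in> closure (\<phi> t ` \<Omega>\<^sub>0)"
      using x image_closure_subset[OF continuous_on_subset[OF continuous_flow_space subset_UNIV]
          closed_closure closure_subset, of t \<Omega>\<^sub>0] by (auto simp: frontier_def)
    moreover have "\<phi> t x \<notin> \<phi> t ` \<Omega>\<^sub>0"
      using x \<Omega> by (simp add: mem_flow_image flow_inverse frontier_def interior_open bounded_smooth_open_def)
    moreover have "open (\<phi> t ` \<Omega>\<^sub>0)"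
      using \<Omega> by (intro open_flow_image) (simp add: bounded_smooth_open_def)
    ultimately have "\<phi> t x \<in> frontier (moving_domain \<phi> \<Omega>\<^sub>0 t)"
      by (simp add: frontier_def interior_open moving_domain_def)
    then show "E t * T (\<phi> t x) t = 0" using sol t by (simp add: is_solution_def)
  next
    fix y t assume t: "0 < (t::real)" and y: "y \<in> \<phi> t ` \<Omega>\<^sub>0"
    then obtain D L where DL: "((\<lambda>s. T y s) has_real_derivative D) (at t)" "has_laplacian (\<lambda>z. T z t) L y"
      "D - L + a y t * T y t = 0"
      using sol unfolding is_solution_def moving_domain_def by blast
    have "((\<lambda>s. E s * T y s) has_real_derivative E t * (\<alpha> t * T y t + D)) (at t)"
      using DERIV_mult[OF E'[OF t] DL(1)] by (simp add: algebra_simps)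
    moreover have "has_laplacian (\<lambda>z. E t * T z t) (E t * L) y"
      using DL(2) by (rule has_laplacian_mult_const)
    moreover have "E t * T y t * (E t * (\<alpha> t * T y t + D)) \<le> E t * T y t * (E t * L)"
    proof -
      have L: "L = D + a y t * T y t" using DL(3) by simp
      have "E t * T y t * (E t * L) - E t * T y t * (E t * (\<alpha> t * T y t + D)) = (E t * T y t)\<^sup>2 * (a y t - \<alpha> t)"
        unfolding L by (simp add: power2_eq_square algebra_simps)
      moreover have "0 \<le> (E t * T y t)\<^sup>2 * (a y t - \<alpha> t)"
        using \<alpha>_le[of t y] t y by (intro mult_nonneg_nonneg) (auto simp: moving_domain_def)
      ultimately show ?thesis by linarith
    qed
    ultimately show "\<exists>D L. ((\<lambda>s. E s * T y s) has_real_derivative D) (at t) \<and>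
        has_laplacian (\<lambda>z. E t * T z t) L y \<and> E t * T y t * D \<le> E t * T y t * L" by blast
  qed
  then show ?thesis unfolding E_def by blast
qed

text \<open>Monotonicity holds between positive times, so time 0 is approached through small s > 0.
  This costs the volume factor, the integrating factor at s and the perturbation factor 1 + \<eta>,
  all of which tend to 1.\<close>

lemma solution_L2_decay:
  fixes \<Omega>\<^sub>0 :: "'a::euclidean_space set" and \<alpha> :: "real \<Rightarrow> real"
  assumes \<Omega>: "bounded_smooth_open \<Omega>\<^sub>0" and flow: "C11_flow V V' \<phi>"
    and sol: "is_solution \<phi> \<Omega>\<^sub>0 a T\<^sub>0 T" and L2: "in_L2 T\<^sub>0 \<Omega>\<^sub>0"
    and \<alpha>: "continuous_on UNIV \<alpha>"
    and \<alpha>_le: "\<And>t y. 0 \<le> t \<Longrightarrow> y \<in> moving_domain \<phi> \<Omega>\<^sub>0 t \<Longrightarrow> \<alpha> t \<le> a y t"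
    and t: "0 \<le> t"
  shows "(LINT y|lebesgue_on (moving_domain \<phi> \<Omega>\<^sub>0 t). (T y t)\<^sup>2)
    \<le> exp (- 2 * integral {0..t} \<alpha>) * (LINT x|lebesgue_on \<Omega>\<^sub>0. (T\<^sub>0 x)\<^sup>2)"
proof -
  interpret C11_flow V V' \<phi> by fact
  have op: "open \<Omega>\<^sub>0" and bd: "bounded \<Omega>\<^sub>0" using \<Omega> by (auto simp: bounded_smooth_open_def)
  define I where "I = (LINT x|lebesgue_on \<Omega>\<^sub>0. (T\<^sub>0 x)\<^sup>2)"
  show ?thesis
  proof (cases "t = 0")
    case True
    have "\<phi> 0 ` \<Omega>\<^sub>0 = \<Omega>\<^sub>0" by (simp add: flow_0)
    moreover have "(LINT y|lebesgue_on \<Omega>\<^sub>0. (T y 0)\<^sup>2) = I"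
      unfolding I_def using sol
      by (intro Bochner_Integration.integral_cong) (auto simp: is_solution_def space_restrict_space)
    ultimately show ?thesis using True by (simp add: moving_domain_def I_def)
  next
    case False
    then have t: "0 < t" using t by simp
    define A where "A = (\<lambda>t. integral {0..t} \<alpha>)"
    define N where "N = (\<lambda>s. LINT y|lebesgue_on (\<phi> s ` \<Omega>\<^sub>0). (exp (A s) * T y s)\<^sup>2)"
    define P where "P = (\<lambda>s x. T (\<phi> s x) s)"
    define d where "d = (\<lambda>s. LINT x|lebesgue_on \<Omega>\<^sub>0. (P s x - T\<^sub>0 x)\<^sup>2)"
    have d: "(d \<longlongrightarrow> 0) (at_right 0)" using sol by (simp add: is_solution_def d_def P_def)
    obtain Fx Fxx Ft where "moving_subsolution V V' \<phi> \<Omega>\<^sub>0 (\<lambda>y t. exp (A t) * T y t) Fx Fxx Ft"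
      using solution_moving_subsolution[OF \<Omega> flow sol \<alpha> \<alpha>_le] unfolding A_def by blast
    then interpret S: moving_subsolution V V' \<phi> \<Omega>\<^sub>0 "\<lambda>y t. exp (A t) * T y t" Fx Fxx Ft .
    obtain C where C: "\<And>s. 0 < s \<Longrightarrow> s \<le> 1 \<Longrightarrow> N s \<le> exp (C * s) ^ DIM('a) * (LINT x|lebesgue_on \<Omega>\<^sub>0. (exp (A s) * P s x)\<^sup>2)"
      using S.L2_norm_le_pullback unfolding N_def P_def by metis
    have P_cont: "continuous_on (closure \<Omega>\<^sub>0) (P s)" if "0 < s" for s
    proof -
      have "continuous_on (closure \<Omega>\<^sub>0 \<times> {0<..}) (\<lambda>(x, t). T (\<phi> t x) t)"
        using sol by (auto simp: is_solution_def C2_C1_on_closure_def)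
      from continuous_on_compose2[OF this continuous_on_Pair[OF continuous_on_id continuous_on_const], of s "closure \<Omega>\<^sub>0"]
      show ?thesis using that by (auto simp: P_def)
    qed
    note P_int = integrable_square_continuous_on_closure[OF op bd P_cont]
    have T0: "T\<^sub>0 \<in> borel_measurable (lebesgue_on \<Omega>\<^sub>0)" "integrable (lebesgue_on \<Omega>\<^sub>0) (\<lambda>x. (T\<^sub>0 x)\<^sup>2)"
      using L2 by (auto simp: in_L2_def)
    have P_le: "(LINT x|lebesgue_on \<Omega>\<^sub>0. (P s x)\<^sup>2) \<le> (1 + \<eta>) * I + (1 + 1 / \<eta>) * d s" if s: "0 < s" and \<eta>: "0 < \<eta>" for s \<eta>
    proof -
      \<comment> \<open>Excludes that \<open>d s\<close> is just the default value 0 of a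
        non-integrable function.\<close>
      have di: "integrable (lebesgue_on \<Omega>\<^sub>0) (\<lambda>x. (P s x - T\<^sub>0 x)\<^sup>2)"
      proof (rule Bochner_Integration.integrable_bound)
        show "integrable (lebesgue_on \<Omega>\<^sub>0) (\<lambda>x. 2 * (P s x)\<^sup>2 + 2 * (T\<^sub>0 x)\<^sup>2)"
          using P_int(2)[OF s] T0(2) by simp
        show "AE x in lebesgue_on \<Omega>\<^sub>0. norm ((P s x - T\<^sub>0 x)\<^sup>2) \<le> norm (2 * (P s x)\<^sup>2 + 2 * (T\<^sub>0 x)\<^sup>2)"
        proof (rule AE_I2)
          fix x
          have "(P s x - T\<^sub>0 x)\<^sup>2 \<le> 2 * (P s x)\<^sup>2 + 2 * (T\<^sub>0 x)\<^sup>2"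
            using zero_le_power2[of "P s x + T\<^sub>0 x"] by (simp add: power2_eq_square algebra_simps)
          then show "norm ((P s x - T\<^sub>0 x)\<^sup>2) \<le> norm (2 * (P s x)\<^sup>2 + 2 * (T\<^sub>0 x)\<^sup>2)"
            by simp
        qed
      qed (use P_int(1)[OF s] T0(1) in measurable)
      have "(LINT x|lebesgue_on \<Omega>\<^sub>0. (P s x)\<^sup>2) \<le> (LINT x|lebesgue_on \<Omega>\<^sub>0. (1 + \<eta>) * (T\<^sub>0 x)\<^sup>2 + (1 + 1 / \<eta>) * (P s x - T\<^sub>0 x)\<^sup>2)"
        using P_int(2)[OF s] T0(2) di square_le_perturbed[OF \<eta>] by (intro integral_mono) auto
      also have "\<dots> = (1 + \<eta>) * I + (1 + 1 / \<eta>) * d s"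
        using T0(2) di unfolding I_def d_def
        by (subst Bochner_Integration.integral_add) auto
      finally show ?thesis .
    qed
    have N_le: "N t \<le> exp (C * s) ^ DIM('a) * (exp (2 * A s) * ((1 + \<eta>) * I + (1 + 1 / \<eta>) * d s))"
      if s: "0 < s" "s \<le> 1" "s \<le> t" and \<eta>: "0 < \<eta>" for s \<eta>
    proof -
      have "N t \<le> N s" unfolding N_def by (rule S.L2_norm_nonincreasing[OF s(1,3)])
      also have "\<dots> \<le> exp (C * s) ^ DIM('a) * (LINT x|lebesgue_on \<Omega>\<^sub>0. (exp (A s) * P s x)\<^sup>2)"
        by (rule C[OF s(1,2)])
      also have "(LINT x|lebesgue_on \<Omega>\<^sub>0. (exp (A s) * P s x)\<^sup>2) = exp (2 * A s) * (LINT x|lebesgue_on \<Omega>\<^sub>0. (P s x)\<^sup>2)"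
        by (simp add: power_mult_distrib exp_double)
      also have "exp (C * s) ^ DIM('a) * \<dots> \<le> exp (C * s) ^ DIM('a) * (exp (2 * A s) * ((1 + \<eta>) * I + (1 + 1 / \<eta>) * d s))"
        by (intro mult_left_mono P_le[OF s(1) \<eta>]) auto
      finally show ?thesis .
    qed
    have A_lim: "(A \<longlongrightarrow> 0) (at_right 0)"
    proof -
      have "continuous_on {0..1} A"
        unfolding A_def using continuous_on_subset[OF \<alpha>]
        by (intro indefinite_integral_continuous_1 integrable_continuous_real) auto
      then have "(A \<longlongrightarrow> A 0) (at 0 within {0..1})" by (simp add: continuous_on_def)
      then show ?thesis by (simp add: at_within_Icc_at_right A_def)
    qed
    \<comment> \<open>The order of limits matters: \<open>s\<close> tends to 0 with \<eta> fixed,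
      because \<open>1 / \<eta>\<close> multiplies \<open>d s\<close>. Only afterwards does \<eta>
      tend to 0.\<close>
    have N_le_\<eta>: "N t \<le> (1 + \<eta>) * I" if \<eta>: "0 < \<eta>" for \<eta>
    proof (rule tendsto_lowerbound)
      have "((\<lambda>s. exp (C * s) ^ DIM('a) * (exp (2 * A s) * ((1 + \<eta>) * I + (1 + 1 / \<eta>) * d s))) \<longlongrightarrow>
          exp (C * 0) ^ DIM('a) * (exp (2 * 0) * ((1 + \<eta>) * I + (1 + 1 / \<eta>) * 0))) (at_right 0)"
        by (intro tendsto_intros A_lim d)
      then show "((\<lambda>s. exp (C * s) ^ DIM('a) * (exp (2 * A s) * ((1 + \<eta>) * I + (1 + 1 / \<eta>) * d s))) \<longlongrightarrow> (1 + \<eta>) * I) (at_right 0)"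
        by simp
      have "\<forall>\<^sub>F s in at_right 0. s \<in> {0<..<min 1 t}" using t by (intro eventually_at_right_real) auto
      then show "\<forall>\<^sub>F s in at_right 0. N t \<le> exp (C * s) ^ DIM('a) * (exp (2 * A s) * ((1 + \<eta>) * I + (1 + 1 / \<eta>) * d s))"
        by eventually_elim (intro N_le \<eta>, auto)
    qed simp
    have I: "0 \<le> I" by (simp add: I_def)
    have "N t \<le> I"
    proof (rule field_le_epsilon)
      fix e :: real assume "0 < e"
      then have "N t \<le> (1 + e / (I + 1)) * I" using I by (intro N_le_\<eta>) simp
      also have "\<dots> \<le> I + e" using I \<open>0 < e\<close> by (simp add: field_simps)
      finally show "N t \<le> I + e" .
    qed
    moreover have "N t = exp (2 * A t) * (LINT y|lebesgue_on (\<phi> t ` \<Omega>\<^sub>0). (T y t)\<^sup>2)"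
      by (simp add: N_def power_mult_distrib exp_double)
    ultimately have "exp (- 2 * A t) * (exp (2 * A t) * (LINT y|lebesgue_on (\<phi> t ` \<Omega>\<^sub>0). (T y t)\<^sup>2)) \<le> exp (- 2 * A t) * I"
      by (intro mult_left_mono) auto
    then show ?thesis
      by (simp add: mult.assoc[symmetric] exp_add[symmetric] A_def I_def moving_domain_def)
  qed
qed

theorem proposition9p2:
  fixes \<Omega>\<^sub>0 :: "'a::euclidean_space set"
    and V :: "'a \<Rightarrow> 'a" and \<phi> :: "real \<Rightarrow> 'a \<Rightarrow> 'a"
    and a T :: "'a \<Rightarrow> real \<Rightarrow> real" and T\<^sub>0 :: "'a \<Rightarrow> real"
    and \<alpha> \<gamma> :: "real \<Rightarrow> real" and \<alpha>\<^sub>1 :: real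
  assumes "bounded_smooth_open \<Omega>\<^sub>0"
    and "smooth_on V UNIV"
    and "is_flow V \<phi>"
    and "continuous_on {(y, t). t \<ge> 0 \<and> y \<in> closure (moving_domain \<phi> \<Omega>\<^sub>0 t)} (\<lambda>(y, t). a y t)"
    and "in_L2 T\<^sub>0 \<Omega>\<^sub>0"
    and "is_solution \<phi> \<Omega>\<^sub>0 a T\<^sub>0 T"
    and "smooth_on \<alpha> UNIV"
    and "\<forall>t\<ge>0. \<forall>y\<in>moving_domain \<phi> \<Omega>\<^sub>0 t. \<alpha> t \<le> a y t"
    and "\<forall>t. \<gamma> t = \<alpha> t - poincare_constant (moving_domain \<phi> \<Omega>\<^sub>0 t)"
    and "\<alpha>\<^sub>1 > 0"
    and "Liminf at_top (\<lambda>t. ereal ((1 / t) * integral {0..t} \<gamma>)) > ereal \<alpha>\<^sub>1"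
  shows "(\<forall>t\<ge>0.
            0 \<le> (LINT y|lebesgue_on (moving_domain \<phi> \<Omega>\<^sub>0 t). (T y t)\<^sup>2) \<and>
            (LINT y|lebesgue_on (moving_domain \<phi> \<Omega>\<^sub>0 t). (T y t)\<^sup>2)
              \<le> exp (- 2 * integral {0..t} \<gamma>) * (LINT x|lebesgue_on \<Omega>\<^sub>0. (T\<^sub>0 x)\<^sup>2)) \<and>
         ((\<lambda>t. exp (- 2 * integral {0..t} \<gamma>) * (LINT x|lebesgue_on \<Omega>\<^sub>0. (T\<^sub>0 x)\<^sup>2)) \<longlongrightarrow> 0) at_top"
proof -
  define I where "I = (LINT x|lebesgue_on \<Omega>\<^sub>0. (T\<^sub>0 x)\<^sup>2)"
  have I: "0 \<le> I" by (simp add: I_def)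
  have flow: "C11_flow V (\<lambda>x. frechet_derivative V (at x)) \<phi>"
    using assms(2,3) by (rule smooth_flow_C11)
  then interpret C11_flow V "\<lambda>x. frechet_derivative V (at x)" \<phi> .
  have \<alpha>: "continuous_on S \<alpha>" for S
    using assms(7) continuous_on_subset unfolding smooth_on_def by (metis Ck_on.simps(1) subset_UNIV)
  have "\<forall>\<^sub>F t in at_top. ereal ((1 / t) * integral {0..t} \<gamma>) > ereal \<alpha>\<^sub>1"
    using assms(11) by (rule less_LiminfD)
  with eventually_gt_at_top[of 0] have ev: "\<forall>\<^sub>F t in at_top. 0 < t \<and> integral {0..t} \<gamma> > \<alpha>\<^sub>1 * t"
    by eventually_elim (simp add: field_simps)
  text \<open>The Henstock-Kurzweil integral of a non-integrable function is \<open>0\<close>, so the lower bound on the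
    averages contains the integrability of \<open>\<gamma>\<close>.\<close>
  have \<gamma>_int: "\<gamma> integrable_on {0..t}" for t
  proof -
    have "\<forall>\<^sub>F s in at_top. (0 < s \<and> integral {0..s} \<gamma> > \<alpha>\<^sub>1 * s) \<and> t \<le> s"
      using ev eventually_ge_at_top[of t] by eventually_elim simp
    then obtain s where s: "0 < s" "integral {0..s} \<gamma> > \<alpha>\<^sub>1 * s" "t \<le> s"
      using eventually_happens'[OF trivial_limit_at_top_linorder] by blast
    then have "integral {0..s} \<gamma> \<noteq> 0" using assms(10) by (metis less_asym mult_pos_pos)
    then have "\<gamma> integrable_on {0..s}" using not_integrable_integral by blast
    then show ?thesis by (rule integrable_on_subinterval) (use s in auto)
  qed
  have bound: "(LINT y|lebesgue_on (moving_domain \<phi> \<Omega>\<^sub>0 t). (T y t)\<^sup>2) \<le> exp (- 2 * integral {0..t} \<gamma>) * I"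
    if t: "0 \<le> t" for t
  proof (cases "\<Omega>\<^sub>0 = {}")
    \<comment> \<open>Every constant is admissible for the empty set, so
      \<open>poincare_constant\<close> has no determined sign there. The integral over the empty set
      is 0, which settles this case.\<close>
    case True
    then show ?thesis using I by (simp add: moving_domain_def integral_restrict_space)
  next
    case False
    have "\<gamma> s \<le> \<alpha> s" for s
    proof -
      have "0 \<le> poincare_constant (\<phi> s ` \<Omega>\<^sub>0)"
        using False assms(1) by (intro poincare_constant_nonneg open_flow_image) (auto simp: bounded_smooth_open_def)
      then show ?thesis using assms(9) by (simp add: moving_domain_def)
    qed
    then have "integral {0..t} \<gamma> \<le> integral {0..t} \<alpha>"
      by (intro integral_le \<gamma>_int integrable_continuous_real \<alpha>) auto
    then have "exp (- 2 * integral {0..t} \<alpha>) * I \<le> exp (- 2 * integral {0..t} \<gamma>) * I"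
      using I by (intro mult_right_mono) auto
    then show ?thesis
      using solution_L2_decay[OF assms(1) flow assms(6,5) \<alpha> _ t] assms(8) unfolding I_def by fastforce
  qed
  have "((\<lambda>t. exp (- 2 * integral {0..t} \<gamma>) * I) \<longlongrightarrow> 0) at_top"
  proof (rule tendsto_mult_left_zero, rule tendsto_sandwich[OF _ _ tendsto_const])
    show "\<forall>\<^sub>F t in at_top. exp (- 2 * integral {0..t} \<gamma>) \<le> exp (- (2 * \<alpha>\<^sub>1 * t))"
      using ev by eventually_elim simp
    have "filterlim (\<lambda>t. 2 * \<alpha>\<^sub>1 * t) at_top at_top"
      using assms(10) by (intro filterlim_tendsto_pos_mult_at_top[OF tendsto_const _ filterlim_ident]) auto
    then show "((\<lambda>t. exp (- (2 * \<alpha>\<^sub>1 * t))) \<longlongrightarrow> 0) at_top"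
      by (intro filterlim_compose[OF exp_at_bot]) (simp add: filterlim_uminus_at_top[symmetric])
  qed simp
  then show ?thesis using bound unfolding I_def by (simp add: Bochner_Integration.integral_nonneg)
qed

end
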